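(* Let $(\phi_t)$ be a holomorphic semigroup, not a group, in $\mathbb{D}$ with Denjoy-Wolff point $\tau\in\overline{\mathbb{D}}$. Suppose $\sigma\in\partial\mathbb{D}$ is a super-repelling fixed point of $(\phi_t)$. Assume $\gamma_j:[0,+\infty)\to\mathbb{D}$, $j=1,2$, are backward orbits of $(\phi_t)$ converging to $\sigma$ (as $t\to+\infty$). Then either $\gamma_1([0,+\infty))\subseteq\gamma_2([0,+\infty))$ or $\gamma_2([0,+\infty))\subseteq\gamma_1([0,+\infty))$. In particular, up to re-parameterization, there is at most one maximal invariant curve $\gamma:(-\infty,+\infty)\to\mathbb{D}$ for $(\phi_t)$ with starting point $\sigma$.
   Context: $\mathbb{D}$ is the open unit disc in $\mathbb{C}$. A holomorphic semigroup in $\mathbb{D}$ is a family $(\phi_t)_{t\ge0}$ of holomorphic self-maps of $\mathbb{D}$ with $\phi_0=\mathrm{id}$, $\phi_{t+s}=\phi_t\circ\phi_s$, continuous in $t$ for uniform convergence on compacta. It is a group if $\phi_t$ is an automorphism of $\mathbb{D}$ for some (equivalently all) $t>0$. If it is not a group, the Denjoy-Wolff point is the unique $\tau\in\overline{\mathbb{D}}$ such that $\phi_t\to\tau$ uniformly on compacta as $t\to+\infty$. $\angle\lim$ denotes the non-tangential limit. A point $\sigma\in\partial\mathbb{D}$ is a boundary fixed point if $\angle\lim_{z\to\sigma}\phi_t(z)=\sigma$ for all $t\ge0$. It is a boundary regular fixed point if moreover there is $\mu\in\mathbb{R}$ with $\angle\lim_{z\to\sigma}\phi_t'(z)=e^{-\mu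 t}$ for all $t\ge0$. A boundary fixed point that is not regular is called super-repelling. A backward orbit is a continuous curve $\gamma:[0,+\infty)\to\mathbb{D}$ with $\phi_s(\gamma(t))=\gamma(t-s)$ for all $t>0$, $0\le s\le t$. For $a\in[-\infty,0)$, a maximal invariant curve is a continuous curve $\gamma:(a,+\infty)\to\mathbb{D}$ such that $\phi_s(\gamma(t))=\gamma(t+s)$ for all $s\ge0$, $t\in(a,+\infty)$, $\lim_{t\to+\infty}\gamma(t)=\tau$, and $\lim_{t\to a^+}\gamma(t)=p$ for some $p\in\partial\mathbb{D}$, called the starting point of $\gamma$. (A maximal invariant curve whose starting point is a boundary fixed point necessarily has $a=-\infty$.) *)

theory Defs
  imports "HOL-Complex_Analysis.Complex_Analysis"
begin

abbreviation unit_disc :: "complex set" where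
  "unit_disc \<equiv> ball 0 1"

abbreviation unit_circle :: "complex set" where
  "unit_circle \<equiv> sphere 0 1"

text \<open>
  A family of self-maps of the disc is a function \<open>\<phi> :: real \<Rightarrow> complex \<Rightarrow> complex\<close>; only
  the values \<open>\<phi> t z\<close> with \<open>t \<ge> 0\<close> and \<open>z\<close> in the disc are meaningful. Likewise, curves are
  total functions of a real parameter, constrained only on their interval of definition.
\<close>

definition holomorphic_semigroup :: "(real \<Rightarrow> complex \<Rightarrow> complex) \<Rightarrow> bool" where
  "holomorphic_semigroup \<phi> \<longleftrightarrow>
     (\<forall>t\<ge>0. \<phi> t holomorphic_on unit_disc \<and> \<phi> t ` unit_disc \<subseteq> unit_disc) \<and>
     (\<forall>z\<in>unit_disc. \<phi> 0 z = z) \<and>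
     (\<forall>t\<ge>0. \<forall>s\<ge>0. \<forall>z\<in>unit_disc. \<phi> (t + s) z = \<phi> t (\<phi> s z)) \<and>
     (\<forall>t\<ge>0. \<forall>K. compact K \<and> K \<subseteq> unit_disc \<longrightarrow>
        uniform_limit K \<phi> (\<phi> t) (at t within {0..}))"

definition disc_automorphism :: "(complex \<Rightarrow> complex) \<Rightarrow> bool" where
  "disc_automorphism f \<longleftrightarrow>
     f holomorphic_on unit_disc \<and> f ` unit_disc \<subseteq> unit_disc \<and>
     (\<exists>g. g holomorphic_on unit_disc \<and> g ` unit_disc \<subseteq> unit_disc \<and>
        (\<forall>z\<in>unit_disc. g (f z) = z) \<and> (\<forall>z\<in>unit_disc. f (g z) = z))"

definition is_group :: "(real \<Rightarrow> complex \<Rightarrow> complex) \<Rightarrow> bool" where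
  "is_group \<phi> \<longleftrightarrow> (\<exists>t>0. disc_automorphism (\<phi> t))"

text \<open>Uniqueness of \<open>\<tau>\<close> is automatic, since it is a limit.\<close>

definition denjoy_wolff_point :: "(real \<Rightarrow> complex \<Rightarrow> complex) \<Rightarrow> complex \<Rightarrow> bool" where
  "denjoy_wolff_point \<phi> \<tau> \<longleftrightarrow>
     \<tau> \<in> cball 0 1 \<and>
     (\<forall>K. compact K \<and> K \<subseteq> unit_disc \<longrightarrow> uniform_limit K \<phi> (\<lambda>z. \<tau>) at_top)"

definition stolz_region :: "complex \<Rightarrow> real \<Rightarrow> complex set" where
  "stolz_region \<sigma> R = {z \<in> unit_disc. norm (\<sigma> - z) < R * (1 - norm z)}"

definition has_angular_limit :: "(complex \<Rightarrow> complex) \<Rightarrow> complex \<Rightarrow> complex \<Rightarrow> bool" where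
  "has_angular_limit f \<sigma> L \<longleftrightarrow> (\<forall>R>1. (f \<longlongrightarrow> L) (at \<sigma> within stolz_region \<sigma> R))"

definition boundary_fixed_point :: "(real \<Rightarrow> complex \<Rightarrow> complex) \<Rightarrow> complex \<Rightarrow> bool" where
  "boundary_fixed_point \<phi> \<sigma> \<longleftrightarrow>
     \<sigma> \<in> unit_circle \<and> (\<forall>t\<ge>0. has_angular_limit (\<phi> t) \<sigma> \<sigma>)"

definition boundary_regular_fixed_point :: "(real \<Rightarrow> complex \<Rightarrow> complex) \<Rightarrow> complex \<Rightarrow> bool" where
  "boundary_regular_fixed_point \<phi> \<sigma> \<longleftrightarrow>
     boundary_fixed_point \<phi> \<sigma> \<and>
     (\<exists>\<mu>::real. \<forall>t\<ge>0. has_angular_limit (deriv (\<phi> t)) \<sigma> (of_real (exp (- \<mu> * t))))"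

definition super_repelling_fixed_point :: "(real \<Rightarrow> complex \<Rightarrow> complex) \<Rightarrow> complex \<Rightarrow> bool" where
  "super_repelling_fixed_point \<phi> \<sigma> \<longleftrightarrow>
     boundary_fixed_point \<phi> \<sigma> \<and> \<not> boundary_regular_fixed_point \<phi> \<sigma>"

definition backward_orbit :: "(real \<Rightarrow> complex \<Rightarrow> complex) \<Rightarrow> (real \<Rightarrow> complex) \<Rightarrow> bool" where
  "backward_orbit \<phi> \<gamma> \<longleftrightarrow>
     continuous_on {0..} \<gamma> \<and> \<gamma> ` {0..} \<subseteq> unit_disc \<and>
     (\<forall>t>0. \<forall>s. 0 \<le> s \<and> s \<le> t \<longrightarrow> \<phi> s (\<gamma> t) = \<gamma> (t - s))"

text \<open>
  The predicate says that \<open>\<gamma>\<close>, defined on \<open>(a, +\<infinity>)\<close>, is a maximal invariant curve with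
  starting point \<open>p\<close>, where \<open>\<tau>\<close> is the Denjoy-Wolff point of \<open>\<phi>\<close>. The last conjunct is
  \<open>\<gamma> t \<longlongrightarrow> p\<close> as \<open>t\<close> tends to \<open>a\<close> from the right; composing with \<open>real_of_ereal\<close> covers both
  finite \<open>a\<close> and \<open>a = -\<infinity>\<close> (see \<open>ereal_tendsto_simps1\<close>).
\<close>

definition maximal_invariant_curve ::
  "(real \<Rightarrow> complex \<Rightarrow> complex) \<Rightarrow> complex \<Rightarrow> ereal \<Rightarrow> (real \<Rightarrow> complex) \<Rightarrow> complex \<Rightarrow> bool" where
  "maximal_invariant_curve \<phi> \<tau> a \<gamma> p \<longleftrightarrow>
     a < 0 \<and>
     continuous_on {t. a < ereal t} \<gamma> \<and> \<gamma> ` {t. a < ereal t} \<subseteq> unit_disc \<and>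
     (\<forall>s\<ge>0. \<forall>t. a < ereal t \<longrightarrow> \<phi> s (\<gamma> t) = \<gamma> (t + s)) \<and>
     (\<gamma> \<longlongrightarrow> \<tau>) at_top \<and>
     p \<in> unit_circle \<and> ((\<gamma> \<circ> real_of_ereal) \<longlongrightarrow> p) (at_right a)"

end

theory Submission
  imports Defs
begin

text \<open>
  Two backward orbits landing at \<open>\<sigma>\<close> extend to full orbits \<open>\<Gamma>\<^sub>1\<close>, \<open>\<Gamma>\<^sub>2\<close>, and by injectivity of the
  \<open>\<phi> t\<close> it suffices that these meet. If they do not, \<open>\<Gamma>\<^sub>1\<close>, \<open>\<Gamma>\<^sub>2\<close>, \<open>\<sigma>\<close> and the Denjoy-Wolff point
  \<open>\<tau>\<close> form a Jordan curve. For zero-free bounded \<open>h\<close> on the disc, Lindelof's theorem applied to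
  \<open>exp (log h / n)\<close> shows that \<open>log h\<close> has the same increment along \<open>\<Gamma>\<^sub>1\<close> and \<open>\<Gamma>\<^sub>2\<close>; taking
  \<open>h = \<phi> t - w\<close> and \<open>h = (\<phi> t - \<phi> t z) / (id - z)\<close> one sees that the inside \<open>\<Omega>\<close> of the curve lies in
  \<open>\<phi> t ` unit_disc\<close> and that \<open>\<phi> t\<close> has a holomorphic inverse mapping \<open>\<Omega>\<close> into itself. Backward
  orbits of suitable points of \<open>\<Omega>\<close> converge to \<open>\<sigma>\<close>, and by the Schwarz-Pick lemma on \<open>\<Omega>\<close> their
  hyperbolic steps are bounded. By the Julia-Wolff-Caratheodory theorem \<open>\<phi> t\<close> then has a finite
  angular derivative at \<open>\<sigma>\<close>, multiplicative and locally bounded in \<open>t\<close>, hence of the form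
  \<open>exp (- \<mu> * t)\<close>, so \<open>\<sigma>\<close> is regular. The same argument along forward orbits excludes \<open>\<sigma> = \<tau>\<close>.
\<close>

section \<open>The Schwarz-Pick lemma and the Julia-Wolff-Caratheodory theorem in the half-plane\<close>

text \<open>\<open>\<phi> t\<close> acts on each full orbit as the time shift by \<open>t\<close>.
  Hence along an orbit \<open>\<phi> t - w\<close> is the shifted curve seen from \<open>w\<close>,
  and its logarithmic increment is \<open>2 * pi * \<i>\<close> times the winding number of the arc
  around \<open>w\<close>. Equal increments along both arcs say that the closed curve has winding
  number 0 around every \<open>w\<close> off the curve and outside the image; for the difference
  quotient they say that \<open>z\<close> and \<open>\<phi> t z\<close> have the same winding
  number. The obstacle is that the semigroup contracts the hyperbolic metric of the disc, so that
  steps may grow without bound when time runs backward. The domain \<Omega> supplies the missing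
  bound: all inverse maps are defined on it, hence contract from the hyperbolic metric of \<Omega>
  to that of the disc, and the distance in \<Omega> between a point and its preimage under
  \<open>\<phi> t\<close> controls every later step. Nothing is known about the direction in which
  these backward orbits approach \<sigma>; Julia's lemma is therefore proved for arbitrary, possibly
  tangential, sequences.\<close>

abbreviation right_half_plane :: "complex set" where
  "right_half_plane \<equiv> {w. 0 < Re w}"

text \<open>For points of \<open>right_half_plane\<close> the quotient
  \<open>norm (a - b) / norm (a + cnj b)\<close> is the pseudo-hyperbolic distance. The identity
  converts statements about it into statements about real parts.\<close>

lemma norm_add_cnj_sq: "(norm (a + cnj b))\<^sup>2 = (norm (a - b))\<^sup>2 + 4 * Re a * Re b"
  by (simp only: cmod_power2) (simp add: power2_eq_square algebra_simps)

lemma norm_diff_less_add_cnj: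
  assumes "0 < Re a" "0 < Re b"
  shows "norm (a - b) < norm (a + cnj b)"
proof -
  have "(norm (a - b))\<^sup>2 < (norm (a + cnj b))\<^sup>2"
    using assms by (simp add: norm_add_cnj_sq)
  then show ?thesis
    by (rule power_less_imp_less_base) simp
qed

lemma add_cnj_nonzero: "0 < Re a \<Longrightarrow> 0 < Re b \<Longrightarrow> a + cnj b \<noteq> 0"
  by (metis add_pos_pos complex_cnj(1) less_irrefl plus_complex.sel(1) zero_complex.sel(1) cnj.sel(1))

text \<open>The classical Schwarz lemma for \<open>f\<close> followed by the Moebius map that takes
  the half-plane to the disc and \<open>f 0\<close> to 0.\<close>

lemma Schwarz_disc_half_plane:
  assumes hol: "f holomorphic_on ball 0 1"
    and pos: "\<And>z. z \<in> ball 0 1 \<Longrightarrow> 0 < Re (f z)"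
    and z: "z \<in> ball 0 1"
  shows "norm (f z - f 0) \<le> norm z * norm (f z + cnj (f 0))"
proof -
  define g where "g = (\<lambda>z. (f z - f 0) / (f z + cnj (f 0)))"
  have nz: "f u + cnj (f 0) \<noteq> 0" if "u \<in> ball 0 1" for u
    using add_cnj_nonzero[OF pos[OF that] pos[of 0]] by simp
  have "g holomorphic_on ball 0 1"
    unfolding g_def by (intro holomorphic_intros hol) (use nz in auto)
  moreover have "g 0 = 0" by (simp add: g_def)
  moreover have "norm (g u) < 1" if "norm u < 1" for u
  proof -
    have u: "u \<in> ball 0 1" using that by simp
    show ?thesis
      using norm_diff_less_add_cnj[OF pos[OF u] pos[of 0]] nz[OF u]
      by (simp add: g_def norm_divide divide_less_eq)
  qed
  ultimately have "norm (g z) \<le> norm z"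
    using Schwarz_Lemma(1)[of g z] z by auto
  then show ?thesis
    using nz[OF z] by (simp add: g_def norm_divide divide_le_eq)
qed

lemma Schwarz_Pick_half_plane:
  assumes hol: "F holomorphic_on right_half_plane"
    and pos: "\<And>w. 0 < Re w \<Longrightarrow> 0 < Re (F w)"
    and a: "0 < Re a" and b: "0 < Re b"
  shows "norm (F a - F b) * norm (a + cnj b) \<le> norm (a - b) * norm (F a + cnj (F b))"
proof -
  \<comment> \<open>\<open>m\<close> is the Moebius map of the disc onto the half-plane with
    \<open>m 0 = b\<close>; the point \<open>z\<close> defined further down is its preimage of
    \<open>a\<close>.\<close>
  define m where "m = (\<lambda>z. (b + cnj b * z) / (1 - z))"
  have m_pos: "0 < Re (m z)" if "z \<in> ball 0 1" for z
  proof -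
    have "z \<noteq> 1" using that by auto
    then have n0: "1 - z \<noteq> 0" by simp
    have "m z = ((b + cnj b * z) * cnj (1 - z)) / of_real ((norm (1 - z))\<^sup>2)"
      unfolding m_def complex_norm_square using n0 by simp
    then have "Re (m z) = Re ((b + cnj b * z) * cnj (1 - z)) / (norm (1 - z))\<^sup>2"
      by (simp only: Re_divide_of_real)
    also have "Re ((b + cnj b * z) * cnj (1 - z)) = Re b * (1 - (norm z)\<^sup>2)"
      by (simp only: cmod_power2) (simp add: power2_eq_square algebra_simps)
    also have "\<dots> / (norm (1 - z))\<^sup>2 > 0"
      using that b n0 by (intro divide_pos_pos mult_pos_pos) (auto simp: power_less_one_iff abs_square_less_1)
    finally show ?thesis .
  qed
  have "m holomorphic_on ball 0 1"
    unfolding m_def by (intro holomorphic_intros) auto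
  then have holf: "(F \<circ> m) holomorphic_on ball 0 1"
    using hol m_pos by (intro holomorphic_on_compose_gen[of m _ F right_half_plane]) auto
  define z where "z = (a - b) / (a + cnj b)"
  have n: "a + cnj b \<noteq> 0" by (rule add_cnj_nonzero[OF a b])
  have zb: "z \<in> ball 0 1"
    using norm_diff_less_add_cnj[OF a b] n by (simp add: z_def norm_divide divide_less_eq)
  have bb: "b + cnj b \<noteq> 0" by (rule add_cnj_nonzero[OF b b])
  have "1 - z = (b + cnj b) / (a + cnj b)" using n by (simp add: z_def field_simps)
  moreover have "b + cnj b * z = a * (b + cnj b) / (a + cnj b)" using n by (simp add: z_def field_simps)
  ultimately have "m z = a" using n bb by (simp add: m_def)
  moreover have "m 0 = b" by (simp add: m_def)
  ultimately have "norm (F a - F b) \<le> norm z * norm (F a + cnj (F b))"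
    using Schwarz_disc_half_plane[OF holf _ zb] m_pos pos by simp
  then show ?thesis using n by (simp add: z_def norm_divide field_simps)
qed

text \<open>After squaring, \<open>norm_add_cnj_sq\<close> makes the products of differences cancel.
  In the resulting form real parts can be compared directly, which is what Julia's lemma and the
  growth estimate require.\<close>

lemma Schwarz_Pick_half_plane_sq:
  assumes hol: "F holomorphic_on right_half_plane"
    and pos: "\<And>w. 0 < Re w \<Longrightarrow> 0 < Re (F w)"
    and a: "0 < Re a" and b: "0 < Re b"
  shows "Re a * Re b * (norm (F a + cnj (F b)))\<^sup>2 \<le> Re (F a) * Re (F b) * (norm (a + cnj b))\<^sup>2"
proof -
  have "(norm (F a - F b) * norm (a + cnj b))\<^sup>2 \<le> (norm (a - b) * norm (F a + cnj (F b)))\<^sup>2"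
    by (rule power_mono[OF Schwarz_Pick_half_plane[OF assms]]) auto
  then have "(norm (F a - F b))\<^sup>2 * (norm (a + cnj b))\<^sup>2 \<le> (norm (a - b))\<^sup>2 * (norm (F a + cnj (F b)))\<^sup>2"
    by (simp add: power_mult_distrib)
  then show ?thesis by (simp add: norm_add_cnj_sq algebra_simps)
qed

text \<open>\<open>half_plane_near M\<close> is a Euclidean substitute for ``hyperbolic distance bounded in terms
  of \<open>M\<close>''.\<close>

definition half_plane_near :: "real \<Rightarrow> complex \<Rightarrow> complex \<Rightarrow> bool" where
  "half_plane_near M a b \<longleftrightarrow> norm (a - b) \<le> M * Re a \<and> norm (a - b) \<le> M * Re b"

lemma half_plane_near_sym: "half_plane_near M a b \<longleftrightarrow> half_plane_near M b a"
  by (auto simp: half_plane_near_def norm_minus_commute)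

lemma half_plane_near_Re:
  assumes "half_plane_near M a b" shows "Re b \<le> (1 + M) * Re a"
proof -
  have "Re b - Re a \<le> norm (a - b)"
    by (metis complex_Re_le_cmod minus_complex.simps(1) norm_minus_commute)
  then show ?thesis using assms by (simp add: half_plane_near_def algebra_simps)
qed

lemma half_plane_near_trans_aux:
  assumes "norm (a - b) \<le> M * Re a" "Re b \<le> (1 + M) * Re a" "norm (b - c) \<le> N * Re b" "0 \<le> N"
  shows "norm (a - c) \<le> (M + N + M * N) * Re a"
proof -
  have "norm (a - c) \<le> norm (a - b) + norm (b - c)"
    using norm_triangle_ineq[of "a - b" "b - c"] by simp
  also have "\<dots> \<le> M * Re a + N * ((1 + M) * Re a)"
    using assms(1) order_trans[OF assms(3) mult_left_mono[OF assms(2,4)]] by (rule add_mono)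
  finally show ?thesis by (simp add: algebra_simps)
qed

text \<open>The constant is \<open>(1 + M) * (1 + N) - 1\<close>: real parts change by factors of at
  most \<open>1 + M\<close> and \<open>1 + N\<close>, and these multiply.\<close>

lemma half_plane_near_trans:
  assumes "half_plane_near M a b" "half_plane_near N b c" "0 \<le> M" "0 \<le> N"
  shows "half_plane_near (M + N + M * N) a c"
proof -
  have "norm (a - c) \<le> (M + N + M * N) * Re a"
    using assms half_plane_near_Re[OF assms(1)]
    by (intro half_plane_near_trans_aux[of a b]) (auto simp: half_plane_near_def)
  moreover have "norm (c - a) \<le> (N + M + N * M) * Re c"
    using assms half_plane_near_Re[OF half_plane_near_sym[THEN iffD1, OF assms(2)]]
    by (intro half_plane_near_trans_aux[of c b]) (auto simp: half_plane_near_def norm_minus_commute)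
  ultimately show ?thesis
    by (auto simp: half_plane_near_def norm_minus_commute algebra_simps)
qed

text \<open>On half the radius the Schwarz lemma gives
  \<open>2 * norm (f z - f p) \<le> norm (f z + cnj (f p))\<close>; comparing the right side with
  \<open>2 * Re (f p)\<close> and with \<open>2 * Re (f z)\<close> yields the constant 2. It depends
  neither on \<open>f\<close> nor on the ball, hence serves a whole family of functions at
  once.\<close>

lemma half_plane_near_ball:
  assumes hol: "f holomorphic_on ball p r" and r: "0 < r"
    and pos: "\<And>z. z \<in> ball p r \<Longrightarrow> 0 < Re (f z)"
    and z: "dist p z \<le> r / 2"
  shows "half_plane_near 2 (f p) (f z)"
proof -
  define g where "g = (\<lambda>u. f (p + of_real r * u))"
  have sub: "p + of_real r * u \<in> ball p r" if "u \<in> ball 0 1" for u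
    using that r by (simp add: dist_norm norm_mult)
  have "(f \<circ> (\<lambda>u. p + of_real r * u)) holomorphic_on ball 0 1"
    by (rule holomorphic_on_compose_gen[OF _ hol]) (use sub in \<open>auto intro!: holomorphic_intros\<close>)
  then have holg: "g holomorphic_on ball 0 1" by (simp add: g_def o_def)
  define u where "u = (z - p) / of_real r"
  have nu: "norm u \<le> 1/2" using z r by (simp add: u_def norm_divide dist_norm norm_minus_commute field_simps)
  have gu: "g u = f z" using r by (simp add: g_def u_def)
  have g0: "g 0 = f p" by (simp add: g_def)
  have "norm (g u - g 0) \<le> norm u * norm (g u + cnj (g 0))"
    using nu by (intro Schwarz_disc_half_plane[OF holg]) (use pos sub in \<open>auto simp: g_def\<close>)
  also have "\<dots> \<le> 1/2 * norm (g u + cnj (g 0))"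
    using nu by (intro mult_right_mono) auto
  finally have le: "2 * norm (f z - f p) \<le> norm (f z + cnj (f p))" by (simp add: gu g0)
  have rp: "Re (f p) > 0" "Re (f z) > 0"
    using pos[of p] pos[of z] z r by auto
  have cn: "norm (w + cnj w) = 2 * Re w" if "Re w > 0" for w
    using that by (simp add: complex_add_cnj)
  have "f z + cnj (f p) = (f z - f p) + (f p + cnj (f p))" by simp
  then have 1: "norm (f z + cnj (f p)) \<le> norm (f z - f p) + 2 * Re (f p)"
    using norm_triangle_ineq cn[OF rp(1)] by metis
  have "norm (cnj (f z) - cnj (f p)) = norm (f z - f p)"
    by (metis complex_cnj_diff complex_mod_cnj)
  moreover have "f z + cnj (f p) = (f z + cnj (f z)) - (cnj (f z) - cnj (f p))" by simp
  ultimately have 2: "norm (f z + cnj (f p)) \<le> 2 * Re (f z) + norm (f z - f p)"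
    using norm_triangle_ineq4 cn[OF rp(2)] by metis
  show ?thesis using le 1 2 by (auto simp: half_plane_near_def norm_minus_commute)
qed

text \<open>This is the contraction of the hyperbolic metric by all \<open>g n\<close> simultaneously; a chain of
  discs replaces the hyperbolic metric of \<open>W\<close>.\<close>

lemma half_plane_near_family:
  fixes g :: "nat \<Rightarrow> complex \<Rightarrow> complex"
  assumes W: "open W" "connected W"
    and hol: "\<And>n. g n holomorphic_on W" and pos: "\<And>n z. z \<in> W \<Longrightarrow> 0 < Re (g n z)"
    and ab: "a \<in> W" "b \<in> W"
  obtains M where "0 \<le> M" "\<And>n. half_plane_near M (g n a) (g n b)"
proof -
  define R where "R = (\<lambda>a b. \<exists>M\<ge>0. \<forall>n. half_plane_near M (g n a) (g n b))"
  have sym: "R y x" if "R x y" for x y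
    using that half_plane_near_sym[of _ "g _ x" "g _ y"] unfolding R_def by simp
  have trans: "R x z" if "R x y" "R y z" for x y z
  proof -
    obtain M where M: "M \<ge> 0" "\<And>n. half_plane_near M (g n x) (g n y)"
      using \<open>R x y\<close> unfolding R_def by auto
    obtain N where N: "N \<ge> 0" "\<And>n. half_plane_near N (g n y) (g n z)"
      using \<open>R y z\<close> unfolding R_def by auto
    have "half_plane_near (M + N + M * N) (g n x) (g n z)" for n
      by (rule half_plane_near_trans[OF M(2) N(2) M(1) N(1)])
    then show ?thesis unfolding R_def using M(1) N(1) by (intro exI[of _ "M + N + M * N"]) simp
  qed
  have "R a b"
  proof (rule connected_equivalence_relation[OF W(2) ab, of R])
    show "R y x" if "R x y" for x y using that by (rule sym)
    show "R x z" if "R x y" "R y z" for x y z using that by (rule trans)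
    fix p assume p: "p \<in> W"
    then obtain r where r: "r > 0" "ball p r \<subseteq> W" using W(1) openE by blast
    have "R p x" if "x \<in> ball p (r/2)" for x
      unfolding R_def
    proof (intro exI[of _ 2] conjI allI)
      fix n show "half_plane_near 2 (g n p) (g n x)"
        using r that pos by (intro half_plane_near_ball[of _ p r] holomorphic_on_subset[OF hol]) auto
    qed simp
    moreover have "ball p (r/2) \<subseteq> W" using r by auto
    ultimately show "\<exists>T. openin (top_of_set W) T \<and> p \<in> T \<and> (\<forall>x\<in>T. R p x)"
      using r by (intro exI[of _ "ball p (r/2)"]) (auto simp: open_subset)
  qed
  then show ?thesis using that unfolding R_def by blast
qed

section \<open>Julia's lemma and the angular derivative at infinity\<close>

text \<open>Apply Schwarz-Pick to \<open>z\<close> and a far point \<open>w n\<close>. Nearness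
  bounds \<open>Re (F (w n)) / Re (w n)\<close> by \<open>1 + M\<close> and
  \<open>norm (w n) / norm (F (w n))\<close> by \<open>1 + M\<close>, the latter entering squared.
  The 16 is the price of using one large \<open>n\<close> instead of a limit: two inequalities each
  lose a factor 2 before squaring.\<close>

lemma Julia_half_plane:
  assumes hol: "F holomorphic_on right_half_plane"
    and pos: "\<And>w. 0 < Re w \<Longrightarrow> 0 < Re (F w)"
    and w: "\<And>n::nat. 0 < Re (w n)" "filterlim w at_infinity sequentially"
    and near: "\<And>n. half_plane_near M (w n) (F (w n))" and M: "0 \<le> M"
    and z: "0 < Re z"
  shows "Re z / (16 * (1 + M)^3) \<le> Re (F z)"
proof -
  \<comment> \<open>Once \<open>norm (w n)\<close> exceeds \<open>K\<close>, both \<open>z\<close>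
    and \<open>F z\<close> are negligible against it, even after multiplication by
    \<open>2 * (1 + M)\<close>.\<close>
  define K where "K = 2 * (1 + M) * (norm (F z) + norm z + 1)"
  have "eventually (\<lambda>n. K \<le> norm (w n)) sequentially"
    using filterlim_at_infinity_imp_norm_at_top[OF w(2)] unfolding filterlim_at_top by blast
  then obtain n where n: "K \<le> norm (w n)" by (metis eventually_sequentially order_refl)
  define x where "x = norm (w n)"
  define v where "v = F (w n)"
  have vpos: "Re v > 0" using pos w by (simp add: v_def)
  have K: "K \<ge> 2 * norm z" "K > 0" "K \<ge> 2 * (1 + M) * norm (F z)"
  proof -
    have "0 \<le> M * norm (F z)" "0 \<le> M * norm z" using M by auto
    moreover have "0 < norm (F z) + norm z + 1" by (intro add_nonneg_pos add_nonneg_nonneg) auto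
    then have "K > 0" unfolding K_def using M by (intro mult_pos_pos) auto
    ultimately show "K \<ge> 2 * norm z" "K > 0" "K \<ge> 2 * (1 + M) * norm (F z)"
      using M norm_ge_zero[of "F z"] norm_ge_zero[of z] by (simp_all add: K_def algebra_simps add_pos_nonneg del: norm_ge_zero)
  qed
  have x: "x > 0" "norm z \<le> x" "2 * (1 + M) * norm (F z) \<le> x" using n K by (auto simp: x_def)
  have "norm (w n - v) \<le> M * Re v" using near[of n] by (simp add: half_plane_near_def v_def)
  also have "\<dots> \<le> M * norm v" using M by (intro mult_left_mono complex_Re_le_cmod)
  finally have "x \<le> (1 + M) * norm v"
    using norm_triangle_ineq[of "w n - v" v] by (simp add: x_def algebra_simps)
  moreover have "norm v \<le> norm (F z + cnj v) + norm (F z)"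
    using norm_triangle_ineq4[of "F z + cnj v" "F z"] by (simp add: add.commute)
  ultimately have "x \<le> (1 + M) * norm (F z + cnj v) + (1 + M) * norm (F z)"
    using M by (smt (verit) distrib_left mult_left_mono)
  then have A: "x \<le> 2 * (1 + M) * norm (F z + cnj v)" using x(3) by linarith
  have B: "norm (z + cnj (w n)) \<le> 2 * x"
    using norm_triangle_ineq[of z "cnj (w n)"] x(2) by (simp add: x_def)
  have C: "Re v \<le> (1 + M) * Re (w n)"
    using half_plane_near_Re[OF near[of n]] by (simp add: v_def)
  have "Re z * Re (w n) * (norm (F z + cnj v))\<^sup>2 \<le> Re (F z) * Re v * (norm (z + cnj (w n)))\<^sup>2"
    unfolding v_def by (rule Schwarz_Pick_half_plane_sq[OF hol pos z w(1)])
  also have "\<dots> \<le> Re (F z) * ((1 + M) * Re (w n)) * (2 * x)\<^sup>2"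
    using B C pos[OF z] vpos by (intro mult_mono power_mono) auto
  finally have D: "Re z * Re (w n) * (norm (F z + cnj v))\<^sup>2 \<le> Re (F z) * ((1 + M) * Re (w n)) * (2 * x)\<^sup>2" .
  have "Re z * Re (w n) * x\<^sup>2 \<le> Re z * Re (w n) * (2 * (1 + M) * norm (F z + cnj v))\<^sup>2"
    using A x z w(1)[of n] by (intro mult_left_mono power_mono) auto
  also have "\<dots> = 4 * (1+M)\<^sup>2 * (Re z * Re (w n) * (norm (F z + cnj v))\<^sup>2)"
    by (simp only: power_mult_distrib) (simp add: algebra_simps)
  also have "\<dots> \<le> 4 * (1+M)\<^sup>2 * (Re (F z) * ((1 + M) * Re (w n)) * (2 * x)\<^sup>2)"
    using D by (intro mult_left_mono) auto
  also have "\<dots> = (16 * (1+M)^3 * Re (F z)) * (Re (w n) * x\<^sup>2)"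
    by (simp add: power2_eq_square power3_eq_cube)
  finally have "Re z * (Re (w n) * x\<^sup>2) \<le> (16 * (1+M)^3 * Re (F z)) * (Re (w n) * x\<^sup>2)" by (simp only: mult.assoc)
  moreover have "Re (w n) * x\<^sup>2 > 0" using w(1) x by simp
  ultimately have "Re z \<le> 16 * (1+M)^3 * Re (F z)" by (meson mult_le_cancel_right_pos)
  then show ?thesis using M by (simp add: divide_le_eq mult.commute)
qed

text \<open>Estimating \<open>Re (G w)\<close> by \<open>norm (G w + cnj (G v))\<close> cancels one
  power of the latter in the squared Schwarz-Pick inequality. In a sector
  \<open>(norm w)\<^sup>2 / Re w\<close> is comparable to \<open>norm w\<close>, so a small ratio
  \<open>Re (G v) / Re v\<close> at a single point forces slow growth in the whole sector.\<close>

lemma half_plane_growth: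
  assumes hol: "G holomorphic_on right_half_plane"
    and pos: "\<And>w. 0 < Re w \<Longrightarrow> 0 < Re (G w)"
    and w: "0 < Re w" and v: "0 < Re v"
  shows "norm (G w) \<le> norm (G v) + Re (G v) / Re v * ((norm (w + cnj v))\<^sup>2 / Re w)"
proof -
  define A where "A = norm (G w + cnj (G v))"
  have Apos: "A > 0" using add_cnj_nonzero[OF pos[OF w] pos[OF v]] by (simp add: A_def)
  have "Re (G w) \<le> Re (G w + cnj (G v))" using pos[OF v] by simp
  also have "\<dots> \<le> A" unfolding A_def by (rule complex_Re_le_cmod)
  finally have le: "Re (G w) \<le> A" .
  have "Re w * Re v * A\<^sup>2 \<le> Re (G w) * Re (G v) * (norm (w + cnj v))\<^sup>2"
    unfolding A_def by (rule Schwarz_Pick_half_plane_sq[OF hol pos w v])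
  also have "\<dots> \<le> A * Re (G v) * (norm (w + cnj v))\<^sup>2"
    using le pos[OF v] by (intro mult_right_mono) auto
  finally have "A * (Re w * Re v * A) \<le> A * (Re (G v) * (norm (w + cnj v))\<^sup>2)"
    by (simp add: power2_eq_square algebra_simps)
  then have "Re w * Re v * A \<le> Re (G v) * (norm (w + cnj v))\<^sup>2"
    using Apos by simp
  then have "A \<le> Re (G v) / Re v * ((norm (w + cnj v))\<^sup>2 / Re w)"
    using w v by (simp add: field_simps)
  moreover have "norm (G w) \<le> A + norm (G v)"
    using norm_triangle_ineq4[of "G w + cnj (G v)" "cnj (G v)"] by (simp add: A_def)
  ultimately show ?thesis by linarith
qed

text \<open>\<open>c\<close> is the infimum of \<open>Re (F w) / Re w\<close>. Subtracting
  \<open>(c - d) * w\<close> instead of \<open>c * w\<close> keeps the real part strictly positive,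
  while \<open>sharp\<close> gives a point \<open>v\<close> where the ratio of the remainder is at
  most \<open>2 * d\<close>; \<open>half_plane_growth\<close> spreads this smallness over the
  sector.\<close>

lemma Julia_Wolff_half_plane:
  assumes hol: "F holomorphic_on right_half_plane"
    and lower: "\<And>w. 0 < Re w \<Longrightarrow> c * Re w \<le> Re (F w)"
    and sharp: "\<And>e. 0 < e \<Longrightarrow> \<exists>w. 0 < Re w \<and> Re (F w) \<le> (c + e) * Re w"
    and e: "0 < e" and M: "0 \<le> M"
  obtains B where "0 < B"
    "\<And>w. 0 < Re w \<Longrightarrow> norm w \<le> M * Re w \<Longrightarrow> B \<le> norm w \<Longrightarrow> norm (F w - of_real c * w) \<le> e * norm w"
proof -
  \<comment> \<open>The \<open>8 * M\<close> arises as \<open>2 * (4 * M)\<close> in the growth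
    estimate; the 2 collects one \<open>d\<close> for \<open>norm (G v)\<close> and one for the term
    \<open>d * w\<close> put back at the end.\<close>
  define d where "d = e / (2 + 8 * M)"
  have d: "d > 0" using e M by (simp add: d_def)
  define G where "G = (\<lambda>w. F w - of_real (c - d) * w)"
  obtain v where v: "0 < Re v" "Re (F v) \<le> (c + d) * Re v" using sharp[OF d] by blast
  have holG: "G holomorphic_on right_half_plane"
    unfolding G_def by (intro holomorphic_intros hol)
  have posG: "0 < Re (G w)" if "0 < Re w" for w
  proof -
    have "0 < d * Re w" using d that by simp
    then show ?thesis using lower[OF that] by (simp add: G_def algebra_simps)
  qed
  have Gv: "Re (G v) / Re v \<le> 2 * d"
    using v by (simp add: G_def field_simps)
  define B where "B = max (norm v) (norm (G v) / d)"
  have Bpos: "B > 0" using v(1) unfolding B_def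
    by (metis complex_Re_le_cmod less_le_trans max.strict_coboundedI1)
  show ?thesis
  proof (rule that[OF Bpos])
    fix w assume w: "0 < Re w" "norm w \<le> M * Re w" "B \<le> norm w"
    have wv: "norm v \<le> norm w" "norm (G v) \<le> d * norm w"
      using w(3) d by (auto simp: B_def field_simps)
    have "norm (w + cnj v) \<le> 2 * norm w"
      using norm_triangle_ineq[of w "cnj v"] wv(1) by simp
    then have "(norm (w + cnj v))\<^sup>2 \<le> 4 * (norm w)\<^sup>2"
      using power_mono[of "norm (w + cnj v)" "2 * norm w" 2] by (simp add: power_mult_distrib)
    also have "\<dots> \<le> 4 * (norm w * (M * Re w))"
      using w by (simp add: power2_eq_square mult_left_mono)
    finally have "(norm (w + cnj v))\<^sup>2 / Re w \<le> 4 * M * norm w"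
      using w by (simp add: divide_le_eq algebra_simps)
    then have "Re (G v) / Re v * ((norm (w + cnj v))\<^sup>2 / Re w) \<le> (2 * d) * (4 * M * norm w)"
      using Gv w v d posG[OF v(1)] by (intro mult_mono) auto
    then have "norm (G w) \<le> d * norm w + 8 * d * M * norm w"
      using half_plane_growth[OF holG posG w(1) v(1)] wv by (simp add: algebra_simps)
    moreover have "F w - of_real c * w = G w - of_real d * w" by (simp add: G_def algebra_simps)
    then have "norm (F w - of_real c * w) \<le> norm (G w) + d * norm w"
      using norm_triangle_ineq4[of "G w" "of_real d * w"] d by (simp add: norm_mult)
    ultimately have "norm (F w - of_real c * w) \<le> d * (2 + 8 * M) * norm w"
      by (simp add: algebra_simps)
    also have "d * (2 + 8 * M) = e" using M by (simp add: d_def)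
    finally show "norm (F w - of_real c * w) \<le> e * norm w" .
  qed
qed

text \<open>The derivative comes from a Cauchy estimate for \<open>F v - c * v\<close> on the disc
  of radius \<open>Re w / 2\<close> around \<open>w\<close>. The radius is comparable to
  \<open>norm w\<close>, and the disc stays in the wider sector with constant
  \<open>2 * M + 1\<close>.\<close>

lemma Julia_Wolff_Caratheodory_half_plane:
  assumes hol: "F holomorphic_on right_half_plane"
    and lower: "\<And>w. 0 < Re w \<Longrightarrow> c * Re w \<le> Re (F w)"
    and sharp: "\<And>e. 0 < e \<Longrightarrow> \<exists>w. 0 < Re w \<and> Re (F w) \<le> (c + e) * Re w"
    and e: "0 < e" and M: "0 \<le> M"
  obtains B where "0 < B"
    "\<And>w. 0 < Re w \<Longrightarrow> norm w \<le> M * Re w \<Longrightarrow> B \<le> norm w \<Longrightarrow>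
      norm (F w - of_real c * w) \<le> e * norm w \<and> norm (deriv F w - of_real c) \<le> e"
proof -
  \<comment> \<open>Cauchy's estimate yields \<open>(3 / 2) * d * norm w / (Re w / 2)\<close>, at
    most \<open>3 * d * M\<close>; the summand 1 ensures \<open>d \<le> e\<close>.\<close>
  define d where "d = e / (1 + 3 * M)"
  have d: "d > 0" "d \<le> e" "3 * d * M \<le> e" using e M by (auto simp: d_def field_simps)
  obtain B where B: "0 < B"
    "\<And>w. 0 < Re w \<Longrightarrow> norm w \<le> (2 * M + 1) * Re w \<Longrightarrow> B \<le> norm w \<Longrightarrow> norm (F w - of_real c * w) \<le> d * norm w"
    using Julia_Wolff_half_plane[OF hol lower sharp d(1), of "2 * M + 1"] M by auto
  \<comment> \<open>Points of the Cauchy circle have at least half the norm of \<open>w\<close>,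
    hence the threshold \<open>2 * B\<close>.\<close>
  show ?thesis
  proof (rule that[of "2 * B"])
    show "0 < 2 * B" using B by simp
    fix w assume w: "0 < Re w" "norm w \<le> M * Re w" "2 * B \<le> norm w"
    have "norm w \<le> (2 * M + 1) * Re w" using w M by (smt (verit) mult_right_mono)
    then have "norm (F w - of_real c * w) \<le> d * norm w" using B w by auto
    also have "\<dots> \<le> e * norm w" using d by (intro mult_right_mono) auto
    finally have 1: "norm (F w - of_real c * w) \<le> e * norm w" .
    define r where "r = Re w / 2"
    have r: "r > 0" using w by (simp add: r_def)
    define f where "f = (\<lambda>v. F v - of_real c * v)"
    have Re_v: "Re v \<ge> r" if "norm (w - v) \<le> r" for v
      using that complex_Re_le_cmod[of "w - v"] by (simp add: r_def)
    have sub: "cball w r \<subseteq> right_half_plane"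
      using r Re_v by (auto simp: dist_norm intro: less_le_trans)
    have holf: "f holomorphic_on right_half_plane"
      unfolding f_def by (intro holomorphic_intros hol)
    have "norm ((deriv ^^ 1) f w) \<le> fact 1 * (d * (3/2 * norm w)) / r ^ 1"
    proof (rule Cauchy_inequality)
      show "f holomorphic_on ball w r"
        by (rule holomorphic_on_subset[OF holf]) (use sub ball_subset_cball in blast)
      show "continuous_on (cball w r) f"
        by (rule holomorphic_on_imp_continuous_on, rule holomorphic_on_subset[OF holf])
          (use sub ball_subset_cball in blast)
      show "0 < r" by fact
      fix v assume v: "norm (w - v) = r"
      have rv: "Re v \<ge> r" using Re_v v by simp
      have nv: "norm v \<le> norm w + r" "norm w \<le> norm v + r"
        using norm_triangle_ineq4[of w "w - v"] norm_triangle_ineq[of "w - v" v] v by auto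
      have rw: "2 * r \<le> norm w" using complex_Re_le_cmod[of w] by (simp add: r_def)
      have "norm v \<le> 2 * M * r + r" using nv w by (simp add: r_def)
      also have "\<dots> \<le> (2 * M + 1) * Re v"
        using rv M by (simp add: distrib_right mult_left_mono add_mono)
      finally have "norm (f v) \<le> d * norm v"
        using B(2)[of v] rv r nv rw w by (auto simp: f_def)
      also have "\<dots> \<le> d * (3/2 * norm w)" using nv rw d by (intro mult_left_mono) auto
      finally show "norm (f v) \<le> d * (3/2 * norm w)" .
    qed
    then have "norm (deriv f w) \<le> 3 * d * (norm w / Re w)" by (simp add: r_def field_simps)
    also have "\<dots> \<le> 3 * d * M" using w d by (intro mult_left_mono) (auto simp: divide_le_eq)
    also have "\<dots> \<le> e" by (rule d)
    finally have 2: "norm (deriv f w) \<le> e" .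
    have "F field_differentiable at w"
      using hol w by (intro holomorphic_on_imp_differentiable_at[of _ right_half_plane])
        (auto simp: open_halfspace_Re_gt)
    then have "deriv f w = deriv F w - of_real c"
      unfolding f_def by (subst deriv_diff) auto
    then show "norm (F w - of_real c * w) \<le> e * norm w \<and> norm (deriv F w - of_real c) \<le> e"
      using 1 2 by simp
  qed
qed

lemma Julia_Wolff_Caratheodory_tendsto:
  assumes hol: "F holomorphic_on right_half_plane"
    and lower: "\<And>w. 0 < Re w \<Longrightarrow> c * Re w \<le> Re (F w)"
    and sharp: "\<And>e. 0 < e \<Longrightarrow> \<exists>w. 0 < Re w \<and> Re (F w) \<le> (c + e) * Re w"
    and M: "0 \<le> M"
    and sector: "\<forall>\<^sub>F x in G. 0 < Re (w x) \<and> norm (w x) \<le> M * Re (w x)"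
    and inf: "filterlim w at_infinity G"
  shows "((\<lambda>x. F (w x) / w x) \<longlongrightarrow> of_real c) G" and "((\<lambda>x. deriv F (w x)) \<longlongrightarrow> of_real c) G"
proof -
  have ev: "\<forall>\<^sub>F x in G. dist (F (w x) / w x) (of_real c) < e \<and> dist (deriv F (w x)) (of_real c) < e"
    if e: "0 < e" for e
  proof -
    have "0 < e / 2" using e by simp
    then obtain B where B: "0 < B"
      "\<And>w. 0 < Re w \<Longrightarrow> norm w \<le> M * Re w \<Longrightarrow> B \<le> norm w \<Longrightarrow>
        norm (F w - of_real c * w) \<le> e / 2 * norm w \<and> norm (deriv F w - of_real c) \<le> e / 2"
      using Julia_Wolff_Caratheodory_half_plane[OF hol lower sharp _ M] by blast
    have "\<forall>\<^sub>F x in G. B \<le> norm (w x)"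
      using filterlim_at_infinity_imp_norm_at_top[OF inf] unfolding filterlim_at_top by blast
    with sector show ?thesis
    proof eventually_elim
      case (elim x)
      then have b: "norm (F (w x) - of_real c * w x) \<le> e / 2 * norm (w x)"
          "norm (deriv F (w x) - of_real c) \<le> e / 2" using B(2)[of "w x"] by auto
      have nz: "w x \<noteq> 0" using elim by auto
      have "F (w x) / w x - of_real c = (F (w x) - of_real c * w x) / w x"
        using nz by (simp add: field_simps)
      then have "norm (F (w x) / w x - of_real c) \<le> e / 2"
        using b(1) nz by (simp add: norm_divide divide_le_eq)
      then show ?case using b(2) e by (simp add: dist_norm)
    qed
  qed
  show "((\<lambda>x. F (w x) / w x) \<longlongrightarrow> of_real c) G"
    unfolding tendsto_iff using ev by (blast intro: eventually_mono)
  show "((\<lambda>x. deriv F (w x)) \<longlongrightarrow> of_real c) G"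
    unfolding tendsto_iff using ev by (blast intro: eventually_mono)
qed

section \<open>Angular derivatives of semigroups at boundary points\<close>

text \<open>For \<sigma> on the unit circle this is the Moebius map of the disc onto
  \<open>right_half_plane\<close> with 0 going to 1 and \<sigma> to infinity. Boundary behaviour at
  \<sigma> becomes behaviour at infinity.\<close>

definition cayley :: "complex \<Rightarrow> complex \<Rightarrow> complex" where
  "cayley \<sigma> z = (\<sigma> + z) / (\<sigma> - z)"

definition cayley_inv :: "complex \<Rightarrow> complex \<Rightarrow> complex" where
  "cayley_inv \<sigma> w = \<sigma> * (w - 1) / (w + 1)"

context
  fixes \<sigma> :: complex
  assumes \<sigma>: "\<sigma> \<in> unit_circle"
begin

lemma sigma_diff_nonzero: "z \<in> unit_disc \<Longrightarrow> \<sigma> - z \<noteq> 0"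
  using \<sigma> by auto

lemma Re_cayley: "z \<in> unit_disc \<Longrightarrow> Re (cayley \<sigma> z) = (1 - (norm z)\<^sup>2) / (norm (\<sigma> - z))\<^sup>2"
proof -
  assume z: "z \<in> unit_disc"
  have "cayley \<sigma> z = ((\<sigma> + z) * cnj (\<sigma> - z)) / of_real ((norm (\<sigma> - z))\<^sup>2)"
    unfolding cayley_def complex_norm_square using sigma_diff_nonzero[OF z] by simp
  then have "Re (cayley \<sigma> z) = Re ((\<sigma> + z) * cnj (\<sigma> - z)) / (norm (\<sigma> - z))\<^sup>2"
    by (simp only: Re_divide_of_real)
  also have "Re ((\<sigma> + z) * cnj (\<sigma> - z)) = (norm \<sigma>)\<^sup>2 - (norm z)\<^sup>2"
    by (simp only: cmod_power2) (simp add: power2_eq_square algebra_simps)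
  finally show ?thesis using \<sigma> by simp
qed

lemma Re_cayley_pos: "z \<in> unit_disc \<Longrightarrow> 0 < Re (cayley \<sigma> z)"
  using sigma_diff_nonzero[of z] by (simp add: Re_cayley power_less_one_iff abs_square_less_1)

lemma cayley_inv_disc: "0 < Re w \<Longrightarrow> cayley_inv \<sigma> w \<in> unit_disc"
  using norm_diff_less_add_cnj[of w 1] add_cnj_nonzero[of w 1] \<sigma>
  by (simp add: cayley_inv_def norm_mult norm_divide divide_less_eq)

lemma cayley_plus_one: "z \<in> unit_disc \<Longrightarrow> cayley \<sigma> z + 1 = 2 * \<sigma> / (\<sigma> - z)"
  using sigma_diff_nonzero by (simp add: cayley_def field_simps)

lemma cayley_inv_cayley: "z \<in> unit_disc \<Longrightarrow> cayley_inv \<sigma> (cayley \<sigma> z) = z"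
proof -
  assume z: "z \<in> unit_disc"
  have "cayley \<sigma> z - 1 = 2 * z / (\<sigma> - z)"
    using sigma_diff_nonzero[OF z] by (simp add: cayley_def field_simps)
  then show ?thesis
    using sigma_diff_nonzero[OF z] \<sigma> by (auto simp: cayley_inv_def cayley_plus_one[OF z])
qed

lemma cayley_holomorphic: "cayley \<sigma> holomorphic_on unit_disc"
  unfolding cayley_def using sigma_diff_nonzero by (intro holomorphic_intros) auto

lemma cayley_inv_holomorphic: "cayley_inv \<sigma> holomorphic_on right_half_plane"
  unfolding cayley_inv_def using add_cnj_nonzero[of _ 1] by (intro holomorphic_intros) auto

lemma cayley_at_infinity:
  assumes "(f \<longlongrightarrow> \<sigma>) G" "\<forall>\<^sub>F x in G. f x \<in> unit_disc"
  shows "filterlim (\<lambda>x. cayley \<sigma> (f x)) at_infinity G"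
proof -
  have 1: "((\<lambda>x. \<sigma> + f x) \<longlongrightarrow> \<sigma> + \<sigma>) G" by (intro tendsto_intros assms)
  have "((\<lambda>x. \<sigma> - f x) \<longlongrightarrow> \<sigma> - \<sigma>) G" by (intro tendsto_intros assms)
  moreover have "\<forall>\<^sub>F x in G. \<sigma> - f x \<noteq> 0"
    using assms(2) by eventually_elim (rule sigma_diff_nonzero)
  ultimately have 2: "filterlim (\<lambda>x. \<sigma> - f x) (at 0) G"
    by (simp add: filterlim_at)
  have "\<sigma> + \<sigma> \<noteq> 0" using \<sigma> by auto
  from tendsto_mult_filterlim_at_infinity[OF 1 this filterlim_compose[OF filterlim_inverse_at_infinity 2]]
  show ?thesis by (simp add: cayley_def divide_inverse)
qed

text \<open>Turns Stolz regions into sectors, where the half-plane theorems apply. The 2 bounds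
  \<open>norm (\<sigma> + z)\<close>.\<close>

lemma stolz_region_cayley:
  assumes "z \<in> stolz_region \<sigma> R"
  shows "norm (cayley \<sigma> z) \<le> 2 * R * Re (cayley \<sigma> z)"
proof -
  have z: "z \<in> unit_disc" "norm (\<sigma> - z) < R * (1 - norm z)"
    using assms by (auto simp: stolz_region_def)
  define d where "d = norm (\<sigma> - z)"
  have d: "d > 0" using sigma_diff_nonzero[OF z(1)] by (simp add: d_def)
  have "0 < R * (1 - norm z)" using z(2) d unfolding d_def by linarith
  then have R: "R > 0" using z(1) by (simp add: zero_less_mult_iff)
  have "norm (\<sigma> + z) \<le> 2" using norm_triangle_ineq[of \<sigma> z] z \<sigma> by simp
  then have "norm (\<sigma> + z) * d \<le> 2 * d" using d by (intro mult_right_mono) auto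
  also have "\<dots> \<le> 2 * (R * (1 - norm z))" using z by (simp add: d_def)
  also have "\<dots> \<le> 2 * (R * (1 - (norm z)\<^sup>2))"
    using R z by (simp add: power2_eq_square mult_left_le)
  finally have "norm (\<sigma> + z) * d / d\<^sup>2 \<le> 2 * (R * (1 - (norm z)\<^sup>2)) / d\<^sup>2"
    using d by (intro divide_right_mono) auto
  then show ?thesis
    using d by (simp add: Re_cayley[OF z(1)] flip: d_def) (simp add: cayley_def norm_divide d_def power2_eq_square)
qed

lemma half_plane_conj:
  assumes "f holomorphic_on unit_disc" "f ` unit_disc \<subseteq> unit_disc"
  shows "(\<lambda>w. cayley \<sigma> (f (cayley_inv \<sigma> w))) holomorphic_on right_half_plane"
    and "0 < Re w \<Longrightarrow> 0 < Re (cayley \<sigma> (f (cayley_inv \<sigma> w)))"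
proof -
  have 1: "(f \<circ> cayley_inv \<sigma>) holomorphic_on right_half_plane"
    using cayley_inv_disc by (intro holomorphic_on_compose_gen[OF cayley_inv_holomorphic assms(1)]) auto
  have "(cayley \<sigma> \<circ> (f \<circ> cayley_inv \<sigma>)) holomorphic_on right_half_plane"
    using cayley_inv_disc assms(2) by (intro holomorphic_on_compose_gen[OF 1 cayley_holomorphic]) auto
  then show "(\<lambda>w. cayley \<sigma> (f (cayley_inv \<sigma> w))) holomorphic_on right_half_plane"
    by (simp add: o_def)
  show "0 < Re (cayley \<sigma> (f (cayley_inv \<sigma> w)))" if "0 < Re w"
    using cayley_inv_disc[OF that] assms(2) by (intro Re_cayley_pos) blast
qed

text \<open>With \<open>w = cayley \<sigma> z\<close> the chain rule gives
  \<open>deriv f z = deriv F w * ((w + 1) / (F w + 1))\<^sup>2\<close>. In sectors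
  \<open>deriv F w\<close> and \<open>F w / w\<close> tend to \<open>c\<close>, so the limit is
  \<open>c / c\<^sup>2\<close>.\<close>

lemma angular_derivative:
  assumes hol: "f holomorphic_on unit_disc" and maps: "f ` unit_disc \<subseteq> unit_disc"
    and F: "F = (\<lambda>w. cayley \<sigma> (f (cayley_inv \<sigma> w)))"
    and c: "0 < c"
    and lower: "\<And>w. 0 < Re w \<Longrightarrow> c * Re w \<le> Re (F w)"
    and sharp: "\<And>e. 0 < e \<Longrightarrow> \<exists>w. 0 < Re w \<and> Re (F w) \<le> (c + e) * Re w"
  shows "has_angular_limit (deriv f) \<sigma> (of_real (1 / c))"
  unfolding has_angular_limit_def
proof (intro allI impI)
  fix R :: real assume R: "1 < R"
  let ?G = "at \<sigma> within stolz_region \<sigma> R"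
  have holF: "F holomorphic_on right_half_plane" unfolding F by (rule half_plane_conj(1)[OF hol maps])
  have posF: "0 < Re (F w)" if "0 < Re w" for w unfolding F by (rule half_plane_conj(2)[OF hol maps that])
  have deriv: "deriv f z = deriv F (cayley \<sigma> z) * ((cayley \<sigma> z + 1) / (F (cayley \<sigma> z) + 1))\<^sup>2"
    if z: "z \<in> unit_disc" for z
  proof -
    define w where "w = cayley \<sigma> z"
    have w: "0 < Re w" unfolding w_def by (rule Re_cayley_pos[OF z])
    have n: "F w + 1 \<noteq> 0" using add_cnj_nonzero[OF posF[OF w], of 1] by simp
    have \<sigma>0: "\<sigma> \<noteq> 0" using \<sigma> by auto
    have "(w + 1)\<^sup>2 / (2 * \<sigma>) = 2 * \<sigma> / (\<sigma> - z)\<^sup>2"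
      unfolding w_def cayley_plus_one[OF z] using \<sigma>0 by (simp add: power_divide power_mult_distrib) (simp add: power2_eq_square)
    moreover have "(cayley \<sigma> has_field_derivative 2 * \<sigma> / (\<sigma> - z)\<^sup>2) (at z)"
      unfolding cayley_def
      by (rule derivative_eq_intros refl sigma_diff_nonzero[OF z])+
        (simp add: power2_eq_square)
    ultimately have d1: "(cayley \<sigma> has_field_derivative (w + 1)\<^sup>2 / (2 * \<sigma>)) (at z)" by simp
    have d2: "(F has_field_derivative deriv F w) (at w)"
      using holF w by (intro holomorphic_derivI[OF holF]) (auto simp: open_halfspace_Re_gt)
    have d3: "(cayley_inv \<sigma> has_field_derivative 2 * \<sigma> / (F w + 1)\<^sup>2) (at (F w))"
      unfolding cayley_inv_def
      by (rule derivative_eq_intros refl n)+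
        (use n in \<open>simp add: field_simps power2_eq_square\<close>)
    have "((\<lambda>z. F (cayley \<sigma> z)) has_field_derivative deriv F w * ((w + 1)\<^sup>2 / (2 * \<sigma>))) (at z)"
      using DERIV_chain2[OF d2[unfolded w_def] d1] by (simp add: w_def)
    from DERIV_chain2[OF d3[unfolded w_def] this]
    have "((\<lambda>z. cayley_inv \<sigma> (F (cayley \<sigma> z))) has_field_derivative
        2 * \<sigma> / (F w + 1)\<^sup>2 * (deriv F w * ((w + 1)\<^sup>2 / (2 * \<sigma>)))) (at z)"
      by (simp add: w_def)
    then have "(f has_field_derivative
        2 * \<sigma> / (F w + 1)\<^sup>2 * (deriv F w * ((w + 1)\<^sup>2 / (2 * \<sigma>)))) (at z)"
      by (rule has_field_derivative_transform_within_open[of _ _ _ unit_disc])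
        (use z maps in \<open>auto simp: F cayley_inv_cayley image_subset_iff\<close>)
    then have "deriv f z = 2 * \<sigma> / (F w + 1)\<^sup>2 * (deriv F w * ((w + 1)\<^sup>2 / (2 * \<sigma>)))"
      by (rule DERIV_imp_deriv)
    also have "\<dots> = deriv F w * ((w + 1) / (F w + 1))\<^sup>2"
      using \<sigma>0 by (simp add: power_divide)
    finally show ?thesis by (simp add: w_def)
  qed
  have ev: "\<forall>\<^sub>F z in ?G. z \<in> stolz_region \<sigma> R" by (simp add: eventually_at_filter)
  have ev_disc: "\<forall>\<^sub>F z in ?G. z \<in> unit_disc"
    using ev by eventually_elim (simp add: stolz_region_def)
  have inf: "filterlim (\<lambda>z. cayley \<sigma> z) at_infinity ?G"
    by (rule cayley_at_infinity[OF _ ev_disc]) (rule tendsto_ident_at)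
  have sector: "\<forall>\<^sub>F z in ?G. 0 < Re (cayley \<sigma> z) \<and> norm (cayley \<sigma> z) \<le> 2 * R * Re (cayley \<sigma> z)"
    using ev by eventually_elim (auto intro!: stolz_region_cayley Re_cayley_pos simp: stolz_region_def)
  have lim: "((\<lambda>z. F (cayley \<sigma> z) / cayley \<sigma> z) \<longlongrightarrow> of_real c) ?G"
      "((\<lambda>z. deriv F (cayley \<sigma> z)) \<longlongrightarrow> of_real c) ?G"
    by (rule Julia_Wolff_Caratheodory_tendsto[OF holF lower sharp _ sector inf]; use R in simp)+
  have inv: "((\<lambda>z. 1 / cayley \<sigma> z) \<longlongrightarrow> 0) ?G"
    using tendsto_divide_0[OF tendsto_const inf] .
  have "((\<lambda>z. deriv F (cayley \<sigma> z) * ((1 + 1 / cayley \<sigma> z) / (F (cayley \<sigma> z) / cayley \<sigma> z + 1 / cayley \<sigma> z))\<^sup>2)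
      \<longlongrightarrow> of_real c * ((1 + 0) / (of_real c + 0))\<^sup>2) ?G"
    using c by (intro tendsto_intros lim inv) auto
  also have "of_real c * ((1 + 0) / (of_real c + 0))\<^sup>2 = (of_real (1 / c) :: complex)"
    using c by (simp add: field_simps power2_eq_square)
  finally show "(deriv f \<longlongrightarrow> of_real (1 / c)) ?G"
  proof (rule Lim_transform_eventually)
    show "\<forall>\<^sub>F z in ?G. deriv F (cayley \<sigma> z) * ((1 + 1 / cayley \<sigma> z) / (F (cayley \<sigma> z) / cayley \<sigma> z + 1 / cayley \<sigma> z))\<^sup>2 = deriv f z"
      using ev_disc
    proof eventually_elim
      case (elim z)
      have nz: "cayley \<sigma> z \<noteq> 0" using Re_cayley_pos[OF elim] by auto
      have "(1 + 1 / w) / (v / w + 1 / w) = (w + 1) / (v + 1)" if "w \<noteq> 0" for v w :: complex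
        using that by (simp add: divide_simps add.commute)
      then show ?case using nz by (simp add: deriv[OF elim])
    qed
  qed
qed

end

section \<open>From bounded hyperbolic steps to regularity\<close>

text \<open>Subtracting \<open>t * f 1\<close> leaves an additive \<open>g\<close> that vanishes at
  the natural numbers and is therefore bounded above on the whole half-line. A positive value would
  be unbounded under multiples, so \<open>g \<le> 0\<close>; since \<open>g t\<close> and
  \<open>g (n - t)\<close> add up to 0, both vanish.\<close>

lemma additive_bounded_above_linear:
  fixes f :: "real \<Rightarrow> real"
  assumes add: "\<And>s t. 0 \<le> s \<Longrightarrow> 0 \<le> t \<Longrightarrow> f (s + t) = f s + f t"
    and bdd: "\<And>t. 0 \<le> t \<Longrightarrow> t \<le> 1 \<Longrightarrow> f t \<le> K"
    and t: "0 \<le> t"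
  shows "f t = t * f 1"
proof -
  define g where "g = (\<lambda>t. f t - t * f 1)"
  have g_add: "g (s + t) = g s + g t" if "0 \<le> s" "0 \<le> t" for s t
    using add[OF that] by (simp add: g_def algebra_simps)
  have g_mult: "g (real n * t) = real n * g t" if "0 \<le> t" for n t
  proof (induction n)
    case 0 show ?case using g_add[of 0 0] by simp
  next
    case (Suc n) then show ?case using g_add[of "real n * t" t] that by (simp add: algebra_simps)
  qed
  have g_nat: "g (real n) = 0" for n using g_mult[of 1 n] unfolding g_def by simp
  define B where "B = K + \<bar>f 1\<bar>"
  have g_le: "g t \<le> B" if "0 \<le> t" for t
  proof -
    define n where "n = nat \<lfloor>t\<rfloor>"
    have n: "real n \<le> t" "t - real n \<le> 1" using that by (simp_all add: n_def) linarith
    have "g t = g (real n) + g (t - real n)" using g_add[of "real n" "t - real n"] n by simp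
    also have "\<dots> = g (t - real n)" by (simp add: g_nat)
    also have "\<dots> \<le> B"
    proof -
      have "\<bar>(t - real n) * f 1\<bar> \<le> 1 * \<bar>f 1\<bar>"
        using n unfolding abs_mult by (intro mult_right_mono) auto
      then show ?thesis using bdd[of "t - real n"] n by (simp add: g_def B_def abs_le_iff)
    qed
    finally show ?thesis .
  qed
  have nonpos: "g t \<le> 0" if t: "0 \<le> t" for t
  proof (rule ccontr)
    assume "\<not> g t \<le> 0"
    then obtain n where "B < real n * g t" using reals_Archimedean3[of "g t"] by auto
    then show False using g_le[of "real n * t"] g_mult[OF t, of n] t by simp
  qed
  obtain n where n: "t \<le> real n" using real_arch_simple by blast
  have "g t + g (real n - t) = 0" using g_add[of t "real n - t"] n t g_nat by simp
  then have "g t = 0" using nonpos[of t] nonpos[of "real n - t"] n t by simp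
  then show ?thesis by (simp add: g_def)
qed

text \<open>The infimum \<open>c t\<close> of \<open>Re (F t w) / Re w\<close> is the reciprocal of
  the angular derivative at \<sigma>. Regularity amounts to \<open>c t\<close> being positive and
  exponential in \<open>t\<close>. Sequence and bound in \<open>step\<close> may depend on
  \<open>t\<close>.\<close>

lemma regular_if_bounded_hyperbolic_step:
  assumes semi: "holomorphic_semigroup \<phi>" and bfp: "boundary_fixed_point \<phi> \<sigma>"
    and step: "\<And>t. 0 \<le> t \<Longrightarrow> \<exists>v M. 0 \<le> M \<and> (\<forall>n::nat. v n \<in> unit_disc) \<and> v \<longlonglongrightarrow> \<sigma> \<and>
      (\<forall>n. half_plane_near M (cayley \<sigma> (v n)) (cayley \<sigma> (\<phi> t (v n))))"
  shows "boundary_regular_fixed_point \<phi> \<sigma>"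
proof -
  have \<sigma>: "\<sigma> \<in> unit_circle" using bfp by (simp add: boundary_fixed_point_def)
  have hol: "\<phi> t holomorphic_on unit_disc" and maps: "\<phi> t ` unit_disc \<subseteq> unit_disc"
    and sg: "\<And>s z. 0 \<le> s \<Longrightarrow> z \<in> unit_disc \<Longrightarrow> \<phi> (t + s) z = \<phi> t (\<phi> s z)" if "0 \<le> t" for t
    using semi that unfolding holomorphic_semigroup_def by auto
  define F where "F = (\<lambda>t w. cayley \<sigma> (\<phi> t (cayley_inv \<sigma> w)))"
  have holF: "F t holomorphic_on right_half_plane" if "0 \<le> t" for t
    unfolding F_def by (rule half_plane_conj(1)[OF \<sigma> hol[OF that] maps[OF that]])
  have posF: "0 < Re (F t w)" if "0 \<le> t" "0 < Re w" for t w
    unfolding F_def by (rule half_plane_conj(2)[OF \<sigma> hol[OF that(1)] maps[OF that(1)] that(2)])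
  have F_add: "F (t + s) w = F t (F s w)" if "0 \<le> t" "0 \<le> s" "0 < Re w" for t s w
  proof -
    have "cayley_inv \<sigma> w \<in> unit_disc" by (rule cayley_inv_disc[OF \<sigma> that(3)])
    moreover from this have "\<phi> s (cayley_inv \<sigma> w) \<in> unit_disc" using maps[OF that(2)] by blast
    ultimately show ?thesis by (simp add: F_def sg[OF that(1,2)] cayley_inv_cayley[OF \<sigma>])
  qed
  define Q where "Q = (\<lambda>t. (\<lambda>w. Re (F t w) / Re w) ` right_half_plane)"
  define c where "c = (\<lambda>t. Inf (Q t))"
  have Q_bdd: "bdd_below (Q t)" if "0 \<le> t" for t
    unfolding Q_def by (rule bdd_belowI2[of _ 0]) (simp add: posF[OF that] less_imp_le)
  have Q_ne: "Q t \<noteq> {}" for t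
    unfolding Q_def by (auto intro: exI[of _ 1])
  have lower: "c t * Re w \<le> Re (F t w)" if t: "0 \<le> t" and w: "0 < Re w" for t w
  proof -
    have "c t \<le> Re (F t w) / Re w"
      unfolding c_def using w by (intro cInf_lower Q_bdd[OF t]) (auto simp: Q_def)
    then show ?thesis using w by (simp add: pos_le_divide_eq)
  qed
  have sharp: "\<exists>w. 0 < Re w \<and> Re (F t w) \<le> (c t + e) * Re w" if t: "0 \<le> t" and e: "0 < e" for t e
  proof -
    have "Inf (Q t) < c t + e" using e by (simp add: c_def)
    then obtain q where "q \<in> Q t" "q < c t + e" using cInf_lessD[OF Q_ne] by blast
    then show ?thesis by (auto simp: Q_def pos_divide_less_eq intro: less_imp_le)
  qed
  \<comment> \<open>The bounded steps enter here: Julia's lemma turns them into a positive lower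
    bound for the quotients.\<close>
  have c_pos: "0 < c t" if t: "0 \<le> t" for t
  proof -
    obtain v M where v: "0 \<le> M" "\<And>n::nat. v n \<in> unit_disc" "v \<longlonglongrightarrow> \<sigma>"
      "\<And>n. half_plane_near M (cayley \<sigma> (v n)) (cayley \<sigma> (\<phi> t (v n)))"
      using step[OF t] by blast
    have J: "Re z / (16 * (1 + M)^3) \<le> Re (F t z)" if z: "0 < Re z" for z
    proof (rule Julia_half_plane[OF holF[OF t] posF[OF t], of "\<lambda>n. cayley \<sigma> (v n)"])
      show "0 < Re (cayley \<sigma> (v n))" for n by (rule Re_cayley_pos[OF \<sigma> v(2)])
      show "filterlim (\<lambda>n. cayley \<sigma> (v n)) at_infinity sequentially"
        using v(2) by (intro cayley_at_infinity[OF \<sigma> v(3)]) auto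
      show "half_plane_near M (cayley \<sigma> (v n)) (F t (cayley \<sigma> (v n)))" for n
        using v(4)[of n] by (simp add: F_def cayley_inv_cayley[OF \<sigma> v(2)])
    qed (use v z in auto)
    have "1 / (16 * (1 + M)^3) \<le> q" if "q \<in> Q t" for q
      using that J by (auto simp: Q_def pos_le_divide_eq)
    then have "1 / (16 * (1 + M)^3) \<le> c t"
      unfolding c_def by (rule cInf_greatest[OF Q_ne])
    moreover have "0 < 1 / (16 * (1 + M)^3)" using v(1) by simp
    ultimately show ?thesis by linarith
  qed
  have radial: "((\<lambda>x. F t (of_real x) / of_real x) \<longlongrightarrow> of_real (c t)) at_top" if t: "0 \<le> t" for t
  proof (rule Julia_Wolff_Caratheodory_tendsto(1)[OF holF[OF t] lower[OF t] sharp[OF t], of 1 "\<lambda>x. of_real x"])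
    show "\<forall>\<^sub>F x in at_top. 0 < Re (complex_of_real x) \<and> norm (complex_of_real x) \<le> 1 * Re (complex_of_real x)"
      using eventually_gt_at_top[of 0] by eventually_elim simp
    show "filterlim complex_of_real at_infinity at_top"
      by (rule filterlim_of_real_at_infinity)
  qed auto
  \<comment> \<open>As \<open>F s x\<close> behaves like \<open>c s * x\<close> with
    \<open>c s > 0\<close>, the image of the positive axis runs to infinity inside the sector with
    constant 2. There \<open>F t v / v\<close> tends to \<open>c t\<close>, and the quotients of the
    composition multiply.\<close>
  have c_mult: "c (t + s) = c t * c s" if t: "0 \<le> t" and s: "0 \<le> s" for t s
  proof -
    let ?v = "\<lambda>x. F s (complex_of_real x)"
    have cs: "c s > 0" by (rule c_pos[OF s])
    have pos: "\<forall>\<^sub>F x::real in at_top. 0 < x" by (rule eventually_gt_at_top)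
    have lim: "((\<lambda>x. ?v x / of_real x) \<longlongrightarrow> of_real (c s)) at_top" by (rule radial[OF s])
    have "((\<lambda>x. norm (?v x / of_real x)) \<longlongrightarrow> norm (complex_of_real (c s))) at_top"
      by (intro tendsto_norm lim)
    then have "\<forall>\<^sub>F x in at_top. norm (?v x / of_real x) < 2 * c s"
      using cs by (intro order_tendstoD(2)) auto
    then have sector: "\<forall>\<^sub>F x in at_top. 0 < Re (?v x) \<and> norm (?v x) \<le> 2 * Re (?v x)"
      using pos
    proof eventually_elim
      case (elim x)
      then have "norm (?v x) \<le> 2 * (c s * x)" by (simp add: norm_divide divide_less_eq mult.assoc)
      also have "c s * x \<le> Re (?v x)" using lower[OF s, of "of_real x"] elim by simp
      finally show ?case using posF[OF s, of "of_real x"] elim by simp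
    qed
    have "filterlim (\<lambda>x. c s * x) at_top at_top"
      using cs by (intro filterlim_tendsto_pos_mult_at_top[OF tendsto_const] filterlim_ident)
    then have "filterlim (\<lambda>x. norm (?v x)) at_top at_top"
    proof (rule filterlim_at_top_mono)
      show "\<forall>\<^sub>F x in at_top. c s * x \<le> norm (?v x)"
        using pos
      proof eventually_elim
        case (elim x)
        then have "c s * x \<le> Re (?v x)" using lower[OF s, of "of_real x"] by simp
        then show ?case using complex_Re_le_cmod order_trans by blast
      qed
    qed
    then have inf: "filterlim ?v at_infinity at_top" by (rule filterlim_norm_at_top_imp_at_infinity)
    have "((\<lambda>x. F t (?v x) / ?v x) \<longlongrightarrow> of_real (c t)) at_top"
      by (rule Julia_Wolff_Caratheodory_tendsto(1)[OF holF[OF t] lower[OF t] sharp[OF t] _ sector inf]) auto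
    from tendsto_mult[OF this lim]
    have "((\<lambda>x. F (t + s) (of_real x) / of_real x) \<longlongrightarrow> of_real (c t) * of_real (c s)) at_top"
    proof (rule Lim_transform_eventually)
      show "\<forall>\<^sub>F x in at_top. F t (?v x) / ?v x * (?v x / of_real x) = F (t + s) (of_real x) / of_real x"
        using pos
      proof eventually_elim
        case (elim x)
        then have "?v x \<noteq> 0" using posF[OF s, of "of_real x"] by auto
        then show ?case using elim by (simp add: F_add[OF t s])
      qed
    qed
    then have "of_real (c t) * of_real (c s) = complex_of_real (c (t + s))"
      using radial[of "t + s"] t s by (intro tendsto_unique[OF trivial_limit_at_top_linorder]) auto
    then show ?thesis by (metis of_real_eq_iff of_real_mult)
  qed
  \<comment> \<open>This prepares an upper bound of \<open>c\<close> on the unit interval: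
    \<open>c t \<le> Re (F t 1)\<close>, and \<open>F t 1 = cayley \<sigma> (\<phi> t 0)\<close>
    stays in a compact set.\<close>
  have "continuous_on {0..1} (\<lambda>t. \<phi> t 0)"
    unfolding continuous_on_def
  proof
    fix t :: real assume t: "t \<in> {0..1}"
    have "compact {0::complex} \<and> {0} \<subseteq> unit_disc" by simp
    then have "uniform_limit {0} \<phi> (\<phi> t) (at t within {0..})"
      using semi t unfolding holomorphic_semigroup_def by (meson atLeastAtMost_iff)
    then have "((\<lambda>t. \<phi> t 0) \<longlongrightarrow> \<phi> t 0) (at t within {0..})"
      by (rule tendsto_uniform_limitI) simp
    then show "((\<lambda>t. \<phi> t 0) \<longlongrightarrow> \<phi> t 0) (at t within {0..1})"
      by (rule tendsto_within_subset) auto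
  qed
  then have "continuous_on {0..1} (cayley \<sigma> \<circ> (\<lambda>t. \<phi> t 0))"
  proof (rule continuous_on_compose)
    have "(\<lambda>t. \<phi> t 0) ` {0..1} \<subseteq> unit_disc" using maps by force
    then show "continuous_on ((\<lambda>t. \<phi> t 0) ` {0..1}) (cayley \<sigma>)"
      by (rule continuous_on_subset[OF holomorphic_on_imp_continuous_on[OF cayley_holomorphic[OF \<sigma>]]])
  qed
  then have "bounded ((cayley \<sigma> \<circ> (\<lambda>t. \<phi> t 0)) ` {0..1})"
    by (intro compact_imp_bounded compact_continuous_image) auto
  then obtain K where "\<forall>x\<in>(cayley \<sigma> \<circ> (\<lambda>t. \<phi> t 0)) ` {0..1}. norm x \<le> K"
    unfolding bounded_iff by blast
  then have K: "norm (cayley \<sigma> (\<phi> t 0)) \<le> K" if "0 \<le> t" "t \<le> 1" for t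
    using that by simp
  define f where "f = (\<lambda>t. ln (c t))"
  have "f t \<le> ln K" if "0 \<le> t" "t \<le> 1" for t
  proof -
    have "c t \<le> Re (F t 1)" using lower[of t 1] that by simp
    also have "\<dots> \<le> norm (F t 1)" by (rule complex_Re_le_cmod)
    also have "F t 1 = cayley \<sigma> (\<phi> t 0)" by (simp add: F_def cayley_inv_def)
    also have "norm \<dots> \<le> K" by (rule K[OF that])
    finally show ?thesis using c_pos[OF that(1)] by (simp add: f_def)
  qed
  moreover have "f (s + t) = f s + f t" if "0 \<le> s" "0 \<le> t" for s t
    using c_pos[OF that(1)] c_pos[OF that(2)] by (simp add: f_def c_mult[OF that] ln_mult)
  ultimately have lin: "f t = t * f 1" if "0 \<le> t" for t
    using additive_bounded_above_linear[of f "ln K" t] that by blast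
  \<comment> \<open>The witness for \<mu> is \<open>f 1 = ln (c 1)\<close>.\<close>
  have "has_angular_limit (deriv (\<phi> t)) \<sigma> (of_real (exp (- f 1 * t)))" if t: "0 \<le> t" for t
  proof -
    have "has_angular_limit (deriv (\<phi> t)) \<sigma> (of_real (1 / c t))"
      by (rule angular_derivative[OF \<sigma> hol[OF t] maps[OF t] _ c_pos[OF t] lower[OF t] sharp[OF t]])
        (auto simp: F_def)
    moreover have "c t = exp (t * f 1)" using lin[OF t] c_pos[OF t] by (simp add: f_def flip: exp_ln_iff)
    ultimately show ?thesis by (simp add: exp_minus inverse_eq_divide mult.commute)
  qed
  then show ?thesis using bfp unfolding boundary_regular_fixed_point_def by blast
qed

section \<open>Lindelof's theorem\<close>

text \<open>Clamp the real part of \<open>p\<close> and the imaginary part of \<open>q\<close> to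
  the box and apply the Fashoda theorem. The strict bounds on the other coordinates show that
  neither clamp is active where the clamped paths meet, so the meeting point is genuine.\<close>

lemma fashoda_complex:
  assumes p: "path p" and q: "path q" and y: "0 < y"
    and p_box: "\<And>t. t \<in> {0..1} \<Longrightarrow> \<bar>Im (p t)\<bar> < y" and p_ends: "Re (p 0) \<le> a" "b \<le> Re (p 1)"
    and q_box: "\<And>t. t \<in> {0..1} \<Longrightarrow> a < Re (q t) \<and> Re (q t) < b" and q_ends: "Im (q 0) \<le> - y" "y \<le> Im (q 1)"
  obtains s t where "s \<in> {0..1}" "t \<in> {0..1}" "p s = q t"
proof -
  define P :: "real \<Rightarrow> real^2" where "P = (\<lambda>t. vector [max a (min b (Re (p t))), Im (p t)])"
  define Q :: "real \<Rightarrow> real^2" where "Q = (\<lambda>t. vector [Re (q t), max (-y) (min y (Im (q t)))])"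
  have ab: "a < b" using q_box[of 0] by auto
  have cont: "continuous_on {0..1} (\<lambda>t. vector [f t, g t] :: real^2)"
    if "continuous_on {0..1} f" "continuous_on {0..1} g" for f g :: "real \<Rightarrow> real"
  proof -
    have "vector [f t, g t] = (\<chi> i::2. if i = 1 then f t else g t)" for t
      by (simp add: vec_eq_iff forall_2)
    moreover have "continuous_on {0..1} (\<lambda>t. if i = 1 then f t else g t)" for i :: 2
      using that by (cases "i = 1") auto
    ultimately show ?thesis by (simp only:) (rule continuous_on_vec_lambda)
  qed
  have "path P" "path Q"
    using p q unfolding P_def Q_def path_def by (intro cont continuous_intros; simp)+
  moreover have "path_image P \<subseteq> cbox (vector [a, -y]) (vector [b, y])"
    using p_box ab by (force simp: path_image_def P_def mem_box_cart forall_2 abs_less_iff)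
  moreover have "path_image Q \<subseteq> cbox (vector [a, -y]) (vector [b, y])"
    using q_box y by (force simp: path_image_def Q_def mem_box_cart forall_2)
  ultimately obtain z where z: "z \<in> path_image P" "z \<in> path_image Q"
    using p_ends q_ends ab y by (rule_tac fashoda[of P Q "vector [a, -y]" "vector [b, y]"]) (auto simp: P_def Q_def pathstart_def pathfinish_def)
  then obtain s t where st: "s \<in> {0..1}" "t \<in> {0..1}" "P s = Q t"
    by (auto simp: path_image_def)
  then have "max a (min b (Re (p s))) = Re (q t)" "Im (p s) = max (-y) (min y (Im (q t)))"
    by (auto simp: P_def Q_def vec_eq_iff forall_2)
  then have "p s = q t"
    using p_box[OF st(1)] q_box[OF st(2)] by (auto simp: complex_eq_iff max_def min_def split: if_splits)
  then show ?thesis using that st by blast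
qed

text \<open>The image of \<open>right_half_plane\<close> under \<open>Ln\<close>. Composed with
  \<open>cayley \<sigma>\<close>, it makes approach to \<sigma> an escape of the real part to
  infinity, and the radius at \<sigma> part of the real axis.\<close>

definition strip :: "complex set" where "strip = {z. \<bar>Im z\<bar> < pi / 2}"

lemma open_strip: "open strip"
  unfolding strip_def by (intro open_Collect_less continuous_intros)

text \<open>The 5 exceeds the largest possible square of \<open>Im w\<close> by 1, and the bound 2
  covers the strip because \<open>pi < 4\<close>. The quadratic serves as a denominator that damps
  the far ends of a long box.\<close>

lemma norm_quadratic_ge:
  assumes "\<bar>Im w\<bar> \<le> 2" shows "(Re w)\<^sup>2 + 1 \<le> norm (w\<^sup>2 + 5)"
proof -
  have "(Im w)\<^sup>2 \<le> 2\<^sup>2" using assms by (metis abs_ge_zero power2_abs power_mono)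
  then have "(Re w)\<^sup>2 + 1 \<le> Re (w\<^sup>2 + 5)" by (simp add: power2_eq_square)
  also have "\<dots> \<le> norm (w\<^sup>2 + 5)" by (rule complex_Re_le_cmod)
  finally show ?thesis .
qed

text \<open>Maximum principle for \<open>F(z) * cnj (F (cnj z)) * 5 / ((z - x)\<^sup>2 + 5)\<close> on the part of the box
  that lies between the arc \<open>p\<close> and its mirror image: by the Fashoda theorem that part does not
  reach the horizontal sides.\<close>

lemma strip_two_constants:
  assumes hol: "F holomorphic_on strip" and bdd: "\<And>z. z \<in> strip \<Longrightarrow> norm (F z) \<le> K"
    and p: "path p" "path_image p \<subseteq> strip" and small: "\<And>z. z \<in> path_image p \<Longrightarrow> norm (F z) \<le> e"
    and p_ends: "Re (p 0) \<le> x - L" "x + L \<le> Re (p 1)" and L: "0 < L"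
  shows "(norm (F (of_real x)))\<^sup>2 \<le> 5 * K * e + 5 * K\<^sup>2 / (L\<^sup>2 + 1)"
proof -
  define E where "E = path_image p \<union> cnj ` path_image p"
  define B where "B = {z. x - L < Re z \<and> Re z < x + L} \<inter> strip"
  define D where "D = B - E"
  have K: "0 \<le> K" using order_trans[OF norm_ge_zero bdd[of 0]] by (simp add: strip_def)
  have e: "0 \<le> e" using order_trans[OF norm_ge_zero small[of "p 0"]] by (simp add: path_image_def)
  have x_strip: "of_real x \<in> strip" by (simp add: strip_def)
  have cnj_strip: "cnj z \<in> strip \<longleftrightarrow> z \<in> strip" for z by (simp add: strip_def)
  have cnj_E: "cnj z \<in> E \<longleftrightarrow> z \<in> E" for z
    unfolding E_def by (auto simp: image_iff) (metis complex_cnj_cnj)+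
  have cnj_D: "cnj z \<in> D \<longleftrightarrow> z \<in> D" for z
    by (auto simp: D_def B_def cnj_strip cnj_E)
  have compE: "compact E" unfolding E_def
    by (intro compact_Un compact_continuous_image compact_path_image p continuous_intros)
  have E_strip: "E \<subseteq> strip" using p(2) by (auto simp: E_def cnj_strip)
  have openB: "open B" unfolding B_def
    by (intro open_Int open_strip) (simp add: open_Collect_conj open_halfspace_Re_gt open_halfspace_Re_lt)
  have openD: "open D" unfolding D_def by (intro open_Diff openB compact_imp_closed compE)
  \<comment> \<open>The quadratic equals 5 at \<open>x\<close>, so \<open>norm (G x)\<close> is
    \<open>(norm (F x))\<^sup>2\<close>. On \<open>E\<close> one of the two factors is at most
    \<open>e\<close>; on the vertical sides the quadratic factor is at most
    \<open>5 / (L\<^sup>2 + 1)\<close>.\<close>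
  define G where "G = (\<lambda>z. F z * cnj (F (cnj z)) * 5 / ((z - of_real x)\<^sup>2 + 5))"
  have quad: "(Re z - x)\<^sup>2 + 1 \<le> norm ((z - of_real x)\<^sup>2 + 5)" if "z \<in> strip" for z
  proof -
    have "\<bar>Im (z - of_real x)\<bar> \<le> 2" using that pi_less_4 by (simp add: strip_def)
    from norm_quadratic_ge[OF this] show ?thesis by simp
  qed
  have quad_pos: "0 < (Re z - x)\<^sup>2 + 1" for z by (simp add: add_nonneg_pos)
  have quad_nz: "(z - of_real x)\<^sup>2 + 5 \<noteq> 0" if "z \<in> strip" for z
    using quad[OF that] quad_pos[of z] by (metis norm_zero not_less)
  have "(cnj \<circ> F \<circ> cnj) holomorphic_on strip"
    unfolding holomorphic_on_open[OF open_strip]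
  proof
    fix z assume "z \<in> strip"
    then have "(F has_field_derivative deriv F (cnj z)) (at (cnj z))"
      by (intro holomorphic_derivI[OF hol open_strip]) (simp add: cnj_strip)
    then show "\<exists>f'. ((cnj \<circ> F \<circ> cnj) has_field_derivative f') (at z)"
      using has_field_derivative_cnj_cnj by fastforce
  qed
  then have holG: "G holomorphic_on strip"
    unfolding G_def o_def using quad_nz by (intro holomorphic_intros hol) auto
  have G_bound: "norm (G z) \<le> 5 * (norm (F z) * norm (F (cnj z))) / ((Re z - x)\<^sup>2 + 1)" if "z \<in> strip" for z
    unfolding G_def norm_divide norm_mult complex_mod_cnj
    using quad[OF that] quad_pos[of z] by (intro frac_le) auto
  have G_strip: "norm (G z) \<le> 5 * (K * K) / ((Re z - x)\<^sup>2 + 1)" if "z \<in> strip" for z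
    using that bdd[of z] bdd[of "cnj z"] cnj_strip K
    by (intro order_trans[OF G_bound] divide_right_mono mult_left_mono mult_mono) auto
  have G_E: "norm (G z) \<le> 5 * K * e" if "z \<in> E" for z
  proof -
    have zs: "z \<in> strip" "cnj z \<in> strip" using that E_strip cnj_strip by auto
    have "norm (F z) \<le> e \<or> norm (F (cnj z)) \<le> e" using that small unfolding E_def by auto
    then have "norm (F z) * norm (F (cnj z)) \<le> K * e"
      using bdd[OF zs(1)] bdd[OF zs(2)] K e
      by (metis mult.commute mult_mono norm_ge_zero)
    then have "5 * (norm (F z) * norm (F (cnj z))) / ((Re z - x)\<^sup>2 + 1) \<le> 5 * (K * e) / 1"
      using K e by (intro frac_le) auto
    then show ?thesis using G_bound[OF zs(1)] by simp
  qed
  have Gx: "norm (G (of_real x)) = (norm (F (of_real x)))\<^sup>2"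
    by (simp add: G_def norm_mult power2_eq_square)
  have rhs: "5 * K * e \<le> 5 * K * e + 5 * K\<^sup>2 / (L\<^sup>2 + 1)" "5 * K\<^sup>2 / (L\<^sup>2 + 1) \<le> 5 * K * e + 5 * K\<^sup>2 / (L\<^sup>2 + 1)"
    using K e by (auto intro: divide_nonneg_nonneg)
  show ?thesis
  proof (cases "of_real x \<in> E")
    case True
    then show ?thesis using G_E[OF True] Gx rhs by linarith
  next
    case False
    then have xD: "of_real x \<in> D" using x_strip L by (simp add: D_def B_def)
    define U where "U = connected_component_set D (of_real x)"
    have xU: "of_real x \<in> U" using xD by (simp add: U_def)
    have UD: "U \<subseteq> D" unfolding U_def by (rule connected_component_subset)
    have openU: "open U" unfolding U_def by (rule open_connected_component[OF openD])
    have "continuous_on (path_image p) (\<lambda>z. \<bar>Im z\<bar>)" by (intro continuous_intros)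
    then obtain z0 where z0: "z0 \<in> path_image p" "\<And>z. z \<in> path_image p \<Longrightarrow> \<bar>Im z\<bar> \<le> \<bar>Im z0\<bar>"
      using continuous_attains_sup[OF compact_path_image[OF p(1)]] path_image_nonempty[of p] by blast
    \<comment> \<open>By compactness the arc stays away from the horizontal sides; \<open>y\<close>
      is a height strictly between the arc and the upper side.\<close>
    define y where "y = (\<bar>Im z0\<bar> + pi / 2) / 2"
    have y: "0 < y" "y < pi / 2" "\<bar>Im z0\<bar> < y"
      using z0(1) p(2) by (auto simp: y_def strip_def)
    have p_y: "\<bar>Im (p t)\<bar> < y" if "t \<in> {0..1}" for t
      using z0(2)[of "p t"] y that by (auto simp: path_image_def)
    have below: "Im u < y" if u: "u \<in> U" for u
    proof (rule ccontr)
      assume "\<not> Im u < y"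
      then have uy: "y \<le> Im u" by simp
      have "path_connected U"
        using openU connected_open_path_connected connected_connected_component unfolding U_def by blast
      then obtain g where g: "path g" "path_image g \<subseteq> U" "pathstart g = of_real x" "pathfinish g = u"
        using xU u unfolding path_connected_def by blast
      have gc: "path (cnj \<circ> g)" by (intro path_continuous_image g continuous_intros)
      have ends: "pathfinish (reversepath (cnj \<circ> g)) = pathstart g"
        using g by (simp add: pathstart_compose)
      \<comment> \<open>\<open>q\<close> leads from \<open>cnj u\<close> through \<open>x\<close> to
        \<open>u\<close> inside \<open>D\<close>, hence from below height \<open>-y\<close> to above
        height \<open>y\<close>, and must cross \<open>p\<close>, which traverses the box
        horizontally. But \<open>D\<close> avoids \<open>p\<close>.\<close>
      define q where "q = reversepath (cnj \<circ> g) +++ g"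
      have q: "path q" unfolding q_def using g gc ends by (intro path_join_imp) auto
      have "path_image q \<subseteq> cnj ` U \<union> U"
        unfolding q_def path_image_join[OF ends] using g by (auto simp: path_image_compose)
      then have qD: "path_image q \<subseteq> D" using UD cnj_D by blast
      have qt: "q t \<in> D" if "t \<in> {0..1}" for t using qD that by (auto simp: path_image_def)
      have q01: "q 0 = cnj u" "q 1 = u"
        using g by (auto simp: q_def joinpaths_def reversepath_def pathfinish_def pathstart_def)
      obtain s t where "s \<in> {0..1}" "t \<in> {0..1}" "p s = q t"
      proof (rule fashoda_complex[OF p(1) q y(1) p_y p_ends])
        show "x - L < Re (q t) \<and> Re (q t) < x + L" if "t \<in> {0..1}" for t
          using qt[OF that] by (auto simp: D_def B_def)
      qed (use q01 uy in auto)
      then have "q t \<in> E" by (force simp: E_def path_image_def)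
      then show False using qt \<open>t \<in> {0..1}\<close> by (simp add: D_def)
    qed
    \<comment> \<open>Symmetry of \<open>U\<close> turns the upper bound for imaginary parts into
      the lower one.\<close>
    have cnj_U: "cnj u \<in> U" if "u \<in> U" for u
    proof -
      have "cnj ` U \<subseteq> U" unfolding U_def
      proof (rule connected_component_maximal)
        show "connected (cnj ` connected_component_set D (of_real x))"
          by (intro connected_continuous_image continuous_intros) auto
        show "cnj ` connected_component_set D (of_real x) \<subseteq> D"
          using UD cnj_D unfolding U_def by blast
        show "complex_of_real x \<in> cnj ` connected_component_set D (of_real x)"
          using xU unfolding U_def by (metis complex_cnj_complex_of_real imageI)
      qed
      then show ?thesis using that by blast
    qed
    have U_box: "U \<subseteq> {z. x - L \<le> Re z} \<inter> {z. Re z \<le> x + L} \<inter> {z. - y \<le> Im z} \<inter> {z. Im z \<le> y}"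
      using UD below below[OF cnj_U] by (fastforce simp: D_def B_def)
    have clU: "closure U \<subseteq> {z. x - L \<le> Re z} \<inter> {z. Re z \<le> x + L} \<inter> {z. - y \<le> Im z} \<inter> {z. Im z \<le> y}"
      by (rule closure_minimal[OF U_box])
        (intro closed_Int closed_halfspace_Re_ge closed_halfspace_Re_le closed_halfspace_Im_ge closed_halfspace_Im_le)
    then have clU_strip: "closure U \<subseteq> strip"
      using y by (force simp: strip_def)
    have "U \<subseteq> cbox (Complex (x - L) (-y)) (Complex (x + L) y)"
      using U_box by (auto simp: in_cbox_complex_iff)
    then have bU: "bounded U" using bounded_subset bounded_cbox by blast
    have fr: "z \<in> E \<or> Re z = x - L \<or> Re z = x + L" if z: "z \<in> frontier U" for z
    proof -
      have "z \<in> frontier D" using z frontier_of_connected_component_subset unfolding U_def by blast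
      then have "z \<notin> D" using openD by (simp add: frontier_def interior_open)
      moreover have "z \<in> closure U" using z by (simp add: frontier_def)
      ultimately show ?thesis using clU clU_strip by (fastforce simp: D_def B_def)
    qed
    have "norm (G (of_real x)) \<le> 5 * K * e + 5 * K\<^sup>2 / (L\<^sup>2 + 1)"
    proof (rule maximum_modulus_frontier[of G U])
      show "G holomorphic_on interior U"
        by (rule holomorphic_on_subset[OF holG]) (use clU_strip interior_subset closure_subset in blast)
      show "continuous_on (closure U) G"
        by (rule continuous_on_subset[OF holomorphic_on_imp_continuous_on[OF holG] clU_strip])
      show "bounded U" by (rule bU)
      show "of_real x \<in> U" by (rule xU)
      fix z assume z: "z \<in> frontier U"
      have zs: "z \<in> strip" using z clU_strip by (auto simp: frontier_def)
      from fr[OF z] show "norm (G z) \<le> 5 * K * e + 5 * K\<^sup>2 / (L\<^sup>2 + 1)"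
      proof
        assume "z \<in> E" then show ?thesis using order_trans[OF G_E rhs(1)] by blast
      next
        assume "Re z = x - L \<or> Re z = x + L"
        then have "(Re z - x)\<^sup>2 = L\<^sup>2" by auto
        then show ?thesis using G_strip[OF zs] rhs by (simp add: power2_eq_square)
      qed
    qed
    then show ?thesis by (simp add: Gx)
  qed
qed

text \<open>For \<open>x\<close> far to the right, a late piece of the curve on which
  \<open>F\<close> is below \<open>e\<close> spans the interval from \<open>x - L\<close> to
  \<open>x + L\<close>, and \<open>strip_two_constants\<close> applies at \<open>x\<close>.\<close>

lemma Lindelof_strip:
  assumes hol: "F holomorphic_on strip" and bdd: "\<And>z. z \<in> strip \<Longrightarrow> norm (F z) \<le> K"
    and \<gamma>: "continuous_on {T::real..} \<gamma>" "\<And>t. T \<le> t \<Longrightarrow> \<gamma> t \<in> strip"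
    and Re: "filterlim (\<lambda>t. Re (\<gamma> t)) at_top at_top"
    and lim: "((\<lambda>t. F (\<gamma> t)) \<longlongrightarrow> 0) at_top"
  shows "((\<lambda>x. F (of_real x)) \<longlongrightarrow> 0) at_top"
proof -
  have K: "0 \<le> K" using order_trans[OF norm_ge_zero bdd[of 0]] by (simp add: strip_def)
  show ?thesis unfolding tendsto_iff
  proof (intro allI impI)
    fix r :: real assume r: "0 < r"
    \<comment> \<open>\<open>e\<close> and \<open>L\<close> are chosen so that each of the two terms
      in \<open>strip_two_constants\<close> is at most \<open>r\<^sup>2 / 3\<close>. The summand 1
      in \<open>K + 1\<close> and in \<open>L\<close> covers \<open>K = 0\<close>.\<close>
    define e where "e = r\<^sup>2 / (15 * (K + 1))"
    have e: "0 < e" using r K by (simp add: e_def)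
    have "5 * K * e = r\<^sup>2 / 3 * (K / (K + 1))" using K by (simp add: e_def field_simps)
    also have "\<dots> \<le> r\<^sup>2 / 3 * 1" using K by (intro mult_left_mono) (auto simp: divide_le_eq)
    finally have e1: "5 * K * e \<le> r\<^sup>2 / 3" by simp
    define L where "L = sqrt (15 * K\<^sup>2 / r\<^sup>2) + 1"
    have "0 \<le> 15 * K\<^sup>2 / r\<^sup>2" using r by simp
    then have "15 * K\<^sup>2 / r\<^sup>2 \<le> L\<^sup>2 + 1" and Lpos: "0 < L"
      by (auto simp: L_def power2_sum intro: add_nonneg_pos add_increasing2)
    then have e2: "5 * K\<^sup>2 / (L\<^sup>2 + 1) \<le> r\<^sup>2 / 3"
      using r by (simp add: field_simps add_nonneg_pos)
    have "\<forall>\<^sub>F t in at_top. T \<le> t \<and> norm (F (\<gamma> t)) < e"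
      using eventually_ge_at_top[of T] tendstoD[OF lim e] by eventually_elim simp
    then obtain T1 where T1: "\<And>t. T1 \<le> t \<Longrightarrow> T \<le> t \<and> norm (F (\<gamma> t)) < e"
      unfolding eventually_at_top_linorder by blast
    show "\<forall>\<^sub>F x in at_top. dist (F (of_real x)) 0 < r"
      using eventually_ge_at_top[of "Re (\<gamma> T1) + L"]
    proof eventually_elim
      case (elim x)
      have "\<forall>\<^sub>F t in at_top. x + L \<le> Re (\<gamma> t) \<and> T1 < t"
        using Re eventually_gt_at_top[of T1] unfolding filterlim_at_top
        by (intro eventually_conj) auto
      then obtain T2 where T2: "x + L \<le> Re (\<gamma> T2)" "T1 < T2"
        unfolding eventually_at_top_linorder by blast
      define p where "p = (\<lambda>s. \<gamma> (T1 + s * (T2 - T1)))"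
      have in1: "T1 \<le> T1 + s * (T2 - T1)" if "s \<in> {0..1}" for s
        using that T2 by simp
      have "path p" unfolding p_def path_def
        by (rule continuous_on_compose2[OF \<gamma>(1)]) (use in1 T1 in \<open>auto intro!: continuous_intros\<close>)
      moreover have "path_image p \<subseteq> strip"
        using in1 T1 \<gamma>(2) by (auto simp: path_image_def p_def)
      moreover have "norm (F z) \<le> e" if "z \<in> path_image p" for z
        using that in1 T1 by (fastforce simp: path_image_def p_def intro: less_imp_le)
      moreover have "Re (p 0) \<le> x - L" "x + L \<le> Re (p 1)" using T2 elim by (auto simp: p_def)
      ultimately have "(norm (F (of_real x)))\<^sup>2 \<le> 5 * K * e + 5 * K\<^sup>2 / (L\<^sup>2 + 1)"
        using strip_two_constants[OF hol bdd _ _ _ _ _ Lpos] by blast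
      also have "\<dots> \<le> r\<^sup>2 / 3 + r\<^sup>2 / 3" using e1 e2 by (rule add_mono)
      also have "\<dots> < r\<^sup>2" using r by simp
      finally have "norm (F (of_real x)) < r" using r by (metis less_imp_le power_less_imp_less_base)
      then show ?case by simp
    qed
  qed
qed

text \<open>The points \<open>cayley_inv \<sigma> (exp x)\<close> with real \<open>x\<close> run
  along the diameter towards \<sigma>. Comparing every curve with this common one makes limits along
  any two curves agree.\<close>

lemma Lindelof_radial:
  assumes \<sigma>: "\<sigma> \<in> unit_circle"
    and hol: "f holomorphic_on unit_disc" and bdd: "\<And>z. z \<in> unit_disc \<Longrightarrow> norm (f z) \<le> K"
    and \<gamma>: "continuous_on {T::real..} \<gamma>" "\<And>t. T \<le> t \<Longrightarrow> \<gamma> t \<in> unit_disc" "(\<gamma> \<longlongrightarrow> \<sigma>) at_top"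
    and lim: "((\<lambda>t. f (\<gamma> t)) \<longlongrightarrow> a) at_top"
  shows "((\<lambda>x. f (cayley_inv \<sigma> (exp (of_real x)))) \<longlongrightarrow> a) at_top"
proof -
  define F where "F = (\<lambda>w. f (cayley_inv \<sigma> (exp w)) - a)"
  define \<eta> where "\<eta> = (\<lambda>t. Ln (cayley \<sigma> (\<gamma> t)))"
  have Re_exp_pos: "0 < Re (exp w)" if "w \<in> strip" for w
  proof -
    have "0 < cos (Im w)" using that by (intro cos_gt_zero_pi) (auto simp: strip_def)
    then show ?thesis by (simp add: Re_exp)
  qed
  have in_disc: "cayley_inv \<sigma> (exp w) \<in> unit_disc" if "w \<in> strip" for w
    by (rule cayley_inv_disc[OF \<sigma> Re_exp_pos[OF that]])
  have "(cayley_inv \<sigma> \<circ> exp) holomorphic_on strip"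
    by (rule holomorphic_on_compose_gen[OF holomorphic_on_exp cayley_inv_holomorphic[OF \<sigma>]])
      (use Re_exp_pos in auto)
  then have "(f \<circ> (cayley_inv \<sigma> \<circ> exp)) holomorphic_on strip"
    by (rule holomorphic_on_compose_gen[OF _ hol]) (use in_disc in auto)
  then have holF: "F holomorphic_on strip"
    unfolding F_def o_def by (intro holomorphic_intros)
  have bddF: "norm (F w) \<le> K + norm a" if "w \<in> strip" for w
    unfolding F_def using bdd[OF in_disc[OF that]] norm_triangle_ineq4 by (smt (verit))
  have pos: "0 < Re (cayley \<sigma> (\<gamma> t))" if "T \<le> t" for t
    by (rule Re_cayley_pos[OF \<sigma> \<gamma>(2)[OF that]])
  then have nz: "cayley \<sigma> (\<gamma> t) \<noteq> 0" if "T \<le> t" for t using that by force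
  have exp_\<eta>: "cayley_inv \<sigma> (exp (\<eta> t)) = \<gamma> t" if "T \<le> t" for t
    by (simp add: \<eta>_def nz[OF that] cayley_inv_cayley[OF \<sigma> \<gamma>(2)[OF that]])
  have ev: "\<forall>\<^sub>F t in at_top. T \<le> t" by (rule eventually_ge_at_top)
  have "((\<lambda>x. F (of_real x)) \<longlongrightarrow> 0) at_top"
  proof (rule Lindelof_strip[OF holF bddF])
    have "continuous_on {T..} (cayley \<sigma> \<circ> \<gamma>)"
      by (intro continuous_on_compose \<gamma>(1) continuous_on_subset[OF
            holomorphic_on_imp_continuous_on[OF cayley_holomorphic[OF \<sigma>]]]) (use \<gamma>(2) in auto)
    then show "continuous_on {T..} \<eta>"
      unfolding \<eta>_def o_def
      by (intro continuous_intros) (use pos in \<open>auto simp: complex_nonpos_Reals_iff not_le\<close>)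
    show "\<eta> t \<in> strip" if "T \<le> t" for t
      using pos[OF that] Re_Ln_pos_lt[OF nz[OF that]] unfolding \<eta>_def strip_def by blast
    have "filterlim (\<lambda>t. cayley \<sigma> (\<gamma> t)) at_infinity at_top"
      by (rule cayley_at_infinity[OF \<sigma> \<gamma>(3) eventually_mono[OF ev \<gamma>(2)]])
    then have "filterlim (\<lambda>t. ln (norm (cayley \<sigma> (\<gamma> t)))) at_top at_top"
      by (intro filterlim_compose[OF ln_at_top] filterlim_at_infinity_imp_norm_at_top)
    moreover have "\<forall>\<^sub>F t in at_top. Re (\<eta> t) = ln (norm (cayley \<sigma> (\<gamma> t)))"
      using ev by eventually_elim (simp add: \<eta>_def nz)
    ultimately show "filterlim (\<lambda>t. Re (\<eta> t)) at_top at_top"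
      by (simp add: filterlim_cong[OF refl refl])
    have "((\<lambda>t. f (\<gamma> t) - a) \<longlongrightarrow> a - a) at_top" by (intro tendsto_intros lim)
    moreover have "\<forall>\<^sub>F t in at_top. f (\<gamma> t) - a = F (\<eta> t)"
      using ev by eventually_elim (simp add: F_def exp_\<eta>)
    ultimately show "((\<lambda>t. F (\<eta> t)) \<longlongrightarrow> 0) at_top"
      using Lim_transform_eventually by fastforce
  qed
  then have "((\<lambda>x. F (of_real x) + a) \<longlongrightarrow> 0 + a) at_top" by (intro tendsto_intros)
  then show ?thesis by (simp add: F_def)
qed

lemma Lindelof:
  assumes \<sigma>: "\<sigma> \<in> unit_circle"
    and hol: "f holomorphic_on unit_disc" and bdd: "\<And>z. z \<in> unit_disc \<Longrightarrow> norm (f z) \<le> K"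
    and "continuous_on {T::real..} \<gamma>" "\<And>t. T \<le> t \<Longrightarrow> \<gamma> t \<in> unit_disc" "(\<gamma> \<longlongrightarrow> \<sigma>) at_top"
    and "((\<lambda>t. f (\<gamma> t)) \<longlongrightarrow> a) at_top"
    and "continuous_on {T'::real..} \<gamma>'" "\<And>t. T' \<le> t \<Longrightarrow> \<gamma>' t \<in> unit_disc" "(\<gamma>' \<longlongrightarrow> \<sigma>) at_top"
    and "((\<lambda>t. f (\<gamma>' t)) \<longlongrightarrow> b) at_top"
  shows "a = b"
  using tendsto_unique[OF trivial_limit_at_top_linorder
      Lindelof_radial[OF \<sigma> hol bdd assms(4-7)] Lindelof_radial[OF \<sigma> hol bdd assms(8-11)]] .

section \<open>Orbits of holomorphic semigroups\<close>

locale disc_semigroup =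
  fixes \<phi> :: "real \<Rightarrow> complex \<Rightarrow> complex"
  assumes semi: "holomorphic_semigroup \<phi>"
begin

lemma hol: "0 \<le> t \<Longrightarrow> \<phi> t holomorphic_on unit_disc"
  using semi unfolding holomorphic_semigroup_def by blast

lemma maps: "0 \<le> t \<Longrightarrow> z \<in> unit_disc \<Longrightarrow> \<phi> t z \<in> unit_disc"
  using semi unfolding holomorphic_semigroup_def by blast

lemma zero: "z \<in> unit_disc \<Longrightarrow> \<phi> 0 z = z"
  using semi unfolding holomorphic_semigroup_def by blast

lemma add: "0 \<le> t \<Longrightarrow> 0 \<le> s \<Longrightarrow> z \<in> unit_disc \<Longrightarrow> \<phi> (t + s) z = \<phi> t (\<phi> s z)"
  using semi unfolding holomorphic_semigroup_def by blast

lemma ulim: "0 \<le> t \<Longrightarrow> compact K \<Longrightarrow> K \<subseteq> unit_disc \<Longrightarrow> uniform_limit K \<phi> (\<phi> t) (at t within {0..})"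
  using semi unfolding holomorphic_semigroup_def by blast

lemma orbit_continuous:
  assumes z: "z \<in> unit_disc" shows "continuous_on {0..} (\<lambda>t. \<phi> t z)"
  unfolding continuous_on_def
proof
  fix t :: real assume "t \<in> {0..}"
  then have "uniform_limit {z} \<phi> (\<phi> t) (at t within {0..})" using z by (intro ulim) auto
  then show "((\<lambda>t. \<phi> t z) \<longlongrightarrow> \<phi> t z) (at t within {0..})"
    by (rule tendsto_uniform_limitI) simp
qed

text \<open>For small \<open>s\<close> the function \<open>\<phi> s z - z\<close> is uniformly at
  most \<open>r / 2\<close> near \<open>p\<close>. Cauchy's estimate on discs of radius
  \<open>r\<close> bounds its derivative by 1/2, so \<open>\<phi> s\<close> is the identity plus a
  contraction.\<close>

lemma locally_inj:
  assumes p: "p \<in> unit_disc"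
  obtains r d where "0 < r" "0 < d" "\<And>s. 0 \<le> s \<Longrightarrow> s < d \<Longrightarrow> inj_on (\<phi> s) (ball p r)"
proof -
  obtain R where R: "0 < R" "cball p R \<subseteq> unit_disc"
    using p open_contains_cball[of unit_disc] open_ball by blast
  define r where "r = R / 2"
  have r: "0 < r" using R by (simp add: r_def)
  have "uniform_limit (cball p R) \<phi> (\<phi> 0) (at 0 within {0..})" by (intro ulim R) auto
  then have "\<forall>\<^sub>F s in at 0 within {0..}. \<forall>z\<in>cball p R. dist (\<phi> s z) (\<phi> 0 z) < r / 2"
    using r unfolding uniform_limit_iff by (meson half_gt_zero)
  then obtain d where d: "0 < d"
    "\<And>s z. 0 \<le> s \<Longrightarrow> s \<noteq> 0 \<Longrightarrow> s < d \<Longrightarrow> z \<in> cball p R \<Longrightarrow> dist (\<phi> s z) (\<phi> 0 z) < r / 2"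
    unfolding eventually_at by (auto simp: dist_real_def)
  have close: "norm (\<phi> s z - z) \<le> r / 2" if "0 \<le> s" "s < d" "z \<in> cball p R" for s z
  proof -
    have "z \<in> unit_disc" using that R by blast
    then show ?thesis using d(2)[OF that(1) _ that(2,3)] zero r
      by (cases "s = 0") (auto simp: dist_norm)
  qed
  have "inj_on (\<phi> s) (ball p r)" if s: "0 \<le> s" "s < d" for s
  proof (rule inj_onI)
    fix a b assume ab: "a \<in> ball p r" "b \<in> ball p r" "\<phi> s a = \<phi> s b"
    define e where "e = (\<lambda>z. \<phi> s z - z)"
    have hole: "e holomorphic_on unit_disc" unfolding e_def by (intro holomorphic_intros hol s)
    have sub: "cball z r \<subseteq> cball p R" if "z \<in> ball p r" for z
    proof
      fix v assume "v \<in> cball z r"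
      then show "v \<in> cball p R" using that dist_triangle[of p v z] by (simp add: r_def)
    qed
    have bound: "norm (deriv e z) \<le> 1 / 2" if z: "z \<in> ball p r" for z
    proof -
      have "norm ((deriv ^^ 1) e z) \<le> fact 1 * (r / 2) / r ^ 1"
      proof (rule Cauchy_inequality)
        have zs: "cball z r \<subseteq> unit_disc" by (rule order_trans[OF sub[OF z] R(2)])
        show "e holomorphic_on ball z r"
          by (rule holomorphic_on_subset[OF hole order_trans[OF ball_subset_cball zs]])
        show "continuous_on (cball z r) e"
          by (rule continuous_on_subset[OF holomorphic_on_imp_continuous_on[OF hole] zs])
        show "0 < r" by fact
        show "norm (e x) \<le> r / 2" if "norm (z - x) = r" for x
          unfolding e_def using that sub[OF z] by (intro close s) (auto simp: dist_norm)
      qed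
      then show ?thesis using r by simp
    qed
    have deriv: "(e has_field_derivative deriv e z) (at z within ball p r)" if "z \<in> ball p r" for z
    proof -
      have "z \<in> cball z r" using r by simp
      then have "z \<in> unit_disc" using sub[OF that] R by blast
      then show ?thesis using holomorphic_derivI[OF hole open_ball] has_field_derivative_at_within by blast
    qed
    have "norm (e a - e b) \<le> 1 / 2 * norm (a - b)"
      by (rule field_differentiable_bound[OF convex_ball deriv bound ab(1,2)])
    moreover have "e a - e b = b - a" using ab(3) by (simp add: e_def)
    ultimately show "a = b" by (simp add: norm_minus_commute)
  qed
  then show ?thesis using that r d(1) by blast
qed

text \<open>If two orbits merge, look at the first time they do so: just before it both are close to the
  meeting point, where the semigroup is injective for small times.\<close>

lemma inj:
  assumes T: "0 \<le> T" shows "inj_on (\<phi> T) unit_disc"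
proof (rule inj_onI, rule ccontr)
  fix z w assume zw: "z \<in> unit_disc" "w \<in> unit_disc" "\<phi> T z = \<phi> T w" "z \<noteq> w"
  define S where "S = {t \<in> {0..T}. \<phi> t z - \<phi> t w = 0}"
  have cont: "continuous_on {0..T} (\<lambda>t. \<phi> t u)" if "u \<in> unit_disc" for u
    by (rule continuous_on_subset[OF orbit_continuous[OF that]]) auto
  have "closed S" unfolding S_def
    by (rule continuous_closed_preimage_constant) (intro continuous_intros cont zw, simp)
  moreover have "bounded S" unfolding S_def by (rule bounded_subset[of "{0..T}"]) auto
  moreover have "S \<noteq> {}" using T zw by (auto simp: S_def)
  ultimately obtain t where t: "t \<in> S" "\<And>s. s \<in> S \<Longrightarrow> t \<le> s"
    using compact_attains_inf compact_eq_bounded_closed by metis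
  have t': "0 \<le> t" "t \<le> T" "\<phi> t z = \<phi> t w" using t(1) by (auto simp: S_def)
  have t0: "0 < t" using t' zw zero by (cases "t = 0") auto
  define p where "p = \<phi> t z"
  have p: "p \<in> unit_disc" unfolding p_def by (rule maps[OF t'(1) zw(1)])
  obtain r d where rd: "0 < r" "0 < d" "\<And>s. 0 \<le> s \<Longrightarrow> s < d \<Longrightarrow> inj_on (\<phi> s) (ball p r)"
    using locally_inj[OF p] by blast
  have near: "\<exists>e>0. \<forall>s. 0 \<le> s \<and> \<bar>s - t\<bar> < e \<longrightarrow> \<phi> s u \<in> ball p r" if "u \<in> unit_disc" "\<phi> t u = p" for u
  proof -
    have "\<exists>e>0. \<forall>s\<in>{0..}. dist s t < e \<longrightarrow> dist (\<phi> s u) (\<phi> t u) < r"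
      using orbit_continuous[OF that(1)] t'(1) rd(1) unfolding continuous_on_iff by (meson atLeast_iff)
    then show ?thesis using that(2) by (auto simp: dist_real_def dist_commute)
  qed
  obtain e1 where e1: "e1 > 0" "\<forall>s. 0 \<le> s \<and> \<bar>s - t\<bar> < e1 \<longrightarrow> \<phi> s z \<in> ball p r"
    using near[OF zw(1)] p_def by blast
  obtain e2 where e2: "e2 > 0" "\<forall>s. 0 \<le> s \<and> \<bar>s - t\<bar> < e2 \<longrightarrow> \<phi> s w \<in> ball p r"
    using near[OF zw(2)] p_def t'(3) by auto
  define h where "h = min (min e1 e2) (min d t) / 2"
  have h: "0 < h" "h < e1" "h < e2" "h < d" "h < t"
    using e1(1) e2(1) rd(2) t0 by (auto simp: h_def min_def)
  have in_ball: "\<phi> (t - h) z \<in> ball p r" "\<phi> (t - h) w \<in> ball p r"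
    using e1(2) e2(2) h by auto
  have "\<phi> h (\<phi> (t - h) z) = \<phi> h (\<phi> (t - h) w)"
    using add[of h "t - h" z] add[of h "t - h" w] h zw t' by simp
  then have "\<phi> (t - h) z = \<phi> (t - h) w"
    using rd(3)[of h] h in_ball by (meson inj_onD less_imp_le)
  then have "t - h \<in> S" using h t' by (simp add: S_def)
  then show False using t(2)[of "t - h"] h by simp
qed

section \<open>Orbits defined for all times\<close>

definition full_orbit :: "(real \<Rightarrow> complex) \<Rightarrow> bool" where
  "full_orbit \<Gamma> \<longleftrightarrow> continuous_on UNIV \<Gamma> \<and> range \<Gamma> \<subseteq> unit_disc \<and> (\<forall>s\<ge>0. \<forall>t. \<phi> s (\<Gamma> t) = \<Gamma> (t + s))"

lemma full_orbitD:
  assumes "full_orbit \<Gamma>"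
  shows "continuous_on UNIV \<Gamma>" "\<Gamma> t \<in> unit_disc" "0 \<le> s \<Longrightarrow> \<phi> s (\<Gamma> t) = \<Gamma> (t + s)"
  using assms unfolding full_orbit_def image_subset_iff by simp_all

lemma full_orbit_extend:
  assumes "backward_orbit \<phi> \<gamma>"
  shows "full_orbit (\<lambda>s. if s \<le> 0 then \<gamma> (- s) else \<phi> s (\<gamma> 0))"
proof -
  have c: "continuous_on {0..} \<gamma>" and D: "\<And>t. 0 \<le> t \<Longrightarrow> \<gamma> t \<in> unit_disc"
    and flow: "\<And>s t. 0 < t \<Longrightarrow> 0 \<le> s \<Longrightarrow> s \<le> t \<Longrightarrow> \<phi> s (\<gamma> t) = \<gamma> (t - s)"
    using assms unfolding backward_orbit_def by auto
  have flow': "\<phi> s (\<gamma> t) = \<gamma> (t - s)" if "0 \<le> s" "s \<le> t" for s t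
    using that flow[of t s] zero[OF D, of t] by (cases "t = 0") auto
  have "continuous_on ({..0} \<union> {0..}) (\<lambda>s. if s \<le> 0 then \<gamma> (- s) else \<phi> s (\<gamma> 0))"
  proof (rule continuous_on_If)
    show "continuous_on {..0} (\<lambda>s. \<gamma> (- s))"
      by (rule continuous_on_compose2[OF c]) (auto intro!: continuous_intros)
    show "continuous_on {0..} (\<lambda>s. \<phi> s (\<gamma> 0))" by (rule orbit_continuous[OF D]) simp
  qed (auto simp: zero[OF D])
  moreover have "{..0} \<union> {0::real..} = UNIV" by auto
  moreover have "(if t \<le> 0 then \<gamma> (- t) else \<phi> t (\<gamma> 0)) \<in> unit_disc" for t
    using D[of "- t"] maps[OF _ D, of t 0] by auto
  moreover have "\<phi> s (if t \<le> 0 then \<gamma> (- t) else \<phi> t (\<gamma> 0)) =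
      (if t + s \<le> 0 then \<gamma> (- (t + s)) else \<phi> (t + s) (\<gamma> 0))" if s: "0 \<le> s" for s t
  proof -
    consider "t + s \<le> 0" | "t \<le> 0" "0 < t + s" | "0 < t" by linarith
    then show ?thesis
    proof cases
      case 1
      have "- t - s = - (t + s)" by simp
      then show ?thesis using flow'[of s "- t"] s 1 by simp
    next
      case 2
      have "\<phi> ((t + s) + (- t)) (\<gamma> (- t)) = \<phi> (t + s) (\<phi> (- t) (\<gamma> (- t)))"
        using 2 by (intro add D) auto
      then show ?thesis using 2 flow'[of "- t" "- t"] by simp
    next
      case 3
      then show ?thesis using add[of s t "\<gamma> 0"] s D by (simp add: add.commute)
    qed
  qed
  ultimately show ?thesis unfolding full_orbit_def image_subset_iff by simp
qed

text \<open>Forward in time this is the semigroup law; backward in time it is the injectivity of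
  \<open>\<phi> (- s)\<close>.\<close>

lemma full_orbits_coincide:
  assumes 1: "full_orbit \<Gamma>\<^sub>1" and 2: "full_orbit \<Gamma>\<^sub>2" and eq: "\<Gamma>\<^sub>1 a = \<Gamma>\<^sub>2 b"
  shows "\<Gamma>\<^sub>1 (a + s) = \<Gamma>\<^sub>2 (b + s)"
proof (cases "0 \<le> s")
  case True
  have "\<Gamma>\<^sub>1 (a + s) = \<phi> s (\<Gamma>\<^sub>1 a)" by (rule full_orbitD(3)[OF 1 True, symmetric])
  also have "\<dots> = \<phi> s (\<Gamma>\<^sub>2 b)" by (simp only: eq)
  also have "\<dots> = \<Gamma>\<^sub>2 (b + s)" by (rule full_orbitD(3)[OF 2 True])
  finally show ?thesis .
next
  case False
  then have s: "0 \<le> - s" by simp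
  have "\<phi> (- s) (\<Gamma>\<^sub>1 (a + s)) = \<Gamma>\<^sub>1 a" using full_orbitD(3)[OF 1 s, of "a + s"] by simp
  moreover have "\<phi> (- s) (\<Gamma>\<^sub>2 (b + s)) = \<Gamma>\<^sub>2 b" using full_orbitD(3)[OF 2 s, of "b + s"] by simp
  ultimately have "\<phi> (- s) (\<Gamma>\<^sub>1 (a + s)) = \<phi> (- s) (\<Gamma>\<^sub>2 (b + s))" by (simp only: eq)
  then show ?thesis
    by (rule inj_onD[OF inj[OF s] _ full_orbitD(2)[OF 1] full_orbitD(2)[OF 2]])
qed

lemma denjoy_wolff_uniform:
  assumes "denjoy_wolff_point \<phi> \<tau>" "compact K" "K \<subseteq> unit_disc" "0 < e"
  shows "\<forall>\<^sub>F t in at_top. \<forall>z\<in>K. dist (\<phi> t z) \<tau> < e"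
proof -
  have "uniform_limit K \<phi> (\<lambda>z. \<tau>) at_top"
    using assms(1-3) unfolding denjoy_wolff_point_def by simp
  then show ?thesis using \<open>0 < e\<close> by (rule uniform_limitD)
qed

lemma denjoy_wolff_tendsto:
  assumes "denjoy_wolff_point \<phi> \<tau>" "z \<in> unit_disc"
  shows "((\<lambda>t. \<phi> t z) \<longlongrightarrow> \<tau>) at_top"
  unfolding tendsto_iff using denjoy_wolff_uniform[OF assms(1), of "{z}"] assms(2) by simp

lemma denjoy_wolff_fixed:
  assumes dw: "denjoy_wolff_point \<phi> \<tau>" and \<tau>: "\<tau> \<in> unit_disc" and t: "0 \<le> t"
  shows "\<phi> t \<tau> = \<tau>"
proof -
  have "isCont (\<phi> t) \<tau>"
    using holomorphic_on_imp_continuous_on[OF hol[OF t]] \<tau> by (simp add: continuous_on_eq_continuous_at)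
  then have "((\<lambda>s. \<phi> t (\<phi> s 0)) \<longlongrightarrow> \<phi> t \<tau>) at_top"
    by (rule isCont_tendsto_compose) (rule denjoy_wolff_tendsto[OF dw], simp)
  moreover have "((\<lambda>s. \<phi> t (\<phi> s 0)) \<longlongrightarrow> \<tau>) at_top"
  proof (rule Lim_transform_eventually)
    show "((\<lambda>s. \<phi> (t + s) 0) \<longlongrightarrow> \<tau>) at_top"
      by (rule filterlim_compose[OF denjoy_wolff_tendsto[OF dw]])
        (auto intro: filterlim_tendsto_add_at_top[OF tendsto_const filterlim_ident])
    show "\<forall>\<^sub>F s in at_top. \<phi> (t + s) 0 = \<phi> t (\<phi> s 0)"
      using eventually_ge_at_top[of 0] by eventually_elim (auto intro: add[OF t])
  qed
  ultimately show ?thesis by (rule tendsto_unique[OF trivial_limit_at_top_linorder])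
qed

lemma full_orbit_tendsto:
  assumes dw: "denjoy_wolff_point \<phi> \<tau>" and \<Gamma>: "full_orbit \<Gamma>"
  shows "(\<Gamma> \<longlongrightarrow> \<tau>) at_top"
proof (rule Lim_transform_eventually)
  show "((\<lambda>t. \<phi> t (\<Gamma> 0)) \<longlongrightarrow> \<tau>) at_top" by (rule denjoy_wolff_tendsto[OF dw full_orbitD(2)[OF \<Gamma>]])
  show "\<forall>\<^sub>F t in at_top. \<phi> t (\<Gamma> 0) = \<Gamma> t"
    using eventually_ge_at_top[of 0] by eventually_elim (simp add: full_orbitD(3)[OF \<Gamma>])
qed

text \<open>A repeated value would make the orbit periodic. As it tends to \<tau> in forward time,
  it would then be constantly \<tau>, against the limit \<sigma> in backward time.\<close>

lemma full_orbit_inj: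
  assumes dw: "denjoy_wolff_point \<phi> \<tau>" and \<Gamma>: "full_orbit \<Gamma>"
    and lim: "(\<Gamma> \<longlongrightarrow> \<sigma>) at_bot" and ne: "\<sigma> \<noteq> \<tau>"
  shows "inj \<Gamma>"
proof (rule linorder_injI)
  fix a b :: real assume ab: "a < b"
  show "\<Gamma> a \<noteq> \<Gamma> b"
  proof
    assume eq: "\<Gamma> a = \<Gamma> b"
    define p where "p = b - a"
    have per: "\<Gamma> (s + p) = \<Gamma> s" for s
      using full_orbits_coincide[OF \<Gamma> \<Gamma> eq, of "s - a"] by (simp add: p_def algebra_simps)
    have pern: "\<Gamma> (s + real n * p) = \<Gamma> s" for s n
    proof (induction n)
      case (Suc n) then show ?case using per[of "s + real n * p"] by (simp add: algebra_simps)
    qed simp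
    have "\<Gamma> s = \<tau>" for s
    proof -
      have "filterlim (\<lambda>n. s + real n * p) at_top sequentially"
        using ab by (intro filterlim_tendsto_add_at_top[OF tendsto_const]
            filterlim_at_top_mult_tendsto_pos[OF tendsto_const] filterlim_real_sequentially) (simp add: p_def)
      then have "(\<lambda>n. \<Gamma> (s + real n * p)) \<longlonglongrightarrow> \<tau>"
        by (rule filterlim_compose[OF full_orbit_tendsto[OF dw \<Gamma>]])
      then show ?thesis by (simp add: pern LIMSEQ_const_iff)
    qed
    then have "\<Gamma> = (\<lambda>s. \<tau>)" by (rule ext)
    then show False using lim ne by (simp add: tendsto_const_iff)
  qed
qed

text \<open>An orbit through \<tau> would have \<tau> in the disc as a fixed point and would stop
  there, contradicting injectivity.\<close>

lemma full_orbit_ne_denjoy_wolff: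
  assumes dw: "denjoy_wolff_point \<phi> \<tau>" and \<Gamma>: "full_orbit \<Gamma>"
    and lim: "(\<Gamma> \<longlongrightarrow> \<sigma>) at_bot" and ne: "\<sigma> \<noteq> \<tau>"
  shows "\<Gamma> s \<noteq> \<tau>"
proof
  assume eq: "\<Gamma> s = \<tau>"
  then have "\<Gamma> (s + 1) = \<Gamma> s"
    using full_orbitD(2)[OF \<Gamma>, of s] full_orbitD(3)[OF \<Gamma>, of 1 s] denjoy_wolff_fixed[OF dw, of 1] by simp
  then show False using full_orbit_inj[OF assms] by (auto dest: injD)
qed

text \<open>Along the forward orbit of 0 the step from \<open>\<phi> n 0\<close> to
  \<open>\<phi> t (\<phi> n 0) = \<phi> n (\<phi> t 0)\<close> is bounded by the distance between 0
  and \<open>\<phi> t 0\<close>, by contraction. Consequently a super-repelling point is never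
  \<tau>.\<close>

lemma denjoy_wolff_boundary_regular:
  assumes dw: "denjoy_wolff_point \<phi> \<tau>" and bfp: "boundary_fixed_point \<phi> \<tau>"
  shows "boundary_regular_fixed_point \<phi> \<tau>"
proof (rule regular_if_bounded_hyperbolic_step[OF semi bfp])
  fix t :: real assume t: "0 \<le> t"
  have \<tau>: "\<tau> \<in> unit_circle" using bfp by (simp add: boundary_fixed_point_def)
  define g where "g = (\<lambda>n z. cayley \<tau> (\<phi> (real n) z))"
  have holg: "g n holomorphic_on unit_disc" for n
  proof -
    have "(cayley \<tau> \<circ> \<phi> (real n)) holomorphic_on unit_disc"
      by (rule holomorphic_on_compose_gen[OF hol cayley_holomorphic[OF \<tau>]]) (use maps in auto)
    then show ?thesis by (simp add: g_def o_def)
  qed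
  obtain M where M: "0 \<le> M" "\<And>n. half_plane_near M (g n 0) (g n (\<phi> t 0))"
  proof (rule half_plane_near_family[of unit_disc g 0 "\<phi> t 0"])
    show "0 < Re (g n z)" if "z \<in> unit_disc" for n z
      unfolding g_def by (intro Re_cayley_pos[OF \<tau>] maps that) simp
    show "\<phi> t 0 \<in> unit_disc" by (intro maps t) simp
  qed (use holg in auto)
  have "\<phi> t (\<phi> (real n) 0) = \<phi> (real n) (\<phi> t 0)" for n
    using add[of t "real n" 0] add[of "real n" t 0] t by (simp add: add.commute)
  moreover have "(\<lambda>n. \<phi> (real n) 0) \<longlonglongrightarrow> \<tau>"
    by (rule filterlim_compose[OF denjoy_wolff_tendsto[OF dw] filterlim_real_sequentially]) simp
  ultimately show "\<exists>v M. 0 \<le> M \<and> (\<forall>n::nat. v n \<in> unit_disc) \<and> v \<longlonglongrightarrow> \<tau> \<and>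
      (\<forall>n. half_plane_near M (cayley \<tau> (v n)) (cayley \<tau> (\<phi> t (v n))))"
    using M maps[of "real _" 0]
    by (intro exI[of _ "\<lambda>n. \<phi> (real n) 0"] exI[of _ M]) (simp add: g_def)
qed

end

section \<open>Increments of logarithms along curves\<close>

text \<open>A homeomorphism from the line onto the open unit interval; its inverse is the logit
  \<open>ln (x / (1 - x))\<close> used in \<open>line_path\<close>.\<close>

definition logistic :: "real \<Rightarrow> real" where "logistic s = 1 / (1 + exp (- s))"

text \<open>Compactifies a curve on the whole line to a path on the unit interval, with the limits
  at both ends inserted by hand as end points.\<close>

definition line_path :: "(real \<Rightarrow> 'a) \<Rightarrow> 'a \<Rightarrow> 'a \<Rightarrow> real \<Rightarrow> 'a" where
  "line_path \<Gamma> a b x = (if x \<le> 0 then a else if 1 \<le> x then b else \<Gamma> (ln (x / (1 - x))))"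

lemma logistic_bounds: "0 < logistic s" "logistic s < 1"
  by (simp_all add: logistic_def add_pos_pos)

lemma logit_logistic: "ln (logistic s / (1 - logistic s)) = s"
proof -
  have "1 + exp (- s) \<noteq> 0" using exp_gt_zero[of "- s"] by linarith
  then have "logistic s / (1 - logistic s) = 1 / exp (- s)"
    by (simp add: logistic_def field_simps)
  moreover have "1 / exp (- s) = exp s" by (metis exp_minus inverse_eq_divide minus_minus)
  ultimately show ?thesis by simp
qed

lemma logistic_logit: "0 < x \<Longrightarrow> x < 1 \<Longrightarrow> logistic (ln (x / (1 - x))) = x"
  by (simp add: logistic_def exp_minus field_simps)

lemma continuous_logistic: "continuous_on UNIV logistic"
proof -
  have "1 + exp (- s) \<noteq> 0" for s :: real using exp_gt_zero[of "- s"] by linarith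
  then show ?thesis unfolding logistic_def by (intro continuous_intros) auto
qed

lemma logistic_at_top: "filterlim logistic (at_left 1) at_top"
proof -
  have "((\<lambda>s. 1 / (1 + exp (- s))) \<longlongrightarrow> 1 / (1 + 0)) (at_top :: real filter)"
    by (intro tendsto_intros filterlim_compose[OF exp_at_bot filterlim_uminus_at_bot_at_top]) auto
  then show ?thesis
    using logistic_bounds by (simp add: filterlim_at logistic_def[abs_def] less_imp_neq less_imp_neq[symmetric])
qed

lemma logistic_at_bot: "filterlim logistic (at_right 0) at_bot"
proof -
  have "filterlim (\<lambda>s. 1 + exp (- s)) at_top (at_bot :: real filter)"
    by (intro filterlim_tendsto_add_at_top[OF tendsto_const] filterlim_compose[OF exp_at_top filterlim_uminus_at_top_at_bot])
  then have "((\<lambda>s. 1 / (1 + exp (- s))) \<longlongrightarrow> 0) (at_bot :: real filter)"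
    by (intro tendsto_divide_0[OF tendsto_const] filterlim_at_top_imp_at_infinity)
  then show ?thesis
    using logistic_bounds by (simp add: filterlim_at logistic_def[abs_def] less_imp_neq less_imp_neq[symmetric])
qed

lemma line_path_ends [simp]: "pathstart (line_path \<Gamma> a b) = a" "pathfinish (line_path \<Gamma> a b) = b"
  by (simp_all add: line_path_def pathstart_def pathfinish_def)

lemma line_path_logistic: "line_path \<Gamma> a b (logistic s) = \<Gamma> s"
  using logistic_bounds[of s] by (simp add: line_path_def logit_logistic not_le)

lemma line_path_image: "path_image (line_path \<Gamma> a b) = insert a (insert b (range \<Gamma>))"
proof
  show "path_image (line_path \<Gamma> a b) \<subseteq> insert a (insert b (range \<Gamma>))"
    by (auto simp: path_image_def line_path_def)
  have "\<Gamma> s \<in> path_image (line_path \<Gamma> a b)" for s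
    using logistic_bounds[of s] by (force simp: path_image_def simp flip: line_path_logistic[of \<Gamma> a b s])
  moreover have "a \<in> path_image (line_path \<Gamma> a b)" "b \<in> path_image (line_path \<Gamma> a b)"
    by (metis line_path_ends pathstart_in_path_image, metis line_path_ends pathfinish_in_path_image)
  ultimately show "insert a (insert b (range \<Gamma>)) \<subseteq> path_image (line_path \<Gamma> a b)" by auto
qed

lemma logit_at_right_0: "filterlim (\<lambda>x::real. ln (x / (1 - x))) at_bot (at_right 0)"
proof (rule filterlim_compose[OF ln_at_0])
  have "((\<lambda>x::real. x / (1 - x)) \<longlongrightarrow> 0 / (1 - 0)) (at_right 0)"
    by (intro tendsto_intros) auto
  moreover have "\<forall>\<^sub>F x::real in at_right 0. 0 < x / (1 - x)"
    using eventually_at_right_real[of 0 1] by (auto elim: eventually_mono)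
  ultimately show "filterlim (\<lambda>x::real. x / (1 - x)) (at_right 0) (at_right 0)"
    by (simp add: filterlim_at) (auto elim: eventually_mono)
qed

lemma logit_at_left_1: "filterlim (\<lambda>x::real. ln (x / (1 - x))) at_top (at_left 1)"
proof (rule filterlim_compose[OF ln_at_top])
  have 1: "((\<lambda>x::real. x) \<longlongrightarrow> 1) (at_left 1)" by (intro tendsto_intros)
  have "((\<lambda>x::real. 1 - x) \<longlongrightarrow> 1 - 1) (at_left 1)" by (intro tendsto_intros)
  moreover have "\<forall>\<^sub>F x::real in at_left 1. 0 < 1 - x"
    using eventually_at_left_real[of 0 1] by (auto elim: eventually_mono)
  ultimately have "filterlim (\<lambda>x::real. 1 - x) (at_right 0) (at_left 1)"
    by (simp add: filterlim_at) (auto elim: eventually_mono)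
  then have "filterlim (\<lambda>x::real. inverse (1 - x)) at_top (at_left 1)"
    by (rule filterlim_compose[OF filterlim_inverse_at_top_right])
  from filterlim_tendsto_pos_mult_at_top[OF 1 _ this]
  show "filterlim (\<lambda>x::real. x / (1 - x)) at_top (at_left 1)" by (simp add: divide_inverse)
qed

lemma path_line_path:
  assumes cont: "continuous_on UNIV \<Gamma>" and a: "(\<Gamma> \<longlongrightarrow> a) at_bot" and b: "(\<Gamma> \<longlongrightarrow> b) at_top"
  shows "path (line_path \<Gamma> a b)"
  unfolding path_def continuous_on_def
proof
  fix x :: real assume x: "x \<in> {0..1}"
  let ?p = "line_path \<Gamma> a b"
  consider "x = 0" | "x = 1" | "0 < x" "x < 1" using x by force
  then show "(?p \<longlongrightarrow> ?p x) (at x within {0..1})"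
  proof cases
    case 1
    have "((\<lambda>x. \<Gamma> (ln (x / (1 - x)))) \<longlongrightarrow> a) (at_right 0)"
      by (rule filterlim_compose[OF a logit_at_right_0])
    moreover have "\<forall>\<^sub>F x in at_right 0. \<Gamma> (ln (x / (1 - x))) = ?p x"
      using eventually_at_right_real[of 0 1] by (auto simp: line_path_def elim!: eventually_mono)
    ultimately have "(?p \<longlongrightarrow> a) (at_right 0)" by (rule Lim_transform_eventually)
    then show ?thesis using 1 by (simp add: at_within_Icc_at_right line_path_def)
  next
    case 2
    have "((\<lambda>x. \<Gamma> (ln (x / (1 - x)))) \<longlongrightarrow> b) (at_left 1)"
      by (rule filterlim_compose[OF b logit_at_left_1])
    moreover have "\<forall>\<^sub>F x in at_left 1. \<Gamma> (ln (x / (1 - x))) = ?p x"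
      using eventually_at_left_real[of 0 1] by (auto simp: line_path_def elim!: eventually_mono)
    ultimately have "(?p \<longlongrightarrow> b) (at_left 1)" by (rule Lim_transform_eventually)
    then show ?thesis using 2 by (simp add: at_within_Icc_at_left line_path_def)
  next
    case 3
    have "continuous_on {0<..<1} (\<lambda>x. \<Gamma> (ln (x / (1 - x))))"
      by (rule continuous_on_compose2[OF cont]) (auto intro!: continuous_intros)
    then have "((\<lambda>x. \<Gamma> (ln (x / (1 - x)))) \<longlongrightarrow> \<Gamma> (ln (x / (1 - x)))) (at x)"
      using 3 by (simp add: continuous_on_eq_continuous_at isCont_def)
    then have "(?p \<longlongrightarrow> \<Gamma> (ln (x / (1 - x)))) (at x)"
      by (rule Lim_transform_within_open[of _ _ _ _ "{0<..<1}"]) (use 3 in \<open>auto simp: line_path_def\<close>)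
    then show ?thesis using 3 by (simp add: line_path_def Lim_at_imp_Lim_at_within)
  qed
qed

lemma arc_line_path:
  assumes "path (line_path \<Gamma> a b)" "inj \<Gamma>" "a \<noteq> b" "a \<notin> range \<Gamma>" "b \<notin> range \<Gamma>"
  shows "arc (line_path \<Gamma> a b)"
  unfolding arc_def
proof (intro conjI assms(1) inj_onI)
  fix x y :: real assume xy: "x \<in> {0..1}" "y \<in> {0..1}" "line_path \<Gamma> a b x = line_path \<Gamma> a b y"
  have p0: "line_path \<Gamma> a b 0 = a" and p1: "line_path \<Gamma> a b 1 = b" by (simp_all add: line_path_def)
  have cases: "u = 0 \<or> u = 1 \<or> (\<exists>s. u = logistic s)" if "u \<in> {0..1}" for u
    using logistic_logit[of u] that by (metis atLeastAtMost_iff less_eq_real_def)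
  have eq_a: "line_path \<Gamma> a b u = a \<longleftrightarrow> u = 0" if "u \<in> {0..1}" for u
    using cases[OF that] assms(3,4) p0 p1 logistic_bounds by (auto simp: line_path_logistic)
  have eq_b: "line_path \<Gamma> a b u = b \<longleftrightarrow> u = 1" if "u \<in> {0..1}" for u
    using cases[OF that] assms(3,5) p0 p1 logistic_bounds by (auto simp: line_path_logistic)
  show "x = y"
  proof (cases "x \<in> {0, 1} \<or> y \<in> {0, 1}")
    case True
    then show ?thesis using xy eq_a eq_b p0 p1 by (metis empty_iff insert_iff)
  next
    case False
    then obtain s t where "x = logistic s" "y = logistic t" using cases xy by blast
    then show ?thesis using xy(3) assms(2) by (auto simp: line_path_logistic dest: injD)
  qed
qed

text \<open>The continuous logarithm along the path is carried back to the time parameter of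
  \<Gamma>, because there \<open>\<phi> t\<close> acts as a translation.\<close>

lemma winding_number_line_path:
  assumes \<Gamma>: "continuous_on UNIV \<Gamma>" "(\<Gamma> \<longlongrightarrow> a) at_bot" "(\<Gamma> \<longlongrightarrow> b) at_top"
    and w: "w \<noteq> a" "w \<noteq> b" "w \<notin> range \<Gamma>"
  obtains Q A B where "continuous_on UNIV Q" "\<And>s. exp (Q s) = \<Gamma> s - w"
    "(Q \<longlongrightarrow> A) at_bot" "(Q \<longlongrightarrow> B) at_top" "exp A = a - w" "exp B = b - w"
    "B - A = 2 * of_real pi * \<i> * winding_number (line_path \<Gamma> a b) w"
proof -
  have "path (line_path \<Gamma> a b)" by (rule path_line_path[OF \<Gamma>])
  moreover have "w \<notin> path_image (line_path \<Gamma> a b)" using w by (simp add: line_path_image)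
  ultimately obtain q where q: "path q"
    "pathfinish q - pathstart q = 2 * of_real pi * \<i> * winding_number (line_path \<Gamma> a b) w"
    "\<And>t. t \<in> {0..1} \<Longrightarrow> line_path \<Gamma> a b t = w + exp (q t)"
    using winding_number_as_continuous_log by blast
  have cont: "continuous_on {0..1} q" using q(1) by (simp add: path_def)
  show ?thesis
  proof (rule that[of "q \<circ> logistic" "q 0" "q 1"])
    show "continuous_on UNIV (q \<circ> logistic)"
      using logistic_bounds
      by (intro continuous_on_compose continuous_logistic continuous_on_subset[OF cont]) (force simp: less_imp_le)
    show "exp ((q \<circ> logistic) s) = \<Gamma> s - w" for s
      using q(3)[of "logistic s"] logistic_bounds[of s] by (simp add: line_path_logistic)
    have "(q \<longlongrightarrow> q 0) (at_right 0)"
      using cont by (auto simp: continuous_on_def at_within_Icc_at_right dest: bspec[of _ _ 0])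
    then show "((q \<circ> logistic) \<longlongrightarrow> q 0) at_bot"
      unfolding o_def by (rule filterlim_compose[OF _ logistic_at_bot])
    have "(q \<longlongrightarrow> q 1) (at_left 1)"
      using cont by (auto simp: continuous_on_def at_within_Icc_at_left dest: bspec[of _ _ 1])
    then show "((q \<circ> logistic) \<longlongrightarrow> q 1) at_top"
      unfolding o_def by (rule filterlim_compose[OF _ logistic_at_top])
    show "exp (q 0) = a - w" "exp (q 1) = b - w"
      using q(3)[of 0] q(3)[of 1] by (simp_all add: line_path_def)
    show "q 1 - q 0 = 2 * of_real pi * \<i> * winding_number (line_path \<Gamma> a b) w"
      using q(2) by (simp add: pathstart_def pathfinish_def)
  qed
qed

text \<open>\<open>l\<close> itself need not be bounded, but \<open>exp (l z / n)\<close> is, for every \<open>n\<close>; two different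
  values of the logarithm of the same number are separated by some \<open>exp (_ / n)\<close>.\<close>

lemma Lindelof_log:
  assumes \<sigma>: "\<sigma> \<in> unit_circle"
    and hol: "l holomorphic_on unit_disc" and bdd: "\<And>z. z \<in> unit_disc \<Longrightarrow> Re (l z) \<le> K"
    and \<gamma>: "continuous_on UNIV (\<gamma> :: real \<Rightarrow> complex)" "\<And>t. \<gamma> t \<in> unit_disc" "(\<gamma> \<longlongrightarrow> \<sigma>) at_top"
      "((\<lambda>t. l (\<gamma> t)) \<longlongrightarrow> a) at_top"
    and \<gamma>': "continuous_on UNIV (\<gamma>' :: real \<Rightarrow> complex)" "\<And>t. \<gamma>' t \<in> unit_disc" "(\<gamma>' \<longlongrightarrow> \<sigma>) at_top"
      "((\<lambda>t. l (\<gamma>' t)) \<longlongrightarrow> b) at_top"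
    and eq: "exp a = exp b"
  shows "a = b"
proof -
  obtain m :: int where m: "a = b + of_int (2 * m) * pi * \<i>" using eq exp_eq by blast
  \<comment> \<open>Any \<open>k\<close> larger than the modulus of \<open>m\<close> works:
    \<open>m\<close> is then divisible by \<open>k\<close> only if it is 0.\<close>
  define k :: int where "k = \<bar>m\<bar> + 1"
  have k: "k > 0" by (simp add: k_def)
  have "exp (a / of_int k) = exp (b / of_int k)"
  proof (rule Lindelof[OF \<sigma>])
    show "(\<lambda>z. exp (l z / of_int k)) holomorphic_on unit_disc"
      using k by (intro holomorphic_intros hol) auto
    show "norm (exp (l z / of_int k)) \<le> exp (max K 0)" if "z \<in> unit_disc" for z
    proof -
      have "Re (l z) / of_int k \<le> max K 0 / of_int k"
        using bdd[OF that] k by (intro divide_right_mono) auto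
      also have "\<dots> \<le> max K 0" using k by (simp add: divide_le_eq mult_le_cancel_left1)
      finally show ?thesis by simp
    qed
    show "continuous_on {0..} \<gamma>" "continuous_on {0..} \<gamma>'"
      using \<gamma>(1) \<gamma>'(1) continuous_on_subset by blast+
    show "((\<lambda>t. exp (l (\<gamma> t) / of_int k)) \<longlongrightarrow> exp (a / of_int k)) at_top"
      using k by (intro tendsto_intros \<gamma>) auto
    show "((\<lambda>t. exp (l (\<gamma>' t) / of_int k)) \<longlongrightarrow> exp (b / of_int k)) at_top"
      using k by (intro tendsto_intros \<gamma>') auto
  qed (use \<gamma> \<gamma>' in auto)
  then obtain m' :: int where m': "a / of_int k = b / of_int k + of_int (2 * m') * pi * \<i>"
    using exp_eq by blast
  then have "a = b + of_int (2 * (k * m')) * pi * \<i>" using k by (simp add: field_simps)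
  then have "of_int (2 * (k * m')) * (pi * \<i>) = of_int (2 * m) * (pi * \<i>)" using m by (simp add: mult.assoc)
  then have "(of_int (2 * (k * m')) :: complex) = of_int (2 * m)" by (subst (asm) mult_cancel_right) simp
  then have km: "k * m' = m" by (simp only: of_int_eq_iff)
  have "m' = 0"
  proof (rule ccontr)
    assume "m' \<noteq> 0"
    then have "k * 1 \<le> k * \<bar>m'\<bar>" using k by (intro mult_left_mono) auto
    moreover have "\<bar>k * m'\<bar> = \<bar>m\<bar>" by (simp only: km)
    then have "k * \<bar>m'\<bar> = \<bar>m\<bar>" using k by (simp add: abs_mult)
    ultimately show False using k_def by linarith
  qed
  then show ?thesis using m km by simp
qed

text \<open>Distinct values of the difference are at least \<open>2 * pi\<close> apart, so a
  continuous difference on the connected line is constant.\<close>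

lemma exp_const_diff:
  fixes f g :: "real \<Rightarrow> complex"
  assumes "continuous_on UNIV f" "continuous_on UNIV g" "\<And>s. exp (f s) = exp (g s)"
  obtains k where "\<And>s. f s = g s + k"
proof -
  have "(\<lambda>s. f s - g s) constant_on UNIV"
  proof (rule continuous_discrete_range_constant[OF connected_UNIV])
    show "continuous_on UNIV (\<lambda>s. f s - g s)" by (intro continuous_intros assms)
    fix x
    show "\<exists>e>0. \<forall>y. y \<in> UNIV \<and> f y - g y \<noteq> f x - g x \<longrightarrow> e \<le> norm (f y - g y - (f x - g x))"
    proof (intro exI[of _ "2 * pi"] conjI allI impI)
      fix y assume ne: "y \<in> UNIV \<and> f y - g y \<noteq> f x - g x"
      have "exp (f y - g y) = exp (f x - g x)" by (simp add: exp_diff assms(3))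
      then obtain n :: int where n: "f y - g y = f x - g x + of_int (2 * n) * pi * \<i>" using exp_eq by blast
      then have "n \<noteq> 0" using ne by auto
      then have "1 \<le> \<bar>of_int n :: real\<bar>" by linarith
      then have "2 * pi * 1 \<le> 2 * pi * \<bar>of_int n\<bar>" by (intro mult_left_mono) auto
      then show "2 * pi \<le> norm (f y - g y - (f x - g x))"
        using n by (simp add: norm_mult mult.commute mult.left_commute)
    qed simp
  qed
  then obtain k where k: "\<forall>s. f s - g s = k" unfolding constant_on_def by blast
  have "f s = g s + k" for s using k[rule_format, of s] by (simp add: algebra_simps)
  then show ?thesis by (rule that)
qed

text \<open>A global logarithm \<open>l\<close> of \<open>h\<close> differs from the given logarithm
  \<open>S j\<close> along the curve only by a constant \<open>k j\<close>. The Lindelof argument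
  forces the limits of \<open>l\<close> along all curves to agree at either end; subtracting the two
  ends eliminates \<open>k j\<close>.\<close>

lemma log_increment_eq:
  assumes hol: "h holomorphic_on unit_disc" and bdd: "\<And>z. z \<in> unit_disc \<Longrightarrow> norm (h z) \<le> K"
    and nz: "\<And>z. z \<in> unit_disc \<Longrightarrow> h z \<noteq> 0"
    and \<sigma>: "\<sigma> \<in> unit_circle" and \<tau>: "\<tau> \<in> cball 0 1"
    and \<Gamma>: "\<And>j. continuous_on UNIV (\<Gamma> j)" "\<And>j s. \<Gamma> j s \<in> unit_disc"
      "\<And>j. (\<Gamma> j \<longlongrightarrow> \<sigma>) at_bot" "\<And>j. (\<Gamma> j \<longlongrightarrow> \<tau>) at_top"
    and S: "\<And>j. continuous_on UNIV (S j :: real \<Rightarrow> complex)" "\<And>j s. exp (S j s) = h (\<Gamma> j s)"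
      "\<And>j. (S j \<longlongrightarrow> A j) at_bot" "\<And>j. (S j \<longlongrightarrow> B j) at_top"
    and eq: "\<And>i j. exp (A i) = exp (A j)" "\<And>i j. exp (B i) = exp (B j)"
  shows "B i - A i = B j - (A j :: complex)"
proof -
  obtain l where l: "l holomorphic_on unit_disc" "\<And>z. z \<in> unit_disc \<Longrightarrow> exp (l z) = h z"
    using holomorphic_logarithm_exists[OF convex_ball open_ball hol nz, of 0] by auto
  have Re_l: "Re (l z) \<le> ln K" if "z \<in> unit_disc" for z
  proof -
    have "exp (Re (l z)) \<le> K" using bdd[OF that] l(2)[OF that] norm_exp_eq_Re by metis
    moreover from this have "0 < K" using exp_gt_zero less_le_trans by blast
    ultimately show ?thesis by (simp add: ln_ge_iff)
  qed
  have contl: "continuous_on UNIV (\<lambda>s. l (\<Gamma> j s))" for j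
    by (rule continuous_on_compose2[OF holomorphic_on_imp_continuous_on[OF l(1)] \<Gamma>(1)]) (use \<Gamma>(2) in auto)
  have "\<exists>k. \<forall>s. l (\<Gamma> j s) = S j s + k" for j
    using exp_const_diff[OF contl[of j] S(1)[of j]] l(2) \<Gamma>(2) S(2) by metis
  then obtain k where k: "\<And>j s. l (\<Gamma> j s) = S j s + k j" by metis
  have exp_k: "exp (k j) = 1" for j
  proof -
    have "exp (S j 0) * exp (k j) = exp (S j 0)"
      using k[of j 0] l(2)[OF \<Gamma>(2)[of j 0]] S(2)[of j 0] by (metis exp_add)
    then show ?thesis by simp
  qed
  have lim_bot: "((\<lambda>s. l (\<Gamma> j s)) \<longlongrightarrow> A j + k j) at_bot" for j
    unfolding k by (intro tendsto_intros S)
  have lim_top: "((\<lambda>s. l (\<Gamma> j s)) \<longlongrightarrow> B j + k j) at_top" for j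
    unfolding k by (intro tendsto_intros S)
  \<comment> \<open>Time is reversed because \<open>Lindelof_log\<close> concerns curves that tend
    to the boundary point at \<open>at_top\<close>.\<close>
  have cont_mirror: "continuous_on UNIV (\<lambda>s. \<Gamma> n (- s))" for n
    by (rule continuous_on_compose2[OF \<Gamma>(1)]) (auto intro!: continuous_intros)
  have lim_mirror: "((\<lambda>s. \<Gamma> n (- s)) \<longlongrightarrow> \<sigma>) at_top" for n
    by (rule filterlim_compose[OF \<Gamma>(3) filterlim_uminus_at_bot_at_top])
  have lim_l_mirror: "((\<lambda>s. l (\<Gamma> n (- s))) \<longlongrightarrow> A n + k n) at_top" for n
    by (rule filterlim_compose[OF lim_bot filterlim_uminus_at_bot_at_top])
  have "A i + k i = A j + k j"
  proof (rule Lindelof_log[OF \<sigma> l(1) Re_l cont_mirror \<Gamma>(2) lim_mirror lim_l_mirror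
        cont_mirror \<Gamma>(2) lim_mirror lim_l_mirror])
    show "exp (A i + k i) = exp (A j + k j)" using eq(1)[of i j] by (simp add: exp_add exp_k)
  qed
  \<comment> \<open>If \<tau> lies in the disc, continuity of \<open>l\<close> at \<tau> suffices;
    on the circle the Lindelof argument is repeated there.\<close>
  moreover have "B i + k i = B j + k j"
  proof (cases "\<tau> \<in> unit_disc")
    case True
    have "isCont l \<tau>"
      using holomorphic_on_imp_continuous_on[OF l(1)] True by (simp add: continuous_on_eq_continuous_at)
    then have "((\<lambda>s. l (\<Gamma> n s)) \<longlongrightarrow> l \<tau>) at_top" for n
      by (rule isCont_tendsto_compose[OF _ \<Gamma>(4)])
    then have "B n + k n = l \<tau>" for n
      using lim_top[of n] tendsto_unique[OF trivial_limit_at_top_linorder] by blast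
    then show ?thesis by metis
  next
    case False
    then have "\<tau> \<in> unit_circle" using \<tau> by auto
    then show ?thesis
      by (rule Lindelof_log[OF _ l(1) Re_l \<Gamma>(1,2,4) lim_top \<Gamma>(1,2,4) lim_top])
        (use eq(2)[of i j] in \<open>simp_all add: exp_add exp_k\<close>)
  qed
  ultimately have "(B i + k i) - (A i + k i) = (B j + k j) - (A j + k j)" by simp
  then show ?thesis by simp
qed

section \<open>The Jordan curve formed by two orbits\<close>

context disc_semigroup
begin

context
  fixes \<Gamma> :: "bool \<Rightarrow> real \<Rightarrow> complex" and \<sigma> \<tau> :: complex
  assumes dw: "denjoy_wolff_point \<phi> \<tau>" and \<sigma>: "\<sigma> \<in> unit_circle"
    and orb: "\<And>j. full_orbit (\<Gamma> j)" and lim: "\<And>j. (\<Gamma> j \<longlongrightarrow> \<sigma>) at_bot"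
begin

lemma winding_log:
  assumes "w \<noteq> \<sigma>" "w \<noteq> \<tau>" "\<And>j. w \<notin> range (\<Gamma> j)"
  obtains Q A B where "\<And>j. continuous_on UNIV (Q j)" "\<And>j s. exp (Q j s) = \<Gamma> j s - w"
    "\<And>j. (Q j \<longlongrightarrow> A j) at_bot" "\<And>j. (Q j \<longlongrightarrow> B j) at_top"
    "\<And>j. exp (A j) = \<sigma> - w" "\<And>j. exp (B j) = \<tau> - w"
    "\<And>j. B j - A j = 2 * of_real pi * \<i> * winding_number (line_path (\<Gamma> j) \<sigma> \<tau>) w"
proof -
  have "\<exists>Q A B. continuous_on UNIV Q \<and> (\<forall>s. exp (Q s) = \<Gamma> j s - w) \<and>
    (Q \<longlongrightarrow> A) at_bot \<and> (Q \<longlongrightarrow> B) at_top \<and> exp A = \<sigma> - w \<and> exp B = \<tau> - w \<and>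
    B - A = 2 * of_real pi * \<i> * winding_number (line_path (\<Gamma> j) \<sigma> \<tau>) w" for j
    by (rule winding_number_line_path[OF full_orbitD(1)[OF orb] lim full_orbit_tendsto[OF dw orb] assms])
      blast
  then obtain Q A B where "\<And>j. continuous_on UNIV (Q j) \<and> (\<forall>s. exp (Q j s) = \<Gamma> j s - w) \<and>
    (Q j \<longlongrightarrow> A j) at_bot \<and> (Q j \<longlongrightarrow> B j) at_top \<and> exp (A j) = \<sigma> - w \<and> exp (B j) = \<tau> - w \<and>
    B j - A j = 2 * of_real pi * \<i> * winding_number (line_path (\<Gamma> j) \<sigma> \<tau>) w"
    by metis
  then show ?thesis by (intro that[of Q A B]) simp_all
qed

lemma shift_tendsto:
  fixes Q :: "real \<Rightarrow> complex"
  shows "(Q \<longlongrightarrow> A) at_bot \<Longrightarrow> ((\<lambda>s. Q (s + t)) \<longlongrightarrow> A) at_bot"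
    and "(Q \<longlongrightarrow> B) at_top \<Longrightarrow> ((\<lambda>s. Q (s + t)) \<longlongrightarrow> B) at_top"
proof -
  have bot: "filterlim (\<lambda>s. s + t) at_bot at_bot"
    unfolding filterlim_at_bot eventually_at_bot_linorder by (metis add.commute le_diff_eq)
  have top: "filterlim (\<lambda>s. s + t) at_top at_top"
    unfolding filterlim_at_top eventually_at_top_linorder by (metis add.commute diff_le_eq)
  show "(Q \<longlongrightarrow> A) at_bot \<Longrightarrow> ((\<lambda>s. Q (s + t)) \<longlongrightarrow> A) at_bot"
    by (rule filterlim_compose[OF _ bot])
  show "(Q \<longlongrightarrow> B) at_top \<Longrightarrow> ((\<lambda>s. Q (s + t)) \<longlongrightarrow> B) at_top"
    by (rule filterlim_compose[OF _ top])
qed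

lemma tau_cball: "\<tau> \<in> cball 0 1"
  using dw by (simp add: denjoy_wolff_point_def)

text \<open>If \<open>w\<close> is omitted, \<open>\<phi> t - w\<close> is zero-free. Along
  \<open>\<Gamma> j\<close> it has the logarithm \<open>Q j (s + t)\<close>, where
  \<open>Q j\<close> is a logarithm of \<open>\<Gamma> j - w\<close>; the shift does not alter the
  limits at the two ends.\<close>

lemma winding_eq_outside_image:
  assumes t: "0 \<le> t" and w: "w \<notin> \<phi> t ` unit_disc"
    and wJ: "w \<noteq> \<sigma>" "w \<noteq> \<tau>" "\<And>j. w \<notin> range (\<Gamma> j)"
  shows "winding_number (line_path (\<Gamma> i) \<sigma> \<tau>) w = winding_number (line_path (\<Gamma> j) \<sigma> \<tau>) w"
proof -
  obtain Q A B where Q: "\<And>j. continuous_on UNIV (Q j)" "\<And>j s. exp (Q j s) = \<Gamma> j s - w"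
    "\<And>j. (Q j \<longlongrightarrow> A j) at_bot" "\<And>j. (Q j \<longlongrightarrow> B j) at_top"
    "\<And>j. exp (A j) = \<sigma> - w" "\<And>j. exp (B j) = \<tau> - w"
    "\<And>j. B j - A j = 2 * of_real pi * \<i> * winding_number (line_path (\<Gamma> j) \<sigma> \<tau>) w"
    using winding_log[OF wJ] by blast
  have "B i - A i = B j - A j"
  proof (rule log_increment_eq[where h = "\<lambda>z. \<phi> t z - w" and K = "1 + norm w" and \<sigma> = \<sigma> and \<tau> = \<tau>
        and \<Gamma> = \<Gamma> and S = "\<lambda>j s. Q j (s + t)"])
    show "(\<lambda>z. \<phi> t z - w) holomorphic_on unit_disc" by (intro holomorphic_intros hol t)
    show "norm (\<phi> t z - w) \<le> 1 + norm w" if "z \<in> unit_disc" for z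
      using norm_triangle_ineq4[of "\<phi> t z" w] maps[OF t that] by simp
    show "\<phi> t z - w \<noteq> 0" if "z \<in> unit_disc" for z using w that by auto
    show "continuous_on UNIV (\<lambda>s. Q j (s + t))" for j
      by (rule continuous_on_compose2[OF Q(1)]) (auto intro!: continuous_intros)
    show "exp (Q j (s + t)) = \<phi> t (\<Gamma> j s) - w" for j s
      by (simp add: Q(2) full_orbitD(3)[OF orb t])
    show "((\<lambda>s. Q j (s + t)) \<longlongrightarrow> A j) at_bot" for j by (rule shift_tendsto(1)[OF Q(3)])
    show "((\<lambda>s. Q j (s + t)) \<longlongrightarrow> B j) at_top" for j by (rule shift_tendsto(2)[OF Q(4)])
  qed (simp_all add: \<sigma>[simplified] tau_cball[simplified] Q full_orbitD(1)[OF orb] full_orbitD(2)[OF orb, simplified]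
      lim full_orbit_tendsto[OF dw orb])
  then show ?thesis by (simp add: Q(7))
qed

text \<open>Injectivity makes the difference quotient of \<open>\<phi> t\<close> at
  \<open>z\<close>, with its removable singularity filled, zero-free. Its logarithm along
  \<open>\<Gamma> j\<close> is \<open>Q j (s + t) - R j s\<close>, so its increment is the change in
  winding number from \<open>z\<close> to \<open>\<phi> t z\<close>.\<close>

lemma winding_diff_invariant:
  assumes t: "0 \<le> t" and z: "z \<in> unit_disc"
    and zJ: "z \<noteq> \<sigma>" "z \<noteq> \<tau>" "\<And>j. z \<notin> range (\<Gamma> j)"
    and wJ: "\<phi> t z \<noteq> \<sigma>" "\<phi> t z \<noteq> \<tau>" "\<And>j. \<phi> t z \<notin> range (\<Gamma> j)"
  shows "winding_number (line_path (\<Gamma> i) \<sigma> \<tau>) (\<phi> t z) - winding_number (line_path (\<Gamma> j) \<sigma> \<tau>) (\<phi> t z) =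
    winding_number (line_path (\<Gamma> i) \<sigma> \<tau>) z - winding_number (line_path (\<Gamma> j) \<sigma> \<tau>) z"
proof -
  obtain Q A B where Q: "\<And>j. continuous_on UNIV (Q j)" "\<And>j s. exp (Q j s) = \<Gamma> j s - \<phi> t z"
    "\<And>j. (Q j \<longlongrightarrow> A j) at_bot" "\<And>j. (Q j \<longlongrightarrow> B j) at_top"
    "\<And>j. exp (A j) = \<sigma> - \<phi> t z" "\<And>j. exp (B j) = \<tau> - \<phi> t z"
    "\<And>j. B j - A j = 2 * of_real pi * \<i> * winding_number (line_path (\<Gamma> j) \<sigma> \<tau>) (\<phi> t z)"
    using winding_log[OF wJ] by blast
  obtain R C D where R: "\<And>j. continuous_on UNIV (R j)" "\<And>j s. exp (R j s) = \<Gamma> j s - z"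
    "\<And>j. (R j \<longlongrightarrow> C j) at_bot" "\<And>j. (R j \<longlongrightarrow> D j) at_top"
    "\<And>j. exp (C j) = \<sigma> - z" "\<And>j. exp (D j) = \<tau> - z"
    "\<And>j. D j - C j = 2 * of_real pi * \<i> * winding_number (line_path (\<Gamma> j) \<sigma> \<tau>) z"
    using winding_log[OF zJ] by blast
  define h where "h = (\<lambda>u. if u = z then deriv (\<phi> t) z else (\<phi> t u - \<phi> t z) / (u - z))"
  have holh: "h holomorphic_on unit_disc"
    unfolding h_def by (rule pole_lemma[OF hol[OF t]]) (use z in simp)
  \<comment> \<open>A compact disc around \<open>z\<close> bounds \<open>h\<close> near
    \<open>z\<close>; outside it the denominator exceeds \<open>r\<close> and the numerator is at
    most 2.\<close>
  obtain r where r: "0 < r" "cball z r \<subseteq> unit_disc"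
    using z open_contains_cball[of unit_disc] open_ball by blast
  have "bounded (h ` cball z r)"
    by (intro compact_imp_bounded compact_continuous_image continuous_on_subset[OF holomorphic_on_imp_continuous_on[OF holh] r(2)])
      simp
  then obtain K where K: "\<And>u. u \<in> cball z r \<Longrightarrow> norm (h u) \<le> K"
    unfolding bounded_iff by blast
  have "(B i - D i) - (A i - C i) = (B j - D j) - (A j - C j)"
  proof (rule log_increment_eq[where h = h and K = "max K (2 / r)" and \<sigma> = \<sigma> and \<tau> = \<tau>
        and \<Gamma> = \<Gamma> and S = "\<lambda>j s. Q j (s + t) - R j s"])
    show "h holomorphic_on unit_disc" by (rule holh)
    show "norm (h u) \<le> max K (2 / r)" if u: "u \<in> unit_disc" for u
    proof (cases "u \<in> cball z r")
      case True then show ?thesis using K[OF True] by simp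
    next
      case False
      then have d: "r < norm (u - z)" "u \<noteq> z" using r(1) by (auto simp: dist_norm norm_minus_commute)
      have "norm (\<phi> t u - \<phi> t z) \<le> 2"
        using norm_triangle_ineq4[of "\<phi> t u" "\<phi> t z"] maps[OF t u] maps[OF t z] by simp
      then have "norm (h u) \<le> 2 / r"
        using d r(1) unfolding h_def by (auto simp: norm_divide intro!: frac_le)
      then show ?thesis by simp
    qed
    show "h u \<noteq> 0" if u: "u \<in> unit_disc" for u
    proof (cases "u = z")
      case True
      then show ?thesis
        using holomorphic_injective_imp_regular[OF hol[OF t] open_ball inj[OF t] z] by (simp add: h_def)
    next
      case False
      then have "\<phi> t u \<noteq> \<phi> t z" using inj_onD[OF inj[OF t] _ u z] by blast
      then show ?thesis using False by (simp add: h_def)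
    qed
    show "continuous_on UNIV (\<lambda>s. Q j (s + t) - R j s)" for j
      by (intro continuous_on_diff R continuous_on_compose2[OF Q(1)]) (auto intro!: continuous_intros)
    show "exp (Q j (s + t) - R j s) = h (\<Gamma> j s)" for j s
    proof -
      have "\<Gamma> j s \<noteq> z" using zJ(3)[of j] by auto
      then show ?thesis by (simp add: exp_diff Q(2) R(2) h_def full_orbitD(3)[OF orb t])
    qed
    show "((\<lambda>s. Q j (s + t) - R j s) \<longlongrightarrow> A j - C j) at_bot" for j
      by (intro tendsto_diff shift_tendsto(1)[OF Q(3)] R(3))
    show "((\<lambda>s. Q j (s + t) - R j s) \<longlongrightarrow> B j - D j) at_top" for j
      by (intro tendsto_diff shift_tendsto(2)[OF Q(4)] R(4))
  qed (simp_all add: \<sigma>[simplified] tau_cball[simplified] exp_diff Q(5,6) R(5,6) full_orbitD(1)[OF orb]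
      full_orbitD(2)[OF orb, simplified] lim full_orbit_tendsto[OF dw orb])
  then have "(B i - A i) - (B j - A j) = (D i - C i) - (D j - C j)" by (simp add: algebra_simps)
  then have "2 * of_real pi * \<i> * (winding_number (line_path (\<Gamma> i) \<sigma> \<tau>) (\<phi> t z) - winding_number (line_path (\<Gamma> j) \<sigma> \<tau>) (\<phi> t z)) =
    2 * of_real pi * \<i> * (winding_number (line_path (\<Gamma> i) \<sigma> \<tau>) z - winding_number (line_path (\<Gamma> j) \<sigma> \<tau>) z)"
    by (simp only: Q(7) R(7) right_diff_distrib)
  then show ?thesis by simp
qed

end

lemma full_orbits_meet:
  assumes dw: "denjoy_wolff_point \<phi> \<tau>" and sr: "super_repelling_fixed_point \<phi> \<sigma>"
    and 1: "full_orbit \<Gamma>\<^sub>1" "(\<Gamma>\<^sub>1 \<longlongrightarrow> \<sigma>) at_bot" and 2: "full_orbit \<Gamma>\<^sub>2" "(\<Gamma>\<^sub>2 \<longlongrightarrow> \<sigma>) at_bot"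
  obtains a b where "\<Gamma>\<^sub>1 a = \<Gamma>\<^sub>2 b"
proof (rule ccontr)
  assume no: "\<not> thesis"
  have disj: "\<Gamma>\<^sub>1 a \<noteq> \<Gamma>\<^sub>2 b" for a b using no that by blast
  have bfp: "boundary_fixed_point \<phi> \<sigma>" and nonreg: "\<not> boundary_regular_fixed_point \<phi> \<sigma>"
    using sr by (simp_all add: super_repelling_fixed_point_def)
  have \<sigma>: "\<sigma> \<in> unit_circle" using bfp by (simp add: boundary_fixed_point_def)
  have ne: "\<sigma> \<noteq> \<tau>" using denjoy_wolff_boundary_regular[OF dw] bfp nonreg by blast
  have \<tau>: "\<tau> \<in> cball 0 1" using dw by (simp add: denjoy_wolff_point_def)

  \<comment> \<open>The Jordan curve and its inside\<close>
  define \<Gamma> where "\<Gamma> = (\<lambda>j. if j then \<Gamma>\<^sub>1 else \<Gamma>\<^sub>2)"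
  have orb: "full_orbit (\<Gamma> j)" and lim: "(\<Gamma> j \<longlongrightarrow> \<sigma>) at_bot" for j
    using 1 2 by (simp_all add: \<Gamma>_def)
  have \<Gamma>D: "\<Gamma> j s \<in> unit_disc" for j s by (rule full_orbitD(2)[OF orb])
  have ne_\<tau>: "\<Gamma> j s \<noteq> \<tau>" for j s by (rule full_orbit_ne_denjoy_wolff[OF dw orb lim ne])
  have ne_\<sigma>: "\<Gamma> j s \<noteq> \<sigma>" for j s using \<Gamma>D[of j s] \<sigma> by auto
  define p where "p = (\<lambda>j. line_path (\<Gamma> j) \<sigma> \<tau>)"
  have path_p: "path (p j)" for j
    unfolding p_def by (rule path_line_path[OF full_orbitD(1)[OF orb] lim full_orbit_tendsto[OF dw orb]])
  have arc_p: "arc (p j)" for j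
    unfolding p_def
  proof (rule arc_line_path)
    show "path (line_path (\<Gamma> j) \<sigma> \<tau>)" using path_p[of j] by (simp add: p_def)
    show "inj (\<Gamma> j)" by (rule full_orbit_inj[OF dw orb lim ne])
    show "\<sigma> \<notin> range (\<Gamma> j)" using ne_\<sigma>[of j] by (metis rangeE)
    show "\<tau> \<notin> range (\<Gamma> j)" using ne_\<tau>[of j] by (metis rangeE)
  qed (rule ne)
  have ends_p [simp]: "pathstart (p j) = \<sigma>" "pathfinish (p j) = \<tau>" for j by (simp_all add: p_def)
  have image_p: "path_image (p j) = insert \<sigma> (insert \<tau> (range (\<Gamma> j)))" for j
    by (simp add: p_def line_path_image)
  \<comment> \<open>\<open>c\<close> runs from \<sigma> to \<tau> along \<open>\<Gamma> True\<close>
    and back along \<open>\<Gamma> False\<close>, so its winding number is the difference controlled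
    by the two winding lemmas.\<close>
  define c where "c = p True +++ reversepath (p False)"
  define J where "J = path_image c"
  have J: "J = insert \<sigma> (insert \<tau> (range (\<Gamma> True) \<union> range (\<Gamma> False)))"
    unfolding J_def c_def by (auto simp: path_image_join image_p)
  have J_orbit: "\<Gamma> j s \<in> J" for j s unfolding J by (cases j) auto
  have J_cases: "w = \<sigma> \<or> w = \<tau> \<or> (\<exists>j s. w = \<Gamma> j s)" if "w \<in> J" for w
    using that unfolding J by auto
  have notJ: "w \<noteq> \<sigma>" "w \<noteq> \<tau>" "w \<notin> range (\<Gamma> j)" if "w \<notin> J" for w j
    using that J_orbit unfolding J by auto
  have simple: "simple_path c"
    unfolding c_def
  proof (rule simple_path_join_loop)
    show "arc (p True)" "arc (reversepath (p False))" by (simp_all add: arc_p arc_reversepath)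
    show "path_image (p True) \<inter> path_image (reversepath (p False)) \<subseteq> {pathstart (p True), pathstart (reversepath (p False))}"
      using disj by (auto simp: image_p \<Gamma>_def)
  qed simp_all
  have loop: "pathfinish c = pathstart c" by (simp add: c_def)
  have wn: "winding_number c w = winding_number (p True) w - winding_number (p False) w" if "w \<notin> J" for w
  proof -
    have "w \<notin> path_image (p j)" for j using notJ[OF that] by (simp add: image_p)
    then show ?thesis unfolding c_def
      by (simp add: winding_number_join winding_number_reversepath path_p)
  qed
  define \<Omega> where "\<Omega> = inside J"
  have \<Omega>: "open \<Omega>" "connected \<Omega>" "bounded \<Omega>" "frontier \<Omega> = J" "\<Omega> \<inter> J = {}"
    and out: "\<Omega> \<union> outside J = - J"
    using Jordan_inside_outside[OF simple loop] inside_no_overlap[of J] unfolding \<Omega>_def J_def by auto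
  have closure_\<Omega>: "closure \<Omega> = \<Omega> \<union> J"
    using \<Omega>(1,4) by (metis closure_Un_frontier)
  have wn_inside: "winding_number c w \<noteq> 0" if "w \<in> \<Omega>" for w
    using simple_closed_path_norm_winding_number_inside[OF simple] that unfolding \<Omega>_def J_def by fastforce
  have wn_outside: "winding_number c w = 0" if "w \<in> outside J" for w
    using winding_number_zero_in_outside[OF simple_path_imp_path[OF simple] loop] that unfolding J_def by blast
  have "J \<subseteq> cball 0 1" unfolding J using \<sigma> \<tau> \<Gamma>D by (auto simp: less_imp_le)
  then have "\<Omega> \<subseteq> cball 0 1"
    using outside_subset_convex[OF convex_cball] out inside_Int_outside[of J] unfolding \<Omega>_def by blast
  then have \<Omega>D: "\<Omega> \<subseteq> unit_disc"
    using interior_maximal[OF _ \<Omega>(1)] by (metis interior_cball)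
  \<comment> \<open>An omitted \<open>w\<close> would have winding number 0, which is impossible
    inside a Jordan curve.\<close>
  have \<Omega>_image: "w \<in> \<phi> t ` unit_disc" if t: "0 \<le> t" and w: "w \<in> \<Omega>" for t w
  proof (rule ccontr)
    assume nw: "w \<notin> \<phi> t ` unit_disc"
    have wJ: "w \<notin> J" using w \<Omega>(5) by blast
    have "winding_number (p True) w = winding_number (p False) w"
      unfolding p_def by (rule winding_eq_outside_image[OF dw \<sigma> orb lim t nw notJ[OF wJ]])
    then show False using wn[OF wJ] wn_inside[OF w] by simp
  qed
  \<comment> \<open>Points of \<open>J\<close> in the disc are mapped into \<open>J\<close>, so
    \<open>z\<close> is off the curve; it inherits the nonzero winding number of
    \<open>\<phi> t z\<close> and cannot lie outside.\<close>
  have \<Omega>_back: "z \<in> \<Omega>" if t: "0 \<le> t" and z: "z \<in> unit_disc" and w: "\<phi> t z \<in> \<Omega>" for t z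
  proof -
    have wJ: "\<phi> t z \<notin> J" using w \<Omega>(5) by blast
    have zJ: "z \<notin> J"
    proof
      assume "z \<in> J"
      then consider "z = \<sigma>" | "z = \<tau>" | j s where "z = \<Gamma> j s" using J_cases by blast
      then have "\<phi> t z \<in> J"
      proof cases
        case 1 then show ?thesis using z \<sigma> by auto
      next
        case 2 then show ?thesis using denjoy_wolff_fixed[OF dw _ t] z by (simp add: J)
      next
        case 3 then show ?thesis using full_orbitD(3)[OF orb t] J_orbit by simp
      qed
      then show False using wJ by blast
    qed
    have "winding_number c z = winding_number c (\<phi> t z)"
      unfolding wn[OF zJ] wn[OF wJ] p_def
      by (rule winding_diff_invariant[OF dw \<sigma> orb lim t z notJ[OF zJ] notJ[OF wJ], symmetric])
    then have "winding_number c z \<noteq> 0" using wn_inside[OF w] by simp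
    then show ?thesis using wn_outside[of z] out zJ by blast
  qed

  \<comment> \<open>The backward flow on the inside\<close>
  have "\<exists>g. g holomorphic_on (\<phi> t ` unit_disc) \<and> (\<forall>z\<in>unit_disc. g (\<phi> t z) = z)" if "0 \<le> t" for t
    using holomorphic_has_inverse[OF hol[OF that] open_ball inj[OF that]] by metis
  then obtain \<psi> where hol_\<psi>: "\<And>t. 0 \<le> t \<Longrightarrow> \<psi> t holomorphic_on (\<phi> t ` unit_disc)"
    and \<psi>: "\<And>t z. 0 \<le> t \<Longrightarrow> z \<in> unit_disc \<Longrightarrow> \<psi> t (\<phi> t z) = z" by metis
  have \<psi>D: "\<psi> t w \<in> unit_disc" "\<phi> t (\<psi> t w) = w" if "0 \<le> t" "w \<in> \<phi> t ` unit_disc" for t w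
    using that \<psi> by auto
  have \<psi>_\<Omega>: "\<psi> t w \<in> \<Omega>" if "0 \<le> t" "w \<in> \<Omega>" for t w
    using \<psi>D[OF that(1) \<Omega>_image[OF that]] \<Omega>_back[OF that(1)] that(2) by simp
  have \<psi>_orbit: "\<psi> t (\<Gamma> j s) = \<Gamma> j (s - t)" if "0 \<le> t" for t j s
    using \<psi>[OF that \<Gamma>D[of j "s - t"]] full_orbitD(3)[OF orb that, of j "s - t"] by simp
  have orbit_image: "\<Gamma> j s \<in> \<phi> t ` unit_disc" if "0 \<le> t" for t j s
    using \<Gamma>D[of j "s - t"] full_orbitD(3)[OF orb that, of j "s - t"] by (metis diff_add_cancel imageI)

  \<comment> \<open>Along an orbit the backward flow is known to converge to \<sigma>; the segment
    carries this over from \<open>q\<close> to \<open>z\<close>. Taking \<open>q\<close> as a point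
    of \<open>J\<close> nearest to \<open>z\<close> keeps the rest of the segment in \<Omega>, and
    starting with \<open>z\<close> close to a point of \<open>\<Gamma> True\<close> keeps
    \<open>q\<close> inside the disc and away from \<tau>, hence on an orbit.\<close>
  obtain z q j a where zq: "z \<in> \<Omega>" "q = \<Gamma> j a" "closed_segment z q \<subseteq> \<Omega> \<union> {q}"
  proof -
    let ?x = "\<Gamma> True 0"
    have "?x \<in> unit_disc - {\<tau>}" using \<Gamma>D ne_\<tau> by blast
    then obtain d where d: "0 < d" "ball ?x d \<subseteq> unit_disc - {\<tau>}"
      using openE[OF open_Diff[OF open_ball closed_singleton]] by metis
    have "?x \<in> closure \<Omega>" using closure_\<Omega> J_orbit by blast
    then obtain z where z: "z \<in> \<Omega>" "dist z ?x < d / 2"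
      using d(1) unfolding closure_approachable by (metis half_gt_zero)
    have "closed J" using \<Omega>(4) frontier_closed by metis
    moreover have "J \<noteq> {}" using J by blast
    ultimately obtain q where q: "q \<in> J" "\<And>y. y \<in> J \<Longrightarrow> dist z q \<le> dist z y"
      using distance_attains_inf[of J z] by blast
    have "dist z q \<le> dist z ?x" using q(2) J_orbit by blast
    then have "dist ?x q < d" using z(2) dist_triangle[of ?x q z] by (simp add: dist_commute)
    then have "q \<in> unit_disc - {\<tau>}" using d(2) by auto
    then obtain j a where ja: "q = \<Gamma> j a" using J_cases[OF q(1)] \<sigma> by auto
    have "z \<noteq> q" using z(1) q(1) \<Omega>(5) by blast
    have ball: "ball z (dist z q) \<subseteq> \<Omega>"
    proof (rule ccontr)
      assume "\<not> ball z (dist z q) \<subseteq> \<Omega>"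
      then have "ball z (dist z q) - \<Omega> \<noteq> {}" by blast
      moreover have "z \<in> ball z (dist z q)" using \<open>z \<noteq> q\<close> by simp
      then have "ball z (dist z q) \<inter> \<Omega> \<noteq> {}" using z(1) by blast
      ultimately have "ball z (dist z q) \<inter> frontier \<Omega> \<noteq> {}"
        by (intro connected_Int_frontier connected_ball)
      then show False using \<Omega>(4) q(2) by fastforce
    qed
    have "x \<in> \<Omega> \<union> {q}" if x: "x \<in> closed_segment z q" for x
    proof (cases "x = q")
      case False
      obtain u where u: "0 \<le> u" "u \<le> 1" "x = (1 - u) *\<^sub>R z + u *\<^sub>R q" using x by (auto simp: in_segment)
      then have "u \<noteq> 1" using False by auto
      have "z - x = u *\<^sub>R (z - q)" using u(3) by (simp add: algebra_simps)
      then have "dist z x = u * dist z q" using u(1) by (simp add: dist_norm)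
      also have "\<dots> < dist z q" using u(2) \<open>u \<noteq> 1\<close> \<open>z \<noteq> q\<close> by simp
      finally show ?thesis using ball by auto
    qed simp
    then show ?thesis using that[OF z(1) ja] by blast
  qed
  let ?S = "closed_segment z q"
  have S_image: "?S \<subseteq> \<phi> t ` unit_disc" if "0 \<le> t" for t
    using zq(3) \<Omega>_image[OF that] orbit_image[OF that] zq(2) by blast
  have q_lim: "((\<lambda>t. \<psi> t q) \<longlongrightarrow> \<sigma>) at_top"
  proof (rule Lim_transform_eventually)
    have "filterlim (\<lambda>t. a - t) at_bot (at_top :: real filter)"
      unfolding filterlim_at_bot eventually_at_top_linorder by (metis diff_le_eq add.commute)
    then show "((\<lambda>t. \<Gamma> j (a - t)) \<longlongrightarrow> \<sigma>) at_top" by (rule filterlim_compose[OF lim])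
    show "\<forall>\<^sub>F t in at_top. \<Gamma> j (a - t) = \<psi> t q"
      using eventually_ge_at_top[of 0] by eventually_elim (simp add: zq(2) \<psi>_orbit)
  qed
  have z_lim: "((\<lambda>t. \<psi> t z) \<longlongrightarrow> \<sigma>) at_top"
    unfolding tendsto_iff
  proof (intro allI impI)
    fix e :: real assume e: "0 < e"
    define r where "r = min e (dist \<sigma> \<tau>) / 2"
    have r: "0 < r" "r < e" "r < dist \<sigma> \<tau>" using e ne by (auto simp: r_def min_def)
    \<comment> \<open>The closure of \<Omega> meets the unit circle at most in \<sigma> and \<tau>,
      both off this sphere as \<open>0 < r < dist \<sigma> \<tau>\<close>. So \<open>P\<close> is
      compact in the disc and the forward flow carries it uniformly to \<tau>.\<close>
    define P where "P = closure \<Omega> \<inter> sphere \<sigma> r"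
    have P: "compact P" unfolding P_def
      using \<Omega>(3) by (intro compact_Int_closed) (simp_all add: compact_closure)
    have PD: "P \<subseteq> unit_disc"
    proof
      fix x assume x: "x \<in> P"
      then have "x \<noteq> \<sigma>" "x \<noteq> \<tau>" using r by (auto simp: P_def)
      then show "x \<in> unit_disc" using x closure_\<Omega> \<Omega>D J_cases[of x] \<Gamma>D unfolding P_def by blast
    qed
    have "\<tau> \<notin> ?S"
    proof
      assume "\<tau> \<in> ?S"
      then have "\<tau> \<in> \<Omega> \<or> \<tau> = q" using zq(3) by blast
      then show False using \<Omega>(5) J zq(2) ne_\<tau> by blast
    qed
    then obtain d where d: "0 < d" "ball \<tau> d \<subseteq> - ?S"
      using openE[of "- ?S" \<tau>] closed_segment[of z q] by (metis ComplI open_Compl)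
    have "\<forall>\<^sub>F t in at_top. \<forall>x\<in>P. dist (\<phi> t x) \<tau> < d"
      by (rule denjoy_wolff_uniform[OF dw P PD d(1)])
    then show "\<forall>\<^sub>F t in at_top. dist (\<psi> t z) \<sigma> < e"
      using tendstoD[OF q_lim r(1)] eventually_ge_at_top[of 0]
    proof eventually_elim
      case (elim t)
      have "dist (\<psi> t z) \<sigma> < r"
      proof (rule ccontr)
        assume far: "\<not> dist (\<psi> t z) \<sigma> < r"
        \<comment> \<open>If \<open>\<psi> t z\<close> were far from \<sigma>, the image of the
          segment would join it to \<open>\<psi> t q\<close>, which is near \<sigma>, and cross
          \<open>P\<close> at some \<open>\<psi> t s\<close>. Flowing forward puts \<open>s\<close>
          near \<tau>, but the segment keeps a positive distance from \<tau>.\<close>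
        have "connected (\<psi> t ` ?S)"
          by (rule connected_continuous_image[OF continuous_on_subset[OF
                  holomorphic_on_imp_continuous_on[OF hol_\<psi>[OF elim(3)]] S_image[OF elim(3)]]
                connected_segment(1)])
        moreover have "\<psi> t q \<in> \<psi> t ` ?S \<inter> ball \<sigma> r" using elim(2) by (simp add: dist_commute)
        moreover have "\<psi> t z \<in> \<psi> t ` ?S - ball \<sigma> r" using far by (simp add: dist_commute)
        ultimately have "\<psi> t ` ?S \<inter> frontier (ball \<sigma> r) \<noteq> {}"
          by (intro connected_Int_frontier) blast+
        then have "\<psi> t ` ?S \<inter> sphere \<sigma> r \<noteq> {}" using frontier_ball[OF r(1), of \<sigma>] by simp
        then obtain s where s: "s \<in> ?S" "\<psi> t s \<in> sphere \<sigma> r" by blast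
        have "\<psi> t s \<in> \<Omega> \<union> J"
          using subsetD[OF zq(3) s(1)] zq(2) \<psi>_\<Omega>[OF elim(3)] \<psi>_orbit[OF elim(3), of j a] J_orbit by auto
        then have "\<psi> t s \<in> P" using s(2) by (simp add: P_def closure_\<Omega>)
        then have "dist (\<phi> t (\<psi> t s)) \<tau> < d" using elim(1) by blast
        then have "s \<in> ball \<tau> d"
          using \<psi>D(2)[OF elim(3) subsetD[OF S_image[OF elim(3)] s(1)]] by (simp add: dist_commute)
        then show False using d(2) s(1) by blast
      qed
      then show ?case using r(2) by linarith
    qed
  qed

  \<comment> \<open>Bounded hyperbolic steps along backward orbits\<close>
  have "boundary_regular_fixed_point \<phi> \<sigma>"
  proof (rule regular_if_bounded_hyperbolic_step[OF semi bfp])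
    fix t :: real assume t: "0 \<le> t"
    define g where "g = (\<lambda>n w. cayley \<sigma> (\<psi> (real n) w))"
    have \<Omega>_sub: "\<Omega> \<subseteq> \<phi> s ` unit_disc" if "0 \<le> s" for s using \<Omega>_image[OF that] by blast
    have \<psi>_\<Omega>_D: "\<psi> (real n) w \<in> unit_disc" if "w \<in> \<Omega>" for n w
      using \<psi>_\<Omega>[of "real n", OF _ that] \<Omega>D by auto
    have holg: "g n holomorphic_on \<Omega>" for n
    proof -
      have "(cayley \<sigma> \<circ> \<psi> (real n)) holomorphic_on \<Omega>"
        by (rule holomorphic_on_compose_gen[OF holomorphic_on_subset[OF hol_\<psi> \<Omega>_sub] cayley_holomorphic[OF \<sigma>]])
          (use \<psi>_\<Omega>_D in auto)
      then show ?thesis by (simp add: g_def o_def)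
    qed
    have posg: "0 < Re (g n w)" if "w \<in> \<Omega>" for n w
      unfolding g_def by (intro Re_cayley_pos[OF \<sigma>] \<psi>_\<Omega>_D that)
    \<comment> \<open>The sequence is \<open>\<psi> n y\<close>, and \<open>\<phi> t\<close> takes
      it to \<open>\<psi> n z\<close>. Both come from fixed points \<open>y\<close> and
      \<open>z\<close> of the connected domain \<Omega> under the same maps \<open>\<psi> n\<close>,
      so one constant \<open>M\<close> serves all \<open>n\<close>.\<close>
    define y where "y = \<psi> t z"
    have y: "y \<in> \<Omega>" unfolding y_def by (rule \<psi>_\<Omega>[OF t zq(1)])
    obtain M where M: "0 \<le> M" "\<And>n. half_plane_near M (g n y) (g n z)"
      by (rule half_plane_near_family[of \<Omega> g, OF \<Omega>(1,2) holg posg y zq(1)]) (assumption, rule that)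
    have v: "\<psi> (real n) y = \<psi> (t + real n) z" "\<phi> t (\<psi> (real n) y) = \<psi> (real n) z" for n
    proof -
      define u where "u = \<psi> (real n) y"
      have uD: "u \<in> unit_disc" unfolding u_def by (rule \<psi>_\<Omega>_D[OF y])
      have "\<phi> (real n) u = y" unfolding u_def by (rule \<psi>D(2)[OF _ \<Omega>_image[OF _ y]]) simp_all
      moreover have "\<phi> t y = z" unfolding y_def by (rule \<psi>D(2)[OF t \<Omega>_image[OF t zq(1)]])
      ultimately have "\<phi> (t + real n) u = z" using add[OF t _ uD, of "real n"] by simp
      then show "\<psi> (real n) y = \<psi> (t + real n) z" using \<psi>[OF _ uD, of "t + real n"] t by (simp add: u_def)
      have "\<phi> (real n) (\<phi> t u) = z"
        using \<open>\<phi> (t + real n) u = z\<close> add[OF _ t uD, of "real n"] by (simp add: add.commute)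
      then show "\<phi> t (\<psi> (real n) y) = \<psi> (real n) z"
        using \<psi>[OF _ maps[OF t uD], of "real n"] by (simp add: u_def)
    qed
    have "filterlim (\<lambda>n. t + real n) at_top sequentially"
      by (rule filterlim_tendsto_add_at_top[OF tendsto_const filterlim_real_sequentially])
    then have "(\<lambda>n. \<psi> (real n) y) \<longlonglongrightarrow> \<sigma>"
      unfolding v(1) by (rule filterlim_compose[OF z_lim])
    then show "\<exists>v M. 0 \<le> M \<and> (\<forall>n::nat. v n \<in> unit_disc) \<and> v \<longlonglongrightarrow> \<sigma> \<and>
        (\<forall>n. half_plane_near M (cayley \<sigma> (v n)) (cayley \<sigma> (\<phi> t (v n))))"
      using M \<psi>_\<Omega>_D[OF y]
      by (intro exI[of _ "\<lambda>n. \<psi> (real n) y"] exI[of _ M]) (simp add: g_def v(2))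
  qed
  then show False using nonreg by blast
qed

lemma full_orbits_shift:
  assumes dw: "denjoy_wolff_point \<phi> \<tau>" and sr: "super_repelling_fixed_point \<phi> \<sigma>"
    and 1: "full_orbit \<Gamma>\<^sub>1" "(\<Gamma>\<^sub>1 \<longlongrightarrow> \<sigma>) at_bot" and 2: "full_orbit \<Gamma>\<^sub>2" "(\<Gamma>\<^sub>2 \<longlongrightarrow> \<sigma>) at_bot"
  obtains c where "\<And>t. \<Gamma>\<^sub>2 t = \<Gamma>\<^sub>1 (t + c)"
proof -
  obtain a b where ab: "\<Gamma>\<^sub>1 a = \<Gamma>\<^sub>2 b" using full_orbits_meet[OF assms] by blast
  have "\<Gamma>\<^sub>2 t = \<Gamma>\<^sub>1 (t + (a - b))" for t
    using full_orbits_coincide[OF 1(1) 2(1) ab, of "t - b"] by (simp add: algebra_simps)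
  then show ?thesis by (rule that)
qed

end

theorem proposition4p21:
  fixes \<phi> :: "real \<Rightarrow> complex \<Rightarrow> complex" and \<tau> \<sigma> :: complex
  assumes "holomorphic_semigroup \<phi>"
    and "\<not> is_group \<phi>"
    and "denjoy_wolff_point \<phi> \<tau>"
    and "super_repelling_fixed_point \<phi> \<sigma>"
  shows "(\<forall>\<gamma>\<^sub>1 \<gamma>\<^sub>2. backward_orbit \<phi> \<gamma>\<^sub>1 \<and> (\<gamma>\<^sub>1 \<longlongrightarrow> \<sigma>) at_top \<and>
                  backward_orbit \<phi> \<gamma>\<^sub>2 \<and> (\<gamma>\<^sub>2 \<longlongrightarrow> \<sigma>) at_top \<longrightarrow>
            \<gamma>\<^sub>1 ` {0..} \<subseteq> \<gamma>\<^sub>2 ` {0..} \<or> \<gamma>\<^sub>2 ` {0..} \<subseteq> \<gamma>\<^sub>1 ` {0..}) \<and>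
         (\<forall>\<gamma>\<^sub>1 \<gamma>\<^sub>2. maximal_invariant_curve \<phi> \<tau> (-\<infinity>) \<gamma>\<^sub>1 \<sigma> \<and>
                  maximal_invariant_curve \<phi> \<tau> (-\<infinity>) \<gamma>\<^sub>2 \<sigma> \<longrightarrow>
            (\<exists>c::real. \<forall>t. \<gamma>\<^sub>2 t = \<gamma>\<^sub>1 (t + c)))"
proof -
  interpret disc_semigroup \<phi> by unfold_locales (rule assms(1))
  define ext where "ext = (\<lambda>\<gamma> s. if s \<le> 0 then \<gamma> (- s) else \<phi> s (\<gamma> 0))"
  have nested: "\<gamma>\<^sub>1 ` {0..} \<subseteq> \<gamma>\<^sub>2 ` {0..} \<or> \<gamma>\<^sub>2 ` {0..} \<subseteq> \<gamma>\<^sub>1 ` {0..}"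
    if \<gamma>: "backward_orbit \<phi> \<gamma>\<^sub>1" "(\<gamma>\<^sub>1 \<longlongrightarrow> \<sigma>) at_top" "backward_orbit \<phi> \<gamma>\<^sub>2" "(\<gamma>\<^sub>2 \<longlongrightarrow> \<sigma>) at_top"
    for \<gamma>\<^sub>1 \<gamma>\<^sub>2
  proof -
    have lim: "(ext \<gamma> \<longlongrightarrow> \<sigma>) at_bot" if "(\<gamma> \<longlongrightarrow> \<sigma>) at_top" for \<gamma> :: "real \<Rightarrow> complex"
    proof (rule Lim_transform_eventually)
      show "((\<lambda>s. \<gamma> (- s)) \<longlongrightarrow> \<sigma>) at_bot"
        by (rule filterlim_compose[OF that filterlim_uminus_at_top_at_bot])
      show "\<forall>\<^sub>F s in at_bot. \<gamma> (- s) = ext \<gamma> s"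
        using eventually_le_at_bot[of 0] by eventually_elim (simp add: ext_def)
    qed
    have orbit: "full_orbit (ext \<gamma>)" if "backward_orbit \<phi> \<gamma>" for \<gamma>
      using full_orbit_extend[OF that] by (simp add: ext_def)
    obtain c where c: "\<And>t. ext \<gamma>\<^sub>2 t = ext \<gamma>\<^sub>1 (t + c)"
      using full_orbits_shift[OF assms(3,4) orbit[OF \<gamma>(1)] lim[OF \<gamma>(2)] orbit[OF \<gamma>(3)] lim[OF \<gamma>(4)]]
      by blast
    have ext: "ext \<gamma> (- t) = \<gamma> t" if "0 \<le> t" for \<gamma> t using that by (simp add: ext_def)
    show ?thesis
    \<comment> \<open>The sign of the time shift decides the inclusion: for \<open>c \<le> 0\<close>
      the orbit \<open>\<gamma>\<^sub>2\<close> is \<open>\<gamma>\<^sub>1\<close> started at time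
      \<open>- c\<close>, otherwise \<open>\<gamma>\<^sub>1\<close> is
      \<open>\<gamma>\<^sub>2\<close> started at time \<open>c\<close>.\<close>
    proof (cases "c \<le> 0")
      case True
      have "\<gamma>\<^sub>2 t = \<gamma>\<^sub>1 (t - c)" if "0 \<le> t" for t
        using c[of "- t"] ext[of t \<gamma>\<^sub>2] ext[of "t - c" \<gamma>\<^sub>1] that True by simp
      then show ?thesis using True by force
    next
      case False
      have "\<gamma>\<^sub>1 t = \<gamma>\<^sub>2 (t + c)" if "0 \<le> t" for t
        using c[of "- (t + c)"] ext[of t \<gamma>\<^sub>1] ext[of "t + c" \<gamma>\<^sub>2] that False by simp
      then show ?thesis using False by force
    qed
  qed
  have unique: "\<exists>c::real. \<forall>t. \<gamma>\<^sub>2 t = \<gamma>\<^sub>1 (t + c)"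
    if \<gamma>: "maximal_invariant_curve \<phi> \<tau> (-\<infinity>) \<gamma>\<^sub>1 \<sigma>" "maximal_invariant_curve \<phi> \<tau> (-\<infinity>) \<gamma>\<^sub>2 \<sigma>" for \<gamma>\<^sub>1 \<gamma>\<^sub>2
  proof -
    have "full_orbit \<gamma>" "(\<gamma> \<longlongrightarrow> \<sigma>) at_bot" if "maximal_invariant_curve \<phi> \<tau> (-\<infinity>) \<gamma> \<sigma>" for \<gamma>
      using that by (auto simp: maximal_invariant_curve_def full_orbit_def ereal_tendsto_simps1)
    then show ?thesis using full_orbits_shift[OF assms(3,4)] \<gamma> by metis
  qed
  show ?thesis using nested unique by blast
qed

end
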